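(* Let $E$ be the cuspidal Weierstrass curve over $\mathbb C$, let $(e,d)$ be a pair of coprime positive integers, $n=e+d$, $\mathfrak g=\mathfrak{sl}_n(\mathbb C)$. Consider the involutive Lie algebra automorphism $\tilde\varphi:\mathfrak g\to\mathfrak g$, $A\mapsto-A^t$. Then $$(\tilde\varphi\otimes\tilde\varphi)\,r_{(E,(n,d))}=r_{(\mathfrak g,e,\omega_K)},\qquad\text{where }K=-J_{(e,d)}\text{ and }\omega_K(a,b)=\mathrm{tr}(K^t\cdot[a,b]).$$
   Context: **The matrix $J=J_{(e,d)}$.** Put $J_{(1,1)}=\begin{pmatrix}0&1\\0&0\end{pmatrix}$. If $J_{(a,b)}=\begin{pmatrix}A_1&A_2\\0&A_3\end{pmatrix}$ with $A_1$ of size $a\times a$ and $A_3$ of size $b\times b$, then $$J_{(a,a+b)}=\begin{pmatrix}0&\mathbb 1&0\\0&A_1&A_2\\0&0&A_3\end{pmatrix},\qquad J_{(a+b,b)}=\begin{pmatrix}A_1&A_2&0\\0&A_3&\mathbb 1\\0&0&0\end{pmatrix}.$$ Every coprime pair is reached from $(1,1)$ by a unique sequence of such steps; this defines $J_{(e,d)}$. **The solution $r_{(E,(n,d))}$.** With respect to the block decomposition $n=e+d$, let $$V_{e,d}=\Bigl\{F=\begin{pmatrix}W&X\\ Y&Z\end{pmatrix}+\begin{pmatrix}W'&0\\ Y'&Z'\end{pmatrix}z+\begin{pmatrix}0&0\\ Y''&0\end{pmatrix}z^2\Bigr\}\subset\mathfrak g[z],$$ $F_0=\begin{pmatrix}W'&X\\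 Y''&Z'\end{pmatrix}$, $F_\epsilon=\begin{pmatrix}W&0\\ Y'&Z\end{pmatrix}$, and for $x\in\mathbb C$ $$\mathrm{Sol}((e,d),x)=\{F\in V_{e,d}:[F_0,J]+xF_0+F_\epsilon=0\}.$$ The map $\overline{\mathrm{res}}_x:\mathrm{Sol}((e,d),x)\to\mathfrak g$, $F\mapsto F(x)$, is an isomorphism; put $\overline{\mathrm{ev}}_y(F)=\frac1{y-x}F(y)$. Then $r_{(E,(n,d))}(x,y)\in\mathfrak g\otimes\mathfrak g$ is the preimage of $\overline{\mathrm{ev}}_y\circ\overline{\mathrm{res}}_x^{-1}$ under $\mathfrak g\otimes\mathfrak g\to\mathrm{End}(\mathfrak g)$, $a\otimes b\mapsto(c\mapsto\mathrm{tr}(ac)b)$. (This is the explicit form, in a suitable trivialization of the sheaf $\mathcal A$ of traceless endomorphisms of a simple vector bundle of rank $n$ and degree $d$ on $E=V(wv^2-u^3)$, of the tensor attached to $\mathrm{ev}_y\circ\mathrm{res}_x^{-1}:\mathcal A|_x\to\mathcal A|_y$.) **The solution $r_{(\mathfrak g,e,\omega_K)}$.** Let $\mathfrak p_e\subset\mathfrak g$ be the block upper triangular parabolic subalgebra with diagonal blocks of sizes $e,d$; $\omega_K$ is non-degenerate on $\mathfrak p_e$. Let $\widehat{\mathfrak g}=\mathfrak g((z^{-1}))$ with the form $(a,b)=\mathrm{res}_{z=0}\,\mathrm{tr}(ab)$ (coefficient of $z^{-1}$). Put $\mathfrak v=\{z^{-1}a+b:a,b\in\mathfrak g,\ \mathrm{tr}(a\cdot-)=\omega_K(b,-)\}$,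 $\mathfrak w'=z^{-2}\mathfrak g[[z^{-1}]]\oplus\mathfrak v$, $\eta=\mathrm{diag}(\mathbb 1_e,z\mathbb 1_d)$, $\mathfrak w=\eta^{-1}\mathfrak w'\eta$. Then $\mathfrak w\oplus\mathfrak g[z]=\widehat{\mathfrak g}$ and the form restricts to a non-degenerate pairing $\mathfrak w\times\mathfrak g[z]\to\mathbb C$. For a basis $(\alpha_l)$ of $\mathfrak g$ let $\beta_{l,m}\in\mathfrak w$ be dual to $\alpha_lz^m$. Then $r_{(\mathfrak g,e,\omega_K)}(x,y)=\sum_{m\ge0}x^m\sum_l\alpha_l\otimes\beta_{l,m}(y)$, which converges to a rational function. *)

theory Defs
  imports
    "Jordan_Normal_Form.VS_Connect"
    "HOL-Complex_Analysis.Laurent_Convergence"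
begin

section \<open>Matrices\<close>

definition tr :: "'a::comm_monoid_add mat \<Rightarrow> 'a" where
  "tr A = (\<Sum>i<dim_row A. A $$ (i,i))"

definition bracket :: "'a::ring mat \<Rightarrow> 'a mat \<Rightarrow> 'a mat" where
  "bracket A B = A * B - B * A"

text \<open>The coefficient ring is polymorphic: over \<^typ>\<open>complex\<close> this is the Lie algebra itself, over
  \<^typ>\<open>complex poly\<close> it is the algebra of polynomials in \<open>z\<close> with values in it, and over
  \<^typ>\<open>complex fls\<close>, whose formal variable stands for \<open>z\<^sup>-\<^sup>1\<close> throughout, it is the algebra of
  Laurent series in \<open>z\<^sup>-\<^sup>1\<close>.\<close>

definition sl :: "nat \<Rightarrow> 'a::comm_ring_1 mat set" where
  "sl n = {A \<in> carrier_mat n n. tr A = 0}"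

definition sl_vs :: "nat \<Rightarrow> (complex, complex mat) module" where
  "sl_vs n = (module_mat TYPE(complex) n n)\<lparr>carrier := sl n\<rparr>"

lemma vectorspace_sl_vs: "vectorspace class_ring (sl_vs n)"
proof -
  let ?V = "module_mat TYPE(complex) n n"
  interpret V: vectorspace class_ring ?V by (rule matrix_vs)
  have "submodule class_ring (sl n) ?V"
    by (rule submodule.intro)
      (auto simp: sl_def tr_def module_mat_simps class_ring_simps sum.distrib
        sum_distrib_left[symmetric] V.module_axioms)
  then have "VectorSpace.subspace class_ring (sl n) ?V"
    by (simp add: VectorSpace.subspace_def V.vectorspace_axioms)
  then show ?thesis
    unfolding sl_vs_def by (rule V.subspace_is_vs)
qed

definition basis_sl :: "nat \<Rightarrow> complex mat set \<Rightarrow> bool" where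
  "basis_sl n B \<longleftrightarrow> vectorspace.basis class_ring (sl_vs n) B"

section \<open>Tensors\<close>

text \<open>An element of the tensor square of the algebra of \<open>n \<times> n\<close> matrices is represented by its
  coordinates with respect to the tensors \<open>E\<^sub>i\<^sub>j \<otimes> E\<^sub>k\<^sub>l\<close> of matrix units (and \<open>0\<close> out of range).\<close>

type_synonym tensor = "nat \<times> nat \<times> nat \<times> nat \<Rightarrow> complex"

definition tens :: "nat \<Rightarrow> complex mat \<Rightarrow> complex mat \<Rightarrow> tensor" where
  "tens n a b = (\<lambda>(i,j,k,l).
     if i < n \<and> j < n \<and> k < n \<and> l < n then a $$ (i,j) * b $$ (k,l) else 0)"

definition tensor_sum :: "nat \<Rightarrow> (complex mat \<times> complex mat) list \<Rightarrow> tensor" where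
  "tensor_sum n ps = (\<lambda>\<iota>. \<Sum>(a,b)\<leftarrow>ps. tens n a b \<iota>)"

text \<open>\<open>f \<otimes> g\<close> on \<open>sl\<^sub>n \<otimes> sl\<^sub>n\<close>, for linear maps \<open>f\<close> and \<open>g\<close> on \<open>sl\<^sub>n\<close>.\<close>

definition tensor_map ::
  "nat \<Rightarrow> (complex mat \<Rightarrow> complex mat) \<Rightarrow> (complex mat \<Rightarrow> complex mat) \<Rightarrow> tensor \<Rightarrow> tensor" where
  "tensor_map n f g t = (THE s. \<exists>ps. set ps \<subseteq> sl n \<times> sl n \<and>
     t = tensor_sum n ps \<and> s = tensor_sum n (map (map_prod f g) ps))"

text \<open>The endomorphism \<open>c \<mapsto> \<Sum> tr(ac) b\<close> attached to \<open>\<Sum> a \<otimes> b\<close>.\<close>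

definition tensor_end :: "nat \<Rightarrow> (complex mat \<times> complex mat) list \<Rightarrow> complex mat \<Rightarrow> complex mat" where
  "tensor_end n ps c = foldr (\<lambda>(a,b) M. tr (a * c) \<cdot>\<^sub>m b + M) ps (0\<^sub>m n n)"

definition tensor_of_end :: "nat \<Rightarrow> (complex mat \<Rightarrow> complex mat) \<Rightarrow> tensor" where
  "tensor_of_end n h = (THE t. \<exists>ps. set ps \<subseteq> sl n \<times> sl n \<and>
     t = tensor_sum n ps \<and> (\<forall>c\<in>sl n. tensor_end n ps c = h c))"

section \<open>The matrix \<open>J\<close>\<close>

text \<open>A coprime pair of positive integers other than \<open>(1,1)\<close> has \<open>e \<noteq> d\<close>, and the recursion undoes
  the last step \<open>(a,b) \<mapsto> (a,a+b)\<close> or \<open>(a,b) \<mapsto> (a+b,b)\<close> by which it is reached from \<open>(1,1)\<close>.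
  The values at other pairs are irrelevant.\<close>

fun J_mat :: "nat \<Rightarrow> nat \<Rightarrow> complex mat" where
  "J_mat e d =
     (if e = 0 \<or> d = 0 then 0\<^sub>m (e + d) (e + d)
      else if e = d then mat_of_rows_list 2 [[0, 1], [0, 0]]
      else if e < d then
        four_block_mat
          (0\<^sub>m e e) (four_block_mat (1\<^sub>m e) (0\<^sub>m e (d - e)) (0\<^sub>m 0 e) (0\<^sub>m 0 (d - e)))
          (0\<^sub>m d e) (J_mat e (d - e))
      else
        four_block_mat
          (J_mat (e - d) d) (four_block_mat (0\<^sub>m (e - d) d) (0\<^sub>m (e - d) 0) (1\<^sub>m d) (0\<^sub>m d 0))
          (0\<^sub>m d e) (0\<^sub>m d d))"

declare J_mat.simps [simp del]

lemma J_mat_1_1: "J_mat 1 1 = mat_of_rows_list 2 [[0, 1], [0, 0]]"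
  by (subst J_mat.simps) simp

lemma J_mat_step_right:
  assumes "a > 0" "b > 0"
  shows "J_mat a (a + b) =
    four_block_mat
      (0\<^sub>m a a) (four_block_mat (1\<^sub>m a) (0\<^sub>m a b) (0\<^sub>m 0 a) (0\<^sub>m 0 b))
      (0\<^sub>m (a + b) a) (J_mat a b)"
  by (subst J_mat.simps) (use assms in simp)

lemma J_mat_step_left:
  assumes "a > 0" "b > 0"
  shows "J_mat (a + b) b =
    four_block_mat
      (J_mat a b) (four_block_mat (0\<^sub>m a b) (0\<^sub>m a 0) (1\<^sub>m b) (0\<^sub>m b 0))
      (0\<^sub>m b (a + b)) (0\<^sub>m b b)"
  by (subst J_mat.simps) (use assms in simp)

section \<open>The solution attached to the cuspidal curve\<close>

definition eval_mat :: "complex \<Rightarrow> complex poly mat \<Rightarrow> complex mat" where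
  "eval_mat x F = map_mat (\<lambda>p. poly p x) F"

definition coeff_mat :: "nat \<Rightarrow> complex poly mat \<Rightarrow> complex mat" where
  "coeff_mat k F = map_mat (\<lambda>p. coeff p k) F"

definition poly_mat :: "complex mat \<Rightarrow> complex poly mat" where
  "poly_mat A = map_mat (\<lambda>c. [:c:]) A"

definition V_space :: "nat \<Rightarrow> nat \<Rightarrow> complex poly mat set" where
  "V_space e d = sl (e + d) \<inter>
     {poly_mat (four_block_mat W X Y Z)
        + monom 1 1 \<cdot>\<^sub>m poly_mat (four_block_mat W' (0\<^sub>m e d) Y' Z')
        + monom 1 2 \<cdot>\<^sub>m poly_mat (four_block_mat (0\<^sub>m e e) (0\<^sub>m e d) Y'' (0\<^sub>m d d))
      | W X Y Z W' Y' Z' Y''.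
        W \<in> carrier_mat e e \<and> X \<in> carrier_mat e d \<and> Y \<in> carrier_mat d e \<and> Z \<in> carrier_mat d d \<and>
        W' \<in> carrier_mat e e \<and> Y' \<in> carrier_mat d e \<and> Z' \<in> carrier_mat d d \<and>
        Y'' \<in> carrier_mat d e}"

definition F_zero :: "nat \<Rightarrow> nat \<Rightarrow> complex poly mat \<Rightarrow> complex mat" where
  "F_zero e d F =
     (let (W, X, Y, Z) = split_block (coeff_mat 0 F) e e;
          (W', X', Y', Z') = split_block (coeff_mat 1 F) e e;
          (W'', X'', Y'', Z'') = split_block (coeff_mat 2 F) e e
      in four_block_mat W' X Y'' Z')"

definition F_eps :: "nat \<Rightarrow> nat \<Rightarrow> complex poly mat \<Rightarrow> complex mat" where
  "F_eps e d F =
     (let (W, X, Y, Z) = split_block (coeff_mat 0 F) e e;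
          (W', X', Y', Z') = split_block (coeff_mat 1 F) e e
      in four_block_mat W (0\<^sub>m e d) Y' Z)"

definition Sol :: "nat \<Rightarrow> nat \<Rightarrow> complex \<Rightarrow> complex poly mat set" where
  "Sol e d x = {F \<in> V_space e d.
     bracket (F_zero e d F) (J_mat e d) + x \<cdot>\<^sub>m F_zero e d F + F_eps e d F = 0\<^sub>m (e + d) (e + d)}"

definition res_inv :: "nat \<Rightarrow> nat \<Rightarrow> complex \<Rightarrow> complex mat \<Rightarrow> complex poly mat" where
  "res_inv e d x = the_inv_into (Sol e d x) (eval_mat x)"

definition ev_bar :: "complex \<Rightarrow> complex \<Rightarrow> complex poly mat \<Rightarrow> complex mat" where
  "ev_bar x y F = (1 / (y - x)) \<cdot>\<^sub>m eval_mat y F"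

definition r_cusp :: "nat \<Rightarrow> nat \<Rightarrow> complex \<Rightarrow> complex \<Rightarrow> tensor" where
  "r_cusp e d x y = tensor_of_end (e + d) (ev_bar x y \<circ> res_inv e d x)"

section \<open>The solution attached to \<open>\<omega>\<^sub>K\<close>\<close>

definition omega :: "complex mat \<Rightarrow> complex mat \<Rightarrow> complex mat \<Rightarrow> complex" where
  "omega K a b = tr (transpose_mat K * bracket a b)"

text \<open>Since the variable of \<^typ>\<open>complex fls\<close> stands for \<open>z\<^sup>-\<^sup>1\<close>, the coefficient of \<open>z\<^sup>-\<^sup>1\<close> has
  index 1, and \<open>z\<close> itself is \<^term>\<open>fls_X_inv\<close>.\<close>

definition res_form :: "complex fls mat \<Rightarrow> complex fls mat \<Rightarrow> complex" where
  "res_form a b = fls_nth (tr (a * b)) 1"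

definition const_mat :: "complex mat \<Rightarrow> complex fls mat" where
  "const_mat a = map_mat fls_const a"

definition v_space :: "nat \<Rightarrow> complex mat \<Rightarrow> complex fls mat set" where
  "v_space n K = {fls_X \<cdot>\<^sub>m const_mat a + const_mat b | a b.
     a \<in> sl n \<and> b \<in> sl n \<and> (\<forall>c\<in>sl n. tr (a * c) = omega K b c)}"

definition w'_space :: "nat \<Rightarrow> complex mat \<Rightarrow> complex fls mat set" where
  "w'_space n K = {fls_X ^ 2 \<cdot>\<^sub>m map_mat fps_to_fls G + H | G H.
     G \<in> sl n \<and> H \<in> v_space n K}"

definition eta :: "nat \<Rightarrow> nat \<Rightarrow> complex fls mat" where
  "eta e d = four_block_mat (1\<^sub>m e) (0\<^sub>m e d) (0\<^sub>m d e) (fls_X_inv \<cdot>\<^sub>m 1\<^sub>m d)"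

definition eta_inv :: "nat \<Rightarrow> nat \<Rightarrow> complex fls mat" where
  "eta_inv e d = four_block_mat (1\<^sub>m e) (0\<^sub>m e d) (0\<^sub>m d e) (fls_X \<cdot>\<^sub>m 1\<^sub>m d)"

lemma eta_eta_inv: "eta e d * eta_inv e d = 1\<^sub>m (e + d)" "eta_inv e d * eta e d = 1\<^sub>m (e + d)"
proof -
  have X: "fls_X_inv * fls_X = (1 :: complex fls)" "fls_X * fls_X_inv = (1 :: complex fls)"
    by (simp_all add: fls_X_times_conv_shift fls_X_inv_conv_shift_1)
  have S: "a \<cdot>\<^sub>m (b \<cdot>\<^sub>m 1\<^sub>m d) = (a * b) \<cdot>\<^sub>m 1\<^sub>m d" for a b :: "complex fls"
    by (rule eq_matI) auto
  have one: "(1 :: complex fls) \<cdot>\<^sub>m 1\<^sub>m d = 1\<^sub>m d"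
    by (rule eq_matI) auto
  show "eta e d * eta_inv e d = 1\<^sub>m (e + d)"
    unfolding eta_def eta_inv_def
    by (subst mult_four_block_mat[of _ e e _ d _ d _ _ e _ d])
      (simp_all add: X S one mult_smult_distrib[of _ d d _ d] mult_smult_assoc_mat[of _ d d _ d])
  show "eta_inv e d * eta e d = 1\<^sub>m (e + d)"
    unfolding eta_def eta_inv_def
    by (subst mult_four_block_mat[of _ e e _ d _ d _ _ e _ d])
      (simp_all add: X S one mult_smult_distrib[of _ d d _ d] mult_smult_assoc_mat[of _ d d _ d])
qed

definition w_space :: "nat \<Rightarrow> nat \<Rightarrow> complex mat \<Rightarrow> complex fls mat set" where
  "w_space e d K = {eta_inv e d * A * eta e d | A. A \<in> w'_space (e + d) K}"

definition dual_elt ::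
  "nat \<Rightarrow> nat \<Rightarrow> complex mat \<Rightarrow> complex mat set \<Rightarrow> complex mat \<Rightarrow> nat \<Rightarrow> complex fls mat" where
  "dual_elt e d K B \<alpha> m = (THE \<beta>. \<beta> \<in> w_space e d K \<and>
     (\<forall>\<alpha>'\<in>B. \<forall>m'. res_form \<beta> (fls_X_inv ^ m' \<cdot>\<^sub>m const_mat \<alpha>') =
        (if \<alpha>' = \<alpha> \<and> m' = m then 1 else 0)))"

definition fls_eval_mat :: "complex \<Rightarrow> complex fls mat \<Rightarrow> complex mat" where
  "fls_eval_mat y A = map_mat (\<lambda>f. eval_fls f (inverse y)) A"

definition r_stolin_term ::
  "nat \<Rightarrow> nat \<Rightarrow> complex mat \<Rightarrow> complex mat set \<Rightarrow> nat \<Rightarrow> complex \<Rightarrow> complex \<Rightarrow> tensor" where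
  "r_stolin_term e d K B m x y = (\<lambda>\<iota>.
     x ^ m * (\<Sum>\<alpha>\<in>B. tens (e + d) \<alpha> (fls_eval_mat y (dual_elt e d K B \<alpha> m)) \<iota>))"

text \<open>Value at \<open>(x,y)\<close> of the rational function to which a series of functions of \<open>(s,t)\<close>
  converges in the region \<open>|s| < |t|\<close>. Note that \<open>(x,y)\<close> need not lie in that region.\<close>

definition poly2 :: "complex poly poly \<Rightarrow> complex \<Rightarrow> complex \<Rightarrow> complex" where
  "poly2 P x y = poly (poly P [:y:]) x"

definition rational_suminf :: "(nat \<Rightarrow> complex \<Rightarrow> complex \<Rightarrow> complex) \<Rightarrow> complex \<Rightarrow> complex \<Rightarrow> complex" where
  "rational_suminf f x y = (THE v. \<exists>P Q.
     (\<forall>s t. norm s < norm t \<longrightarrow>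
        poly2 Q s t \<noteq> 0 \<and> (\<lambda>m. f m s t) sums (poly2 P s t / poly2 Q s t)) \<and>
     poly2 Q x y \<noteq> 0 \<and> v = poly2 P x y / poly2 Q x y)"

text \<open>Here \<open>B\<close> is the basis \<open>(\<alpha>\<^sub>l)\<close> used to write down the series; the sum does not depend on it.\<close>

definition r_stolin ::
  "nat \<Rightarrow> nat \<Rightarrow> complex mat \<Rightarrow> complex mat set \<Rightarrow> complex \<Rightarrow> complex \<Rightarrow> tensor" where
  "r_stolin e d K B x y = (\<lambda>\<iota>. rational_suminf (\<lambda>m s t. r_stolin_term e d K B m s t \<iota>) x y)"

definition phi :: "complex mat \<Rightarrow> complex mat" where
  "phi A = - transpose_mat A"

end

theory Submission
  imports Defs
begin

hide_const (open) Determinants.det Finite_Cartesian_Product.mat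

text \<open>
Both tensors describe, for a traceless matrix \<open>c\<close>, the unique function of \<open>z\<close> with principal part
\<open>c / (z - x)\<close> that satisfies a boundary condition at infinity, and transposition exchanges the two
conditions.

On the side of the cuspidal curve the function is \<open>F / (z - x)\<close>, where \<open>F\<close> is the element of \<open>Sol\<close>
with \<open>F(x) = c\<close>. On the other side, contracting the first factor
of the series with \<open>c\<close> gives the element of \<open>w\<close> whose pairing
with \<open>p \<in> sl[z]\<close> is \<open>tr(c p(x))\<close>; it is \<open>c / (z - x)\<close> plus a polynomial. Conjugation by
\<open>\<eta> = diag(1,z)\<close> turns the degree conditions in the definition of \<open>V_space\<close> into the condition that
\<open>\<eta> F\<^sup>t \<eta>\<^sup>-\<^sup>1 / (z - x)\<close> has no positive powers of \<open>z\<close>, and the expansion at infinity begins with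
\<open>b + z\<^sup>-\<^sup>1 a\<close>, where \<open>b\<close> is the transpose of \<open>F\<^sub>0\<close> and \<open>a\<close> that of \<open>x F\<^sub>0 + F\<^sub>\<epsilon>\<close>.
The definition of \<open>w\<close> requires \<open>a = [K\<^sup>t,b]\<close>. For \<open>K = - J\<close> this is the transpose of the equation
\<open>[F\<^sub>0,J] + x F\<^sub>0 + F\<^sub>\<epsilon> = 0\<close> of \<open>Sol\<close>. As \<open>phi\<close> is minus the transposition, the two tensors correspond
to each other under \<open>phi \<otimes> phi\<close>.

It remains to know that the boundary value problem is uniquely solvable. Subtracting the principal
part leaves a linear equation \<open>[Q,J] + B = R\<close> for a block lower triangular traceless \<open>Q\<close> and a lower
left block \<open>B\<close>, with as many unknowns as equations. Its injectivity is
\<open>J_mat_nondegenerate\<close>, proved by induction along the Euclidean algorithm that builds \<open>J\<close>. The right-hand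
side \<open>R\<close> is affine in \<open>x\<close>, so the solution consists of two linear maps, which are packaged as
\<open>correction_maps\<close>. In terms of them both tensors become explicit, in \<open>r_cusp_index\<close> and
\<open>r_stolin_index\<close>, and the two formulas coincide. On the series side the coefficient of \<open>x\<^sup>m\<close> of the
boundary value problem yields the dual elements: \<open>c z\<^sup>-\<^sup>m\<^sup>-\<^sup>1\<close> plus a correction that vanishes for
\<open>m \<ge> 2\<close>.
\<close>

section \<open>Traceless matrices\<close>

text \<open>The projection of the matrix unit \<open>E\<^sub>i\<^sub>j\<close> to the traceless matrices along the identity. These
  span, and by \<open>tr_mult_unit_sl\<close> they read off the entries of a traceless matrix through the trace
  form, so they serve as coordinates without a basis being chosen.\<close>
definition unit_sl :: "nat \<Rightarrow> nat \<Rightarrow> nat \<Rightarrow> complex mat" where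
  "unit_sl n i j = mat n n (\<lambda>(p,q).
     (if p = i \<and> q = j then 1 else 0) - (if i = j \<and> p = q then 1 / of_nat n else 0))"

lemma unit_sl_dim [simp]:
  "unit_sl n i j \<in> carrier_mat n n" "dim_row (unit_sl n i j) = n" "dim_col (unit_sl n i j) = n"
  by (simp_all add: unit_sl_def)

lemma unit_sl_index:
  assumes "p < n" "q < n"
  shows "unit_sl n i j $$ (p,q) =
    (if p = i \<and> q = j then 1 else 0) - (if i = j \<and> p = q then 1 / of_nat n else 0)"
  using assms by (simp add: unit_sl_def)

lemma unit_sl_in_sl:
  assumes "i < n" "j < n"
  shows "unit_sl n i j \<in> sl n"
proof -
  have "tr (unit_sl n i j) = (\<Sum>p<n. if p = i then (if i = j then 1 else 0) else 0)
      - (\<Sum>p<n. if i = j then 1 / of_nat n else 0)"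
    unfolding tr_def by (subst sum_subtractf[symmetric]) (auto intro!: sum.cong simp: unit_sl_index)
  also have "\<dots> = 0" using assms by simp
  finally show ?thesis by (simp add: sl_def)
qed

lemma slD:
  assumes "A \<in> sl n"
  shows "A \<in> carrier_mat n n" "dim_row A = n" "dim_col A = n" "(\<Sum>i<n. A $$ (i,i)) = 0"
  using assms by (auto simp: sl_def tr_def)

lemma slI:
  assumes "A \<in> carrier_mat n n" "(\<Sum>i<n. A $$ (i,i)) = 0"
  shows "A \<in> sl n"
  using assms by (auto simp: sl_def tr_def)

lemma index_mult_sum:
  assumes "A \<in> carrier_mat n m" "B \<in> carrier_mat m k" "i < n" "j < k"
  shows "(A * B) $$ (i,j) = (\<Sum>l<m. A $$ (i,l) * B $$ (l,j))"
  using assms by (simp add: scalar_prod_def atLeast0LessThan)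

lemma tr_mult:
  assumes "A \<in> carrier_mat n n" "B \<in> carrier_mat n n"
  shows "tr (A * B) = (\<Sum>i<n. \<Sum>j<n. A $$ (i,j) * B $$ (j,i))"
  unfolding tr_def using assms by (auto intro!: sum.cong simp: index_mult_sum[OF assms] simp del: index_mult_mat(1))

lemma tr_mult_commute:
  fixes A B :: "'a::comm_semiring_0 mat"
  assumes "A \<in> carrier_mat n n" "B \<in> carrier_mat n n"
  shows "tr (A * B) = tr (B * A)"
  unfolding tr_mult[OF assms] tr_mult[OF assms(2,1)]
  by (subst sum.swap) (simp add: mult.commute)

lemma bracket_in_sl:
  fixes A B :: "'a::comm_ring_1 mat"
  assumes "A \<in> carrier_mat n n" "B \<in> carrier_mat n n"
  shows "bracket A B \<in> sl n"
proof -
  have "tr (bracket A B) = tr (A * B) - tr (B * A)"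
    using assms by (simp add: bracket_def tr_def sum_subtractf)
  thus ?thesis using tr_mult_commute[OF assms] assms by (auto simp: sl_def bracket_def)
qed

lemma tr_mult_unit_sl:
  assumes c: "c \<in> sl n" and ij: "i < n" "j < n"
  shows "tr (c * unit_sl n i j) = c $$ (j,i)"
proof -
  have "tr (c * unit_sl n i j) = (\<Sum>p<n. \<Sum>q<n. c $$ (p,q) * unit_sl n i j $$ (q,p))"
    using slD(1)[OF c] by (simp add: tr_mult[where n=n])
  also have "\<dots> = (\<Sum>p<n. \<Sum>q<n. (if p = j \<and> q = i then c $$ (j,i) else 0)
      - (if p = q then (if i = j then c $$ (p,p) / of_nat n else 0) else 0))"
    by (intro sum.cong refl) (auto simp: unit_sl_index algebra_simps)
  also have "\<dots> = (\<Sum>p<n. \<Sum>q<n. if p = j then (if q = i then c $$ (j,i) else 0) else 0)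
      - (\<Sum>p<n. if i = j then c $$ (p,p) / of_nat n else 0)"
    by (simp add: sum_subtractf if_conn)
  also have "(\<Sum>p<n. if i = j then c $$ (p,p) / of_nat n else 0) = 0"
    using slD(4)[OF c] sum_divide_distrib[of "\<lambda>p. c $$ (p,p)" "{..<n}" "of_nat n"] by (cases "i = j") simp_all
  also have "(\<Sum>p<n. \<Sum>q<n. if p = j then (if q = i then c $$ (j,i) else 0) else 0)
     = (\<Sum>p<n. if p = j then c $$ (j,i) else 0)"
    using ij by (intro sum.cong refl) auto
  finally show ?thesis using ij by simp
qed

lemma trace_form_nondegenerate:
  fixes c :: "complex mat"
  assumes "c \<in> sl n" "\<And>a. a \<in> sl n \<Longrightarrow> tr (c * a) = 0"
  shows "c = 0\<^sub>m n n"
proof (rule eq_matI)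
  fix i j assume "i < dim_row (0\<^sub>m n n :: complex mat)" "j < dim_col (0\<^sub>m n n :: complex mat)"
  hence "i < n" "j < n" by auto
  thus "c $$ (i,j) = 0\<^sub>m n n $$ (i,j)"
    using tr_mult_unit_sl[OF assms(1), of j i] assms(2)[OF unit_sl_in_sl[of j n i]] by simp
qed (use slD[OF assms(1)] in auto)

text \<open>The projection fixes \<open>c\<close>, so the expansion of \<open>c\<close> in matrix units survives it.\<close>
lemma sl_expand_unit_sl:
  assumes c: "c \<in> sl n" and pq: "p < n" "q < n"
  shows "c $$ (p,q) = (\<Sum>(i,j)\<in>{..<n}\<times>{..<n}. c $$ (i,j) * unit_sl n i j $$ (p,q))"
proof -
  have "(\<Sum>(i,j)\<in>{..<n}\<times>{..<n}. c $$ (i,j) * unit_sl n i j $$ (p,q)) =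
     (\<Sum>i<n. \<Sum>j<n. (if i = p then (if j = q then c $$ (i,j) else 0) else 0)
      - (if i = j then (if p = q then c $$ (i,i) / of_nat n else 0) else 0))"
    unfolding sum.cartesian_product[symmetric]
    by (intro sum.cong refl) (use pq in \<open>auto simp: unit_sl_index algebra_simps\<close>)
  also have "\<dots> = (\<Sum>i<n. \<Sum>j<n. (if i = p then (if j = q then c $$ (i,j) else 0) else 0))
     - (\<Sum>i<n. if p = q then c $$ (i,i) / of_nat n else 0)"
    by (simp add: sum_subtractf)
  also have "(\<Sum>i<n. if p = q then c $$ (i,i) / of_nat n else 0) = 0"
    using slD(4)[OF c] sum_divide_distrib[of "\<lambda>p. c $$ (p,p)" "{..<n}" "of_nat n"] by (cases "p = q") simp_all
  also have "(\<Sum>i<n. \<Sum>j<n. (if i = p then (if j = q then c $$ (i,j) else 0) else 0))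
     = (\<Sum>i<n. if i = p then c $$ (i,q) else 0)"
    using pq by (intro sum.cong refl) auto
  finally show ?thesis using pq by simp
qed

section \<open>Linear maps of matrices\<close>

definition lin_map :: "nat \<Rightarrow> (complex mat \<Rightarrow> complex mat) \<Rightarrow> bool" where
  "lin_map n D \<longleftrightarrow> (\<forall>A\<in>carrier_mat n n. D A \<in> carrier_mat n n) \<and>
     (\<forall>A\<in>carrier_mat n n. \<forall>B\<in>carrier_mat n n. D (A + B) = D A + D B) \<and>
     (\<forall>A\<in>carrier_mat n n. \<forall>s. D (s \<cdot>\<^sub>m A) = s \<cdot>\<^sub>m D A)"

lemma lin_map_carrier: "lin_map n D \<Longrightarrow> A \<in> carrier_mat n n \<Longrightarrow> D A \<in> carrier_mat n n"
  by (auto simp: lin_map_def)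

lemma lin_mapI:
  assumes "\<And>A. A \<in> carrier_mat n n \<Longrightarrow> D A \<in> carrier_mat n n"
    and "\<And>A B i j. A \<in> carrier_mat n n \<Longrightarrow> B \<in> carrier_mat n n \<Longrightarrow> i < n \<Longrightarrow> j < n \<Longrightarrow>
      D (A + B) $$ (i,j) = D A $$ (i,j) + D B $$ (i,j)"
    and "\<And>A s i j. A \<in> carrier_mat n n \<Longrightarrow> i < n \<Longrightarrow> j < n \<Longrightarrow>
      D (s \<cdot>\<^sub>m A) $$ (i,j) = s * D A $$ (i,j)"
  shows "lin_map n D"
  unfolding lin_map_def
proof (intro conjI ballI allI)
  fix A B :: "complex mat" and s :: complex
  assume A: "A \<in> carrier_mat n n"
  note c = carrier_matD[OF assms(1)]
  show "D (s \<cdot>\<^sub>m A) = s \<cdot>\<^sub>m D A"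
    by (rule eq_matI) (use A assms(3) in \<open>auto simp: c\<close>)
  assume B: "B \<in> carrier_mat n n"
  show "D (A + B) = D A + D B"
    by (rule eq_matI) (use A B assms(2) in \<open>auto simp: c\<close>)
qed (use assms(1) in simp)

lemma lin_map_entry:
  assumes "lin_map n D" "A \<in> carrier_mat n n"
  shows "D A \<in> carrier_mat n n" "dim_row (D A) = n" "dim_col (D A) = n"
    and "B \<in> carrier_mat n n \<Longrightarrow> i < n \<Longrightarrow> j < n \<Longrightarrow>
      D (A + B) $$ (i,j) = D A $$ (i,j) + D B $$ (i,j)"
    and "i < n \<Longrightarrow> j < n \<Longrightarrow> D (s \<cdot>\<^sub>m A) $$ (i,j) = s * D A $$ (i,j)"
proof -
  have c: "D A \<in> carrier_mat n n" if "A \<in> carrier_mat n n" for A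
    using assms(1) that by (auto simp: lin_map_def)
  note d = carrier_matD[OF c]
  show "D A \<in> carrier_mat n n" "dim_row (D A) = n" "dim_col (D A) = n"
    using assms(2) d c by auto
  show "D (A + B) $$ (i,j) = D A $$ (i,j) + D B $$ (i,j)"
    if "B \<in> carrier_mat n n" "i < n" "j < n"
    using assms that d by (simp add: lin_map_def)
  show "D (s \<cdot>\<^sub>m A) $$ (i,j) = s * D A $$ (i,j)" if "i < n" "j < n"
    using assms that d by (simp add: lin_map_def)
qed

lemma lin_map_zero:
  assumes "lin_map n D"
  shows "D (0\<^sub>m n n) = 0\<^sub>m n n"
proof -
  have "D (0 \<cdot>\<^sub>m 0\<^sub>m n n) = 0 \<cdot>\<^sub>m D (0\<^sub>m n n)"
    using assms by (simp add: lin_map_def del: smult_zero_mat)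
  moreover have "0 \<cdot>\<^sub>m 0\<^sub>m n n = (0\<^sub>m n n :: complex mat)" by auto
  moreover have "0 \<cdot>\<^sub>m D (0\<^sub>m n n) = 0\<^sub>m n n"
    using lin_map_carrier[OF assms, of "0\<^sub>m n n"] by (intro eq_matI) auto
  ultimately show ?thesis by simp
qed

lemma lin_map_sum:
  fixes f :: "'s \<Rightarrow> complex"
  assumes D: "lin_map n D" and "finite S"
    and A: "\<And>s. s \<in> S \<Longrightarrow> A s \<in> carrier_mat n n"
    and kl: "k < n" "l < n"
  shows "D (mat n n (\<lambda>b. \<Sum>s\<in>S. f s * A s $$ b)) $$ (k,l) = (\<Sum>s\<in>S. f s * D (A s) $$ (k,l))"
  using assms(2) A
proof (induction S rule: finite_induct)
  case empty
  have "mat n n (\<lambda>a. 0) = (0\<^sub>m n n :: complex mat)" by auto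
  then show ?case using lin_map_zero[OF D] kl by simp
next
  case (insert a S)
  let ?R = "mat n n (\<lambda>b. \<Sum>s\<in>S. f s * A s $$ b)"
  have "mat n n (\<lambda>b. \<Sum>s\<in>insert a S. f s * A s $$ b) = f a \<cdot>\<^sub>m A a + ?R"
    by (rule eq_matI) (use insert carrier_matD[OF insert.prems[of a]] in auto)
  also have "D \<dots> = f a \<cdot>\<^sub>m D (A a) + D ?R"
    using D insert.prems unfolding lin_map_def by simp
  also have "\<dots> $$ (k,l) = f a * D (A a) $$ (k,l) + D ?R $$ (k,l)"
    using kl lin_map_carrier[OF D, of "A a"] lin_map_carrier[OF D, of ?R] insert.prems by simp
  finally show ?case using insert by simp
qed

text \<open>The form in which linearity is used: matrices of varying size form no additive type class, so
  a linear combination of matrices is given by its entries.\<close>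
lemma lin_map_combination:
  fixes f :: "'s \<Rightarrow> complex"
  assumes D: "lin_map n D" and "finite S"
    and A: "\<And>s. s \<in> S \<Longrightarrow> A s \<in> carrier_mat n n"
    and M: "M \<in> carrier_mat n n"
    and eq: "\<And>i j. i < n \<Longrightarrow> j < n \<Longrightarrow> M $$ (i,j) = (\<Sum>s\<in>S. f s * A s $$ (i,j))"
    and kl: "k < n" "l < n"
  shows "D M $$ (k,l) = (\<Sum>s\<in>S. f s * D (A s) $$ (k,l))"
proof -
  have "M = mat n n (\<lambda>b. \<Sum>s\<in>S. f s * A s $$ b)"
    by (rule eq_matI) (use M eq in auto)
  thus ?thesis using lin_map_sum[OF D assms(2) A kl, where f=f] by simp
qed

lemma lin_map_comp:
  assumes "lin_map n D" "lin_map n D'"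
  shows "lin_map n (\<lambda>A. D (D' A))"
  using assms by (auto simp: lin_map_def)

lemma lin_map_id: "lin_map n (\<lambda>A. A)"
  by (auto simp: lin_map_def)

lemma lin_map_smult:
  assumes "lin_map n D"
  shows "lin_map n (\<lambda>A. s \<cdot>\<^sub>m D A)"
  by (rule lin_mapI) (use assms in \<open>simp_all add: lin_map_entry algebra_simps\<close>)

lemma lin_map_add:
  assumes "lin_map n D" "lin_map n D'"
  shows "lin_map n (\<lambda>A. D A + D' A)"
  by (rule lin_mapI) (use assms in \<open>simp_all add: lin_map_entry algebra_simps\<close>)

lemma lin_map_diff:
  assumes "lin_map n D" "lin_map n D'"
  shows "lin_map n (\<lambda>A. D A - D' A)"
  by (rule lin_mapI) (use assms in \<open>simp_all add: lin_map_entry algebra_simps minus_carrier_mat\<close>)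

lemma lin_map_uminus:
  assumes "lin_map n D"
  shows "lin_map n (\<lambda>A. - D A)"
  by (rule lin_mapI) (use assms in \<open>simp_all add: lin_map_entry algebra_simps\<close>)

lemma lin_map_transpose: "lin_map n transpose_mat"
  unfolding lin_map_def by (auto intro!: eq_matI)

lemma bracket_carrier [simp]:
  "A \<in> carrier_mat n n \<Longrightarrow> B \<in> carrier_mat n n \<Longrightarrow> bracket A B \<in> carrier_mat n n"
  by (simp add: bracket_def minus_carrier_mat)

lemma bracket_index:
  assumes "A \<in> carrier_mat n n" "B \<in> carrier_mat n n" "i < n" "j < n"
  shows "bracket A B $$ (i,j) =
    (\<Sum>k<n. A $$ (i,k) * B $$ (k,j)) - (\<Sum>k<n. B $$ (i,k) * A $$ (k,j))"
  using assms unfolding bracket_def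
  by (simp add: index_mult_sum[of _ n n _ n] del: index_mult_mat(1))

lemma lin_map_bracket:
  assumes "J \<in> carrier_mat n n"
  shows "lin_map n (\<lambda>A. bracket A J)"
  by (rule lin_mapI)
    (use assms in \<open>simp_all add: bracket_index[of _ n] algebra_simps sum.distrib sum_distrib_left\<close>)

definition mask :: "(nat \<Rightarrow> nat \<Rightarrow> bool) \<Rightarrow> nat \<Rightarrow> complex mat \<Rightarrow> complex mat" where
  "mask P n A = mat n n (\<lambda>(i,j). if P i j then A $$ (i,j) else 0)"

lemma mask_carrier [simp]: "mask P n A \<in> carrier_mat n n" 
   "dim_row (mask P n A) = n" "dim_col (mask P n A) = n"
  by (simp_all add: mask_def)

lemma mask_index [simp]: "i < n \<Longrightarrow> j < n \<Longrightarrow> mask P n A $$ (i,j) = (if P i j then A $$ (i,j) else 0)"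
  by (simp add: mask_def)

lemma lin_map_pick: "lin_map n (mask P n)"
  unfolding lin_map_def by (auto intro!: eq_matI)

text \<open>Enumerating the index set turns the system into a square matrix, whose determinant does not
  vanish; the coefficients \<open>\<Gamma>\<close> are the entries of its inverse. That they do not depend on \<open>r\<close> is
  what makes the solution linear in the right-hand side.\<close>
lemma injective_system_solvable:
  fixes \<tau> :: "'i \<Rightarrow> 'i \<Rightarrow> complex"
  assumes fin: "finite S"
    and inj: "\<And>v. (\<And>a. a \<in> S \<Longrightarrow> (\<Sum>b\<in>S. \<tau> a b * v b) = 0) \<Longrightarrow> (\<And>b. b \<in> S \<Longrightarrow> v b = 0)"
  shows "\<exists>\<Gamma>. \<forall>r. \<forall>a\<in>S. (\<Sum>b\<in>S. \<tau> a b * (\<Sum>c\<in>S. \<Gamma> b c * r c)) = r a"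
proof -
  define N where "N = card S"
  obtain h where h: "bij_betw h {0..<N} S" using ex_bij_betw_nat_finite[OF fin] N_def by auto
  define g where "g = the_inv_into {0..<N} h"
  have gh: "g (h i) = i" if "i < N" for i
    using that h by (simp add: g_def the_inv_into_f_f bij_betw_def)
  have hg: "h (g a) = a" "g a < N" if "a \<in> S" for a
    using that h f_the_inv_into_f_bij_betw[OF h] the_inv_into_into[of h "{0..<N}" a "{0..<N}"]
    by (auto simp: g_def bij_betw_def)
  have re: "(\<Sum>b\<in>S. F b) = (\<Sum>i=0..<N. F (h i))" for F :: "'i \<Rightarrow> complex"
    using sum.reindex_bij_betw[OF h, of F] by simp
  define A where "A = mat N N (\<lambda>(i,j). \<tau> (h i) (h j))"
  have A: "A \<in> carrier_mat N N" by (simp add: A_def)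
  have "det A \<noteq> 0"
  proof
    assume "det A = 0"
    then obtain w where w: "w \<in> carrier_vec N" "w \<noteq> 0\<^sub>v N" "A *\<^sub>v w = 0\<^sub>v N"
      using det_0_iff_vec_prod_zero[OF A] by auto
    have "w $ g b = 0" if "b \<in> S" for b
    proof (rule inj[OF _ that])
      fix a assume a: "a \<in> S"
      have "(\<Sum>b\<in>S. \<tau> a b * w $ g b) = (\<Sum>i=0..<N. \<tau> a (h i) * w $ i)"
        unfolding re by (intro sum.cong) (auto simp: gh)
      also have "\<dots> = (A *\<^sub>v w) $ g a"
        using hg[OF a] w(1) by (simp add: A_def scalar_prod_def)
      finally show "(\<Sum>b\<in>S. \<tau> a b * w $ g b) = 0" using w(3) hg[OF a] by simp
    qed
    hence "w $ i = 0" if "i < N" for i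
      using gh[OF that] bij_betwE[OF h] that by fastforce
    hence "w = 0\<^sub>v N" using w(1) by (intro eq_vecI) auto
    with w(2) show False by simp
  qed
  then obtain C where C: "C \<in> carrier_mat N N" "A * C = 1\<^sub>m N"
    using det_non_zero_imp_unit[OF A, where b="()"] by (auto simp: Units_def ring_mat_simps)
  show ?thesis
  proof (intro exI allI ballI)
    fix r a assume a: "a \<in> S"
    have "(\<Sum>b\<in>S. \<tau> a b * (\<Sum>c\<in>S. C $$ (g b, g c) * r c)) =
      (\<Sum>c\<in>S. (\<Sum>b\<in>S. \<tau> a b * C $$ (g b, g c)) * r c)"
      unfolding sum_distrib_left sum_distrib_right mult.assoc by (rule sum.swap)
    also have "\<dots> = (\<Sum>c\<in>S. (if a = c then r c else 0))"
    proof (intro sum.cong refl)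
      fix c assume c: "c \<in> S"
      have gac: "g a = g c \<longleftrightarrow> a = c" using hg(1)[OF a] hg(1)[OF c] by metis
      have "(\<Sum>b\<in>S. \<tau> a b * C $$ (g b, g c)) = (\<Sum>i=0..<N. \<tau> a (h i) * C $$ (i, g c))"
        unfolding re by (intro sum.cong) (auto simp: gh)
      also have "\<dots> = (\<Sum>i<N. A $$ (g a, i) * C $$ (i, g c))"
        unfolding atLeast0LessThan using hg[OF a] by (intro sum.cong) (simp_all add: A_def)
      also have "\<dots> = (A * C) $$ (g a, g c)"
        using hg(2)[OF a] hg(2)[OF c] by (simp only: index_mult_sum[OF A C(1)])
      also have "\<dots> = (if a = c then 1 else 0)" using C(2) hg(2)[OF a] hg(2)[OF c] gac by simp
      finally show "(\<Sum>b\<in>S. \<tau> a b * C $$ (g b, g c)) * r c = (if a = c then r c else 0)" by simp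
    qed
    also have "\<dots> = r a" using fin a by simp
    finally show "(\<Sum>b\<in>S. \<tau> a b * (\<Sum>c\<in>S. C $$ (g b, g c) * r c)) = r a" .
  qed
qed

lemma injective_lin_map_has_right_inverse:
  assumes T: "lin_map n T"
    and inj: "\<And>M. M \<in> carrier_mat n n \<Longrightarrow> T M = 0\<^sub>m n n \<Longrightarrow> M = 0\<^sub>m n n"
  shows "\<exists>S. lin_map n S \<and> (\<forall>R\<in>carrier_mat n n. T (S R) = R)"
proof -
  define I where "I = {..<n} \<times> {..<n}"
  define E :: "nat \<times> nat \<Rightarrow> complex mat" where
    "E = (\<lambda>b. mat n n (\<lambda>a. if a = b then 1 else 0))"
  define \<tau> where "\<tau> = (\<lambda>a b. T (E b) $$ a)"
  have fin: "finite I" by (simp add: I_def)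
  have T_index: "T M $$ a = (\<Sum>b\<in>I. \<tau> a b * M $$ b)" if "M \<in> carrier_mat n n" "a \<in> I" for M a
  proof -
    have "T M $$ (fst a, snd a) = (\<Sum>b\<in>I. M $$ b * T (E b) $$ (fst a, snd a))"
    proof (rule lin_map_combination[OF T fin])
      fix i j assume ij: "i < n" "j < n"
      have "(\<Sum>s\<in>I. M $$ s * E s $$ (i, j)) = (\<Sum>s\<in>I. if s = (i,j) then M $$ s else 0)"
        by (intro sum.cong) (use ij in \<open>auto simp: E_def\<close>)
      thus "M $$ (i, j) = (\<Sum>s\<in>I. M $$ s * E s $$ (i, j))"
        using ij fin by (simp add: I_def)
    qed (use that in \<open>auto simp: E_def I_def\<close>)
    thus ?thesis by (simp add: \<tau>_def mult.commute)
  qed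
  have "\<exists>\<Gamma>. \<forall>r. \<forall>a\<in>I. (\<Sum>b\<in>I. \<tau> a b * (\<Sum>c\<in>I. \<Gamma> b c * r c)) = r a"
  proof (rule injective_system_solvable[OF fin])
    fix v b assume v: "\<And>a. a \<in> I \<Longrightarrow> (\<Sum>b\<in>I. \<tau> a b * v b) = 0" and b: "b \<in> I"
    have "T (mat n n v) = 0\<^sub>m n n"
    proof (rule eq_matI)
      fix i j assume ij: "i < dim_row (0\<^sub>m n n :: complex mat)" "j < dim_col (0\<^sub>m n n :: complex mat)"
      have "T (mat n n v) $$ (i,j) = (\<Sum>b\<in>I. \<tau> (i,j) b * mat n n v $$ b)"
        using ij by (intro T_index) (auto simp: I_def)
      also have "\<dots> = (\<Sum>b\<in>I. \<tau> (i,j) b * v b)" by (intro sum.cong) (auto simp: I_def)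
      also have "\<dots> = 0" using v ij by (auto simp: I_def)
      finally show "T (mat n n v) $$ (i,j) = 0\<^sub>m n n $$ (i,j)" using ij by simp
    qed (use lin_map_carrier[OF T, of "mat n n v"] in auto)
    hence "mat n n v = 0\<^sub>m n n" using inj[of "mat n n v"] by simp
    hence "mat n n v $$ b = 0\<^sub>m n n $$ b" by simp
    thus "v b = 0" using b by (auto simp: I_def)
  qed
  then obtain \<Gamma> where \<Gamma>: "\<And>r a. a \<in> I \<Longrightarrow> (\<Sum>b\<in>I. \<tau> a b * (\<Sum>c\<in>I. \<Gamma> b c * r c)) = r a"
    by blast
  define S where "S = (\<lambda>R. mat n n (\<lambda>b. \<Sum>c\<in>I. \<Gamma> b c * R $$ c))"
  have S_index: "S R $$ (i,j) = (\<Sum>c\<in>I. \<Gamma> (i,j) c * R $$ c)" if "i < n" "j < n" for R i j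
    using that by (simp add: S_def)
  have "lin_map n S"
  proof (rule lin_mapI)
    fix A B :: "complex mat" and s :: complex and i j
    assume A: "A \<in> carrier_mat n n" and ij: "i < n" "j < n"
    have "S (s \<cdot>\<^sub>m A) $$ (i,j) = (\<Sum>c\<in>I. s * (\<Gamma> (i,j) c * A $$ c))"
      unfolding S_index[OF ij] by (intro sum.cong refl) (use A in \<open>auto simp: I_def\<close>)
    thus "S (s \<cdot>\<^sub>m A) $$ (i,j) = s * S A $$ (i,j)"
      unfolding S_index[OF ij] by (simp add: sum_distrib_left)
    assume B: "B \<in> carrier_mat n n"
    have "S (A + B) $$ (i,j) = (\<Sum>c\<in>I. \<Gamma> (i,j) c * A $$ c + \<Gamma> (i,j) c * B $$ c)"
      unfolding S_index[OF ij] by (intro sum.cong refl) (use A B in \<open>auto simp: I_def distrib_left\<close>)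
    thus "S (A + B) $$ (i,j) = S A $$ (i,j) + S B $$ (i,j)"
      unfolding S_index[OF ij] by (simp add: sum.distrib)
  qed (simp add: S_def)
  moreover have "T (S R) = R" if R: "R \<in> carrier_mat n n" for R
  proof (rule eq_matI)
    fix i j assume "i < dim_row R" "j < dim_col R"
    hence ij: "(i,j) \<in> I" using R by (auto simp: I_def)
    have "T (S R) $$ (i,j) = (\<Sum>b\<in>I. \<tau> (i,j) b * S R $$ b)"
      using ij by (intro T_index) (auto simp: S_def)
    also have "\<dots> = (\<Sum>b\<in>I. \<tau> (i,j) b * (\<Sum>c\<in>I. \<Gamma> b c * R $$ c))"
      by (intro sum.cong) (auto simp: S_def I_def)
    also have "\<dots> = R $$ (i,j)" using \<Gamma>[OF ij, of "\<lambda>c. R $$ c"] .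
    finally show "T (S R) $$ (i,j) = R $$ (i,j)" .
  qed (use R lin_map_carrier[OF T, of "S R"] in \<open>auto simp: S_def\<close>)
  ultimately show ?thesis by blast
qed

section \<open>Bases of the traceless matrices\<close>

text \<open>Translates the abstract linear combinations behind \<open>basis_sl\<close> into sums of entries.\<close>
lemma lincomb_sl:
  assumes "finite A" "A \<subseteq> sl n"
  shows "LinearCombinations.module.lincomb (sl_vs n) a A \<in> sl n"
    and "i < n \<Longrightarrow> j < n \<Longrightarrow>
      LinearCombinations.module.lincomb (sl_vs n) a A $$ (i,j) = (\<Sum>v\<in>A. a v * v $$ (i,j))"
proof -
  interpret V: vectorspace class_ring "sl_vs n" by (rule vectorspace_sl_vs)
  have simps: "carrier (sl_vs n) = sl n" "add (sl_vs n) = (+)" "module.smult (sl_vs n) = (\<cdot>\<^sub>m)"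
     "zero (sl_vs n) = 0\<^sub>m n n"
    by (simp_all add: sl_vs_def module_mat_simps)
  have *: "V.lincomb a A \<in> sl n \<and> (\<forall>i<n. \<forall>j<n. V.lincomb a A $$ (i,j) = (\<Sum>v\<in>A. a v * v $$ (i,j)))"
    using assms
  proof (induction A rule: finite_induct)
    case empty
    show ?case by (simp add: V.lincomb_def simps sl_def tr_def)
  next
    case (insert v A)
    have f: "(\<lambda>v. a v \<odot>\<^bsub>sl_vs n\<^esub> v) \<in> A \<rightarrow> carrier (sl_vs n)" "a v \<odot>\<^bsub>sl_vs n\<^esub> v \<in> carrier (sl_vs n)"
      using insert.prems by (auto intro!: V.smult_closed) (auto simp: class_ring_simps simps)
    have "V.lincomb a (insert v A) = a v \<odot>\<^bsub>sl_vs n\<^esub> v \<oplus>\<^bsub>sl_vs n\<^esub> V.lincomb a A"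
      unfolding V.lincomb_def using insert.hyps f by (intro V.M.finsum_insert) auto
    also have "\<dots> = a v \<cdot>\<^sub>m v + V.lincomb a A" by (simp add: simps)
    finally have eq: "V.lincomb a (insert v A) = a v \<cdot>\<^sub>m v + V.lincomb a A" .
    have IH: "V.lincomb a A \<in> sl n" "\<And>i j. i < n \<Longrightarrow> j < n \<Longrightarrow> V.lincomb a A $$ (i,j) = (\<Sum>v\<in>A. a v * v $$ (i,j))"
      using insert by auto
    have v: "v \<in> sl n" using insert.prems by simp
    have "V.lincomb a (insert v A) \<in> sl n"
      unfolding eq using slD[OF v] slD[OF IH(1)]
      by (intro slI) (auto simp: sum.distrib simp flip: sum_distrib_left)
    moreover have "V.lincomb a (insert v A) $$ (i,j) = (\<Sum>v\<in>insert v A. a v * v $$ (i,j))" if "i < n" "j < n" for i j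
      unfolding eq using slD[OF v] slD[OF IH(1)] IH(2) insert.hyps that by simp
    ultimately show ?case by blast
  qed
  thus "V.lincomb a A \<in> sl n" by blast
  show "V.lincomb a A $$ (i,j) = (\<Sum>v\<in>A. a v * v $$ (i,j))" if "i < n" "j < n"
    using * that by blast
qed

lemma basis_sl_properties:
  assumes "basis_sl n B"
  shows "finite B" "B \<subseteq> sl n"
    and "\<And>c. c \<in> sl n \<Longrightarrow> \<exists>a. \<forall>i<n. \<forall>j<n. c $$ (i,j) = (\<Sum>\<alpha>\<in>B. a \<alpha> * \<alpha> $$ (i,j))"
    and "\<And>a \<alpha>. (\<And>i j. i < n \<Longrightarrow> j < n \<Longrightarrow> (\<Sum>\<alpha>\<in>B. a \<alpha> * \<alpha> $$ (i,j)) = 0) \<Longrightarrow> \<alpha> \<in> B \<Longrightarrow> a \<alpha> = 0"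
proof -
  interpret V: vectorspace class_ring "sl_vs n" by (rule vectorspace_sl_vs)
  have simps: "carrier (sl_vs n) = sl n" "zero (sl_vs n) = 0\<^sub>m n n"
    by (simp_all add: sl_vs_def module_mat_simps)
  have cl: "a \<in> A \<rightarrow> carrier class_ring" for a :: "complex mat \<Rightarrow> complex" and A
    by (auto simp: class_ring_simps)
  have indep: "V.lin_indpt B" and gen: "V.span B = sl n" and sub: "B \<subseteq> sl n"
    using assms unfolding basis_sl_def V.basis_def simps by auto
  show "B \<subseteq> sl n" by (rule sub)
  \<comment> \<open>The finitely many projected matrix units span, so an independent set is finite.\<close>
  define U where "U = (\<lambda>(i,j). unit_sl n i j) ` ({..<n} \<times> {..<n})"
  have U: "finite U" "U \<subseteq> sl n" by (auto simp: U_def unit_sl_in_sl)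
  have "c \<in> V.span U" if c: "c \<in> sl n" for c
  proof -
    let ?I = "{..<n} \<times> {..<n}"
    define a where "a = (\<lambda>u. \<Sum>s\<in>{s\<in>?I. (case s of (i,j) \<Rightarrow> unit_sl n i j) = u}. c $$ s)"
    have "c = V.lincomb a U"
    proof (rule eq_matI)
      note l = lincomb_sl[OF U, where a=a]
      fix p q assume "p < dim_row (V.lincomb a U)" "q < dim_col (V.lincomb a U)"
      hence pq: "p < n" "q < n" using slD[OF l(1)] by auto
      have "c $$ (p,q) = (\<Sum>s\<in>?I. c $$ s * (case s of (i,j) \<Rightarrow> unit_sl n i j) $$ (p,q))"
        unfolding sl_expand_unit_sl[OF c pq] by (intro sum.cong) auto
      also have "\<dots> = (\<Sum>u\<in>U. \<Sum>s\<in>{s\<in>?I. (case s of (i,j) \<Rightarrow> unit_sl n i j) = u}.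
          c $$ s * (case s of (i,j) \<Rightarrow> unit_sl n i j) $$ (p,q))"
        by (rule sum.group[symmetric]) (auto simp: U_def)
      also have "\<dots> = (\<Sum>u\<in>U. a u * u $$ (p,q))"
        unfolding a_def sum_distrib_right by (intro sum.cong refl) auto
      finally show "c $$ (p,q) = V.lincomb a U $$ (p,q)" using l(2) pq by simp
    qed (use slD[OF c] slD[OF lincomb_sl(1)[OF U, where a=a]] in auto)
    thus ?thesis unfolding V.span_def using U cl by blast
  qed
  hence "V.span U = carrier (sl_vs n)"
    using V.span_is_subset2[of U] U unfolding simps by auto
  hence "V.fin_dim" unfolding V.fin_dim_def using U simps by auto
  thus fin: "finite B" using V.fin_dim_li_fin[OF _ indep] sub simps by auto
  show "\<exists>a. \<forall>i<n. \<forall>j<n. c $$ (i,j) = (\<Sum>\<alpha>\<in>B. a \<alpha> * \<alpha> $$ (i,j))" if "c \<in> sl n" for c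
  proof -
    have "c \<in> V.span B" using that gen by simp
    hence "\<exists>a. c = V.lincomb a B" using V.finite_span[OF fin] sub unfolding simps by blast
    then obtain a where "c = V.lincomb a B" ..
    thus ?thesis using lincomb_sl(2)[OF fin sub] by blast
  qed
  show "a \<alpha> = 0" if a: "\<And>i j. i < n \<Longrightarrow> j < n \<Longrightarrow> (\<Sum>\<alpha>\<in>B. a \<alpha> * \<alpha> $$ (i,j)) = 0" and "\<alpha> \<in> B" for a \<alpha>
  proof (rule ccontr)
    assume "a \<alpha> \<noteq> 0"
    moreover have "V.lincomb a B = 0\<^sub>m n n"
      by (rule eq_matI) (use slD[OF lincomb_sl(1)[OF fin sub, where a=a]] lincomb_sl(2)[OF fin sub, where a=a] a in auto)
    ultimately show False
      using indep fin \<open>\<alpha> \<in> B\<close> cl unfolding V.lin_dep_def simps class_ring_simps by blast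
  qed
qed

text \<open>The coordinates of \<open>c\<close> in the basis are linear in \<open>c\<close>, hence of the form \<open>tr (\<beta> c)\<close>. The last
  statement says that the Casimir tensor \<open>\<Sum> \<alpha> \<otimes> \<beta>\<close> has the same coordinates for every basis; it
  makes the final result independent of \<open>B\<close>.\<close>
lemma trace_dual_basis:
  assumes "basis_sl n B"
  obtains \<beta> where "\<And>\<alpha>. \<alpha> \<in> B \<Longrightarrow> \<beta> \<alpha> \<in> sl n"
    and "\<And>\<alpha> \<alpha>'. \<alpha> \<in> B \<Longrightarrow> \<alpha>' \<in> B \<Longrightarrow> tr (\<beta> \<alpha> * \<alpha>') = (if \<alpha>' = \<alpha> then 1 else 0)"
    and "\<And>i j p q. i < n \<Longrightarrow> j < n \<Longrightarrow> p < n \<Longrightarrow> q < n \<Longrightarrow>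
      (\<Sum>\<alpha>\<in>B. \<alpha> $$ (i,j) * \<beta> \<alpha> $$ (p,q)) = unit_sl n j i $$ (p,q)"
proof -
  note B = basis_sl_properties[OF assms]
  define I where "I = {..<n} \<times> {..<n}"
  have "\<exists>a. \<forall>i<n. \<forall>j<n. unit_sl n p q $$ (i,j) = (\<Sum>\<alpha>\<in>B. a \<alpha> * \<alpha> $$ (i,j))" if "p < n" "q < n" for p q
    by (rule B(3)[OF unit_sl_in_sl[OF that]])
  then obtain a where a: "\<And>p q i j. p < n \<Longrightarrow> q < n \<Longrightarrow> i < n \<Longrightarrow> j < n \<Longrightarrow>
      unit_sl n p q $$ (i,j) = (\<Sum>\<alpha>\<in>B. a p q \<alpha> * \<alpha> $$ (i,j))"
    by metis
  define \<beta> where "\<beta> = (\<lambda>\<alpha>. mat n n (\<lambda>(q,p). a p q \<alpha>))"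
  have \<beta>: "\<beta> \<alpha> \<in> carrier_mat n n" "\<And>p q. p < n \<Longrightarrow> q < n \<Longrightarrow> \<beta> \<alpha> $$ (q,p) = a p q \<alpha>" for \<alpha>
    by (auto simp: \<beta>_def)
  have coord: "c $$ (i,j) = (\<Sum>\<alpha>\<in>B. tr (\<beta> \<alpha> * c) * \<alpha> $$ (i,j))"
    if c: "c \<in> sl n" and ij: "i < n" "j < n" for c i j
  proof -
    have "c $$ (i,j) = (\<Sum>(p,q)\<in>I. c $$ (p,q) * (\<Sum>\<alpha>\<in>B. a p q \<alpha> * \<alpha> $$ (i,j)))"
      unfolding sl_expand_unit_sl[OF c ij] I_def[symmetric]
      by (intro sum.cong) (auto simp: I_def a ij)
    also have "\<dots> = (\<Sum>s\<in>I. \<Sum>\<alpha>\<in>B. c $$ s * a (fst s) (snd s) \<alpha> * \<alpha> $$ (i,j))"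
      by (simp add: case_prod_beta sum_distrib_left mult.assoc)
    also have "\<dots> = (\<Sum>\<alpha>\<in>B. (\<Sum>s\<in>I. c $$ s * a (fst s) (snd s) \<alpha>) * \<alpha> $$ (i,j))"
      unfolding sum_distrib_right by (rule sum.swap)
    also have "\<dots> = (\<Sum>\<alpha>\<in>B. tr (\<beta> \<alpha> * c) * \<alpha> $$ (i,j))"
    proof (intro sum.cong refl arg_cong2[where f="(*)"])
      fix \<alpha>
      have "tr (\<beta> \<alpha> * c) = (\<Sum>p<n. \<Sum>q<n. \<beta> \<alpha> $$ (q,p) * c $$ (p,q))"
        unfolding tr_mult[OF \<beta>(1) slD(1)[OF c]] by (rule sum.swap)
      also have "\<dots> = (\<Sum>p<n. \<Sum>q<n. c $$ (p,q) * a p q \<alpha>)"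
        by (intro sum.cong refl) (auto simp: \<beta>(2))
      finally show "(\<Sum>s\<in>I. c $$ s * a (fst s) (snd s) \<alpha>) = tr (\<beta> \<alpha> * c)"
        unfolding I_def sum.cartesian_product by (simp add: case_prod_beta)
    qed
    finally show ?thesis .
  qed
  show ?thesis
  proof
    fix \<alpha> assume \<alpha>: "\<alpha> \<in> B"
    \<comment> \<open>The trace of \<open>\<beta> \<alpha>\<close> is a coordinate of the projection of the identity, which is zero.\<close>
    have "(\<Sum>\<alpha>\<in>B. (\<Sum>p<n. a p p \<alpha>) * \<alpha> $$ (i,j)) = 0" if "i < n" "j < n" for i j
    proof -
      have "(\<Sum>\<alpha>\<in>B. (\<Sum>p<n. a p p \<alpha>) * \<alpha> $$ (i,j)) = (\<Sum>p<n. \<Sum>\<alpha>\<in>B. a p p \<alpha> * \<alpha> $$ (i,j))"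
        unfolding sum_distrib_right by (rule sum.swap)
      also have "\<dots> = (\<Sum>p<n. unit_sl n p p $$ (i,j))"
        using a that by (intro sum.cong refl) simp
      also have "\<dots> = (\<Sum>p<n. (if p = i then (if i = j then 1 else 0) else 0) - (if i = j then 1 / of_nat n else 0))"
        by (intro sum.cong refl) (use that in \<open>auto simp: unit_sl_index\<close>)
      also have "\<dots> = 0" using that by (simp add: sum_subtractf)
      finally show ?thesis .
    qed
    from B(4)[OF this \<alpha>] show "\<beta> \<alpha> \<in> sl n"
      by (intro slI) (use \<beta> in auto)
  next
    fix \<alpha> \<alpha>' assume \<alpha>: "\<alpha> \<in> B" "\<alpha>' \<in> B"
    have \<alpha>': "\<alpha>' \<in> sl n" using \<alpha> B(2) by auto
    have "(\<Sum>\<gamma>\<in>B. (tr (\<beta> \<gamma> * \<alpha>') - (if \<alpha>' = \<gamma> then 1 else 0)) * \<gamma> $$ (i,j)) = 0" if ij: "i < n" "j < n" for i j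
    proof -
      have "(\<Sum>\<gamma>\<in>B. (if \<alpha>' = \<gamma> then 1 else 0) * \<gamma> $$ (i,j)) = (\<Sum>\<gamma>\<in>B. if \<alpha>' = \<gamma> then \<alpha>' $$ (i,j) else 0)"
        by (intro sum.cong) auto
      also have "\<dots> = \<alpha>' $$ (i,j)" using B(1) \<alpha> by simp
      finally show ?thesis using coord[OF \<alpha>' ij] by (simp add: left_diff_distrib sum_subtractf)
    qed
    from B(4)[OF this \<alpha>(1)] show "tr (\<beta> \<alpha> * \<alpha>') = (if \<alpha>' = \<alpha> then 1 else 0)" by simp
  next
    fix i j p q assume *: "i < n" "j < n" "p < n" "q < n"
    have "(\<Sum>\<alpha>\<in>B. \<alpha> $$ (i,j) * \<beta> \<alpha> $$ (p,q)) = unit_sl n q p $$ (i,j)"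
      using * by (simp add: \<beta> a mult.commute)
    also have "\<dots> = unit_sl n j i $$ (p,q)" using * by (auto simp: unit_sl_index)
    finally show "(\<Sum>\<alpha>\<in>B. \<alpha> $$ (i,j) * \<beta> \<alpha> $$ (p,q)) = unit_sl n j i $$ (p,q)" .
  qed
qed

section \<open>Tensors and endomorphisms\<close>

lemma tens_index:
  "i < n \<Longrightarrow> j < n \<Longrightarrow> k < n \<Longrightarrow> l < n \<Longrightarrow> tens n a b (i,j,k,l) = a $$ (i,j) * b $$ (k,l)"
  by (simp add: tens_def)

lemma tensor_sum_out_of_range:
  "\<not> (i < n \<and> j < n \<and> k < n \<and> l < n) \<Longrightarrow> tensor_sum n ps (i,j,k,l) = 0"
  by (induction ps) (auto simp: tensor_sum_def tens_def)

lemma tensor_sum_Nil [simp]: "tensor_sum n [] \<iota> = 0"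
  and tensor_sum_Cons [simp]: "tensor_sum n ((a,b) # ps) \<iota> = tens n a b \<iota> + tensor_sum n ps \<iota>"
  by (simp_all add: tensor_sum_def)

lemma phi_index:
  "a \<in> carrier_mat n n \<Longrightarrow> i < n \<Longrightarrow> j < n \<Longrightarrow> phi a $$ (i,j) = - a $$ (j,i)"
  by (auto simp: phi_def)

text \<open>\<open>phi\<close> is minus the transposition, and the two signs cancel. The right-hand side sees only the
  coordinates of the tensor, which also shows that the choice of a decomposition is immaterial.\<close>
lemma tensor_map_phi_phi:
  assumes "set ps \<subseteq> sl n \<times> sl n"
  shows "tensor_map n phi phi (tensor_sum n ps) = (\<lambda>(i,j,k,l). tensor_sum n ps (j,i,l,k))"
proof -
  have *: "tensor_sum n (map (map_prod phi phi) qs) = (\<lambda>(i,j,k,l). tensor_sum n qs (j,i,l,k))"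
    if "set qs \<subseteq> sl n \<times> sl n" for qs
  proof (rule ext, clarify)
    fix i j k l
    show "tensor_sum n (map (map_prod phi phi) qs) (i,j,k,l) = tensor_sum n qs (j,i,l,k)"
      using that by (induction qs) (auto simp: tens_def phi_index dest!: slD(1))
  qed
  show ?thesis
    unfolding tensor_map_def
  proof (rule the_equality)
    show "\<exists>qs. set qs \<subseteq> sl n \<times> sl n \<and> tensor_sum n ps = tensor_sum n qs \<and>
       (\<lambda>(i,j,k,l). tensor_sum n ps (j,i,l,k)) = tensor_sum n (map (map_prod phi phi) qs)"
      using *[OF assms] assms by (intro exI[of _ ps]) simp
  next
    fix s assume "\<exists>qs. set qs \<subseteq> sl n \<times> sl n \<and> tensor_sum n ps = tensor_sum n qs \<and>
       s = tensor_sum n (map (map_prod phi phi) qs)"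
    then obtain qs where "set qs \<subseteq> sl n \<times> sl n" "tensor_sum n ps = tensor_sum n qs"
       "s = tensor_sum n (map (map_prod phi phi) qs)" by blast
    thus "s = (\<lambda>(i,j,k,l). tensor_sum n ps (j,i,l,k))" by (simp add: *)
  qed
qed

lemma tensor_end_index:
  assumes "set ps \<subseteq> sl n \<times> sl n" "c \<in> carrier_mat n n"
  shows "tensor_end n ps c \<in> carrier_mat n n"
    and "k < n \<Longrightarrow> l < n \<Longrightarrow> tensor_end n ps c $$ (k,l) = (\<Sum>(a,b)\<leftarrow>ps. tr (a * c) * b $$ (k,l))"
proof -
  have *: "tensor_end n ps c \<in> carrier_mat n n \<and> (\<forall>k<n. \<forall>l<n.
      tensor_end n ps c $$ (k,l) = (\<Sum>(a,b)\<leftarrow>ps. tr (a * c) * b $$ (k,l)))"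
    using assms(1)
  proof (induction ps)
    case (Cons p ps)
    obtain a b where p: "p = (a,b)" by (cases p)
    have b: "b \<in> carrier_mat n n" using Cons.prems p by (auto simp: sl_def)
    have "tensor_end n (p # ps) c = tr (a * c) \<cdot>\<^sub>m b + tensor_end n ps c"
      by (simp add: tensor_end_def p)
    thus ?case using Cons b p by auto
  qed (simp add: tensor_end_def)
  thus "tensor_end n ps c \<in> carrier_mat n n" by blast
  show "tensor_end n ps c $$ (k,l) = (\<Sum>(a,b)\<leftarrow>ps. tr (a * c) * b $$ (k,l))" if "k < n" "l < n"
    using * that by blast
qed

text \<open>Fixing the last two coordinates of a tensor leaves a traceless matrix, and pairing it with \<open>c\<close>
  computes an entry of the associated endomorphism at \<open>c\<close>.\<close>
lemma first_factor:
  assumes "set ps \<subseteq> sl n \<times> sl n" "k < n" "l < n"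
  shows "mat n n (\<lambda>(i,j). tensor_sum n ps (i,j,k,l)) \<in> sl n"
    and "c \<in> carrier_mat n n \<Longrightarrow>
      tr (mat n n (\<lambda>(i,j). tensor_sum n ps (i,j,k,l)) * c) = tensor_end n ps c $$ (k,l)"
proof -
  let ?M = "\<lambda>ps. mat n n (\<lambda>(i,j). tensor_sum n ps (i,j,k,l))"
  show "?M ps \<in> sl n"
    using assms(1)
  proof (induction ps)
    case (Cons p ps)
    obtain a b where p: "p = (a,b)" by (cases p)
    have a: "a \<in> sl n" using Cons.prems p by auto
    have "(\<Sum>i<n. ?M (p # ps) $$ (i,i)) = (\<Sum>i<n. a $$ (i,i)) * b $$ (k,l) + (\<Sum>i<n. ?M ps $$ (i,i))"
      by (simp add: p tens_index assms sum.distrib sum_distrib_right)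
    thus ?case using Cons slD(4)[OF a] by (auto intro!: slI simp: sl_def tr_def)
  qed (auto intro!: slI)
  assume c: "c \<in> carrier_mat n n"
  show "tr (?M ps * c) = tensor_end n ps c $$ (k,l)"
    unfolding tensor_end_index(2)[OF assms(1) c assms(2,3)]
    using assms(1)
  proof (induction ps)
    case Nil
    show ?case by (subst tr_mult[OF _ c]) auto
  next
    case (Cons p ps)
    obtain a b where p: "p = (a,b)" by (cases p)
    have a: "a \<in> carrier_mat n n" using Cons.prems p by (auto simp: sl_def)
    have "tr (?M (p # ps) * c) = (\<Sum>i<n. \<Sum>j<n. (a $$ (i,j) * c $$ (j,i)) * b $$ (k,l) + ?M ps $$ (i,j) * c $$ (j,i))"
      by (subst tr_mult[OF _ c]) (auto simp: p tens_index assms algebra_simps intro!: sum.cong)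
    also have "\<dots> = tr (a * c) * b $$ (k,l) + tr (?M ps * c)"
      by (simp add: tr_mult[OF a c] tr_mult[OF _ c, of "?M ps"] sum.distrib sum_distrib_right)
    finally show ?case using Cons by (simp add: p)
  qed
qed

text \<open>Injectivity of \<open>sl \<otimes> sl \<rightarrow> End sl\<close>: since the trace form is non-degenerate,
  each matrix in \<open>first_factor\<close> is determined by its pairings.\<close>
lemma tensor_sum_determined_by_end:
  assumes "set ps \<subseteq> sl n \<times> sl n" "set qs \<subseteq> sl n \<times> sl n"
    and eq: "\<And>c. c \<in> sl n \<Longrightarrow> tensor_end n ps c = tensor_end n qs c"
  shows "tensor_sum n ps = tensor_sum n qs"
proof (rule ext, clarify)
  fix i j k l
  show "tensor_sum n ps (i,j,k,l) = tensor_sum n qs (i,j,k,l)"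
  proof (cases "i < n \<and> j < n \<and> k < n \<and> l < n")
    case True
    let ?M = "\<lambda>ps. mat n n (\<lambda>(i,j). tensor_sum n ps (i,j,k,l))"
    let ?c = "unit_sl n j i"
    have c: "?c \<in> sl n" using True by (intro unit_sl_in_sl) auto
    have "?M ps $$ (i,j) = tr (?M ps * ?c)"
      using tr_mult_unit_sl[OF first_factor(1)[OF assms(1)]] True by simp
    also have "\<dots> = tr (?M qs * ?c)"
      using first_factor(2)[OF assms(1)] first_factor(2)[OF assms(2)] eq[OF c] True slD(1)[OF c] by simp
    also have "\<dots> = ?M qs $$ (i,j)"
      using tr_mult_unit_sl[OF first_factor(1)[OF assms(2)]] True by simp
    finally show ?thesis using True by simp
  next
    case False
    thus ?thesis by (simp add: tensor_sum_out_of_range)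
  qed
qed

text \<open>The tensor attached to a linear map \<open>D\<close> is \<open>\<Sum> u\<^sub>j\<^sub>i \<otimes> D u\<^sub>i\<^sub>j\<close> with \<open>u\<close> the
  projected matrix units, because \<open>tr (u\<^sub>j\<^sub>i c)\<close> is the entry of \<open>c\<close> at \<open>(i,j)\<close>.\<close>
lemma tensor_of_end_linear:
  assumes D: "lin_map n D" "\<And>c. c \<in> sl n \<Longrightarrow> D c \<in> sl n"
    and h: "\<And>c. c \<in> sl n \<Longrightarrow> h c = D c"
  obtains ps where "set ps \<subseteq> sl n \<times> sl n" "tensor_of_end n h = tensor_sum n ps"
    and "\<And>i j k l. i < n \<Longrightarrow> j < n \<Longrightarrow> k < n \<Longrightarrow> l < n \<Longrightarrow>
      tensor_sum n ps (i,j,k,l) = D (unit_sl n j i) $$ (k,l)"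
proof -
  define idx where "idx = List.product [0..<n] [0..<n]"
  define ps where "ps = map (\<lambda>(i,j). (unit_sl n j i, D (unit_sl n i j))) idx"
  have sum_idx: "sum_list (map f idx) = (\<Sum>s\<in>{..<n}\<times>{..<n}. f s)" for f :: "nat \<times> nat \<Rightarrow> complex"
    by (subst sum_list_distinct_conv_sum_set) (auto simp: idx_def distinct_product atLeast0LessThan)
  have ps: "set ps \<subseteq> sl n \<times> sl n"
    using D by (auto simp: ps_def idx_def unit_sl_in_sl)
  have ends: "tensor_end n ps c = D c" if c: "c \<in> sl n" for c
  proof (rule eq_matI)
    fix k l assume "k < dim_row (D c)" "l < dim_col (D c)"
    hence kl: "k < n" "l < n" using slD[OF D(2)[OF c]] by auto
    have "tensor_end n ps c $$ (k,l) = (\<Sum>s\<in>{..<n}\<times>{..<n}.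
        tr (unit_sl n (snd s) (fst s) * c) * D (unit_sl n (fst s) (snd s)) $$ (k,l))"
      unfolding tensor_end_index(2)[OF ps slD(1)[OF c] kl] sum_idx[symmetric]
      by (simp add: ps_def case_prod_beta o_def)
    also have "\<dots> = (\<Sum>s\<in>{..<n}\<times>{..<n}. c $$ s * D (unit_sl n (fst s) (snd s)) $$ (k,l))"
      by (intro sum.cong refl)
        (auto simp: tr_mult_commute[OF unit_sl_dim(1) slD(1)[OF c]] tr_mult_unit_sl[OF c])
    also have "\<dots> = D c $$ (k,l)"
      by (rule lin_map_combination[OF D(1), symmetric])
        (use kl slD(1)[OF c] in \<open>auto simp: sl_expand_unit_sl[OF c] case_prod_beta\<close>)
    finally show "tensor_end n ps c $$ (k,l) = D c $$ (k,l)" .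
  qed (use tensor_end_index(1)[OF ps slD(1)[OF c]] slD[OF D(2)[OF c]] in auto)
  have "tensor_of_end n h = tensor_sum n ps"
    unfolding tensor_of_end_def
  proof (rule the_equality)
    show "\<exists>qs. set qs \<subseteq> sl n \<times> sl n \<and> tensor_sum n ps = tensor_sum n qs \<and> (\<forall>c\<in>sl n. tensor_end n qs c = h c)"
      using ps ends h by (intro exI[of _ ps]) simp
  next
    fix t assume "\<exists>qs. set qs \<subseteq> sl n \<times> sl n \<and> t = tensor_sum n qs \<and> (\<forall>c\<in>sl n. tensor_end n qs c = h c)"
    thus "t = tensor_sum n ps" using tensor_sum_determined_by_end[OF _ ps] ends h by metis
  qed
  moreover have "tensor_sum n ps (i,j,k,l) = D (unit_sl n j i) $$ (k,l)"
    if "i < n" "j < n" "k < n" "l < n" for i j k l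
  proof -
    have c: "unit_sl n j i \<in> sl n" using that by (intro unit_sl_in_sl)
    show ?thesis
      using tr_mult_unit_sl[OF first_factor(1)[OF ps], of k l j i] that
        first_factor(2)[OF ps, of k l "unit_sl n j i"] ends[OF c] by simp
  qed
  ultimately show ?thesis using that ps by blast
qed

section \<open>Non-degeneracy of the form attached to J\<close>

text \<open>The Euclidean algorithm by subtraction, which is the recursion that defines \<open>J_mat\<close>.\<close>
lemma coprime_pair_induct [consumes 3, case_names base right left]:
  fixes e d :: nat
  assumes "e > 0" "d > 0" "coprime e d"
    and base: "P 1 1"
    and right: "\<And>a b. a > 0 \<Longrightarrow> b > 0 \<Longrightarrow> coprime a b \<Longrightarrow> P a b \<Longrightarrow> P a (a + b)"
    and left: "\<And>a b. a > 0 \<Longrightarrow> b > 0 \<Longrightarrow> coprime a b \<Longrightarrow> P a b \<Longrightarrow> P (a + b) b"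
  shows "P e d"
  using assms(1-3)
proof (induction "e + d" arbitrary: e d rule: less_induct)
  case less
  consider "e = d" | "e < d" | "d < e" by linarith
  thus ?case
  proof cases
    case 1
    hence "e = 1" "d = 1" using less.prems by auto
    thus ?thesis using base by simp
  next
    case 2
    then obtain k where k: "d = e + k" "k > 0" using less_imp_add_positive by blast
    hence "coprime e k" using less.prems(3) by (simp add: coprime_iff_gcd_eq_1)
    moreover from this have "P e k" using less k by (intro less.hyps) auto
    ultimately show ?thesis using right[of e k] k less.prems by simp
  next
    case 3
    then obtain k where k: "e = k + d" "k > 0" using less_imp_add_positive by (metis add.commute)
    hence "coprime k d" using less.prems(3) by (simp add: coprime_iff_gcd_eq_1)
    moreover from this have "P k d" using less k by (intro less.hyps) auto
    ultimately show ?thesis using left[of k d] k less.prems by simp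
  qed
qed

lemma J_mat_carrier:
  assumes "e > 0" "d > 0" "coprime e d"
  shows "J_mat e d \<in> carrier_mat (e + d) (e + d)"
  using assms
proof (induction e d rule: coprime_pair_induct)
  case base
  show ?case unfolding J_mat_1_1 by (simp add: mat_of_rows_list_def numeral_2_eq_2)
next
  case (right a b)
  thus ?case by (simp add: J_mat_step_right four_block_carrier_mat)
next
  case (left a b)
  thus ?case by (simp add: J_mat_step_left four_block_carrier_mat)
qed

lemma split_block_lower:
  assumes "Q \<in> carrier_mat (e + d) (e + d)"
    and "\<And>i j. i < e \<Longrightarrow> e \<le> j \<Longrightarrow> j < e + d \<Longrightarrow> Q $$ (i,j) = 0"
  shows "Q = four_block_mat (mat e e (\<lambda>(i,j). Q $$ (i,j))) (0\<^sub>m e d)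
     (mat d e (\<lambda>(i,j). Q $$ (i + e, j))) (mat d d (\<lambda>(i,j). Q $$ (i + e, j + e)))"
  by (rule eq_matI) (use assms in auto)

text \<open>Up to transposition this is the non-degeneracy of \<open>\<omega>\<^sub>K\<close> on the parabolic subalgebra, for
  which scalar matrices are the only radical. The induction works because the identity block that one step of the recursion adds to \<open>J\<close> forces the
  larger diagonal block of \<open>Q\<close> to be block triangular for the smaller pair \<open>(a,b)\<close> and expresses its
  bracket with the smaller \<open>J\<close> through the off-diagonal block of \<open>Q\<close>. So the larger
  diagonal block is scalar by induction, and then so is \<open>Q\<close>.\<close>
lemma J_mat_nondegenerate:
  assumes "e > 0" "d > 0" "coprime e d"
    and "Q \<in> carrier_mat (e + d) (e + d)"
    and "\<And>i j. i < e \<Longrightarrow> e \<le> j \<Longrightarrow> j < e + d \<Longrightarrow> Q $$ (i,j) = 0"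
    and "\<And>i j. i < e + d \<Longrightarrow> j < e + d \<Longrightarrow> i < e \<or> e \<le> j \<Longrightarrow> bracket Q (J_mat e d) $$ (i,j) = 0"
  shows "\<exists>c. Q = c \<cdot>\<^sub>m 1\<^sub>m (e + d)"
  using assms
proof (induction e d arbitrary: Q rule: coprime_pair_induct)
  case base
  have Q: "Q \<in> carrier_mat 2 2" using base(1) by (simp add: numeral_2_eq_2)
  have J: "J_mat 1 1 \<in> carrier_mat 2 2" "J_mat 1 1 $$ (0,0) = 0" "J_mat 1 1 $$ (0,1) = 1"
      "J_mat 1 1 $$ (1,0) = 0" "J_mat 1 1 $$ (1,1) = 0"
    unfolding J_mat_1_1 by (simp_all add: mat_of_rows_list_def numeral_2_eq_2)
  have s: "(\<Sum>k<2. f k) = f 0 + f 1" for f :: "nat \<Rightarrow> complex" by (simp add: numeral_2_eq_2)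
  have 1: "Q $$ (0,1) = 0" using base(2)[of 0 1] by simp
  have 2: "bracket Q (J_mat 1 1) $$ (0,0) = 0" "bracket Q (J_mat 1 1) $$ (0,1) = 0"
    using base(3)[of 0 0] base(3)[of 0 1] by simp_all
  have 3: "Q $$ (1,0) = 0" "Q $$ (0,0) = Q $$ (1,1)"
    using 2 J 1 bracket_index[OF Q J(1), of 0 0] bracket_index[OF Q J(1), of 0 1]
    by (simp_all add: s)
  show ?case
  proof (intro exI eq_matI)
    fix i j assume "i < dim_row (Q $$ (0,0) \<cdot>\<^sub>m 1\<^sub>m (1 + 1))" "j < dim_col (Q $$ (0,0) \<cdot>\<^sub>m 1\<^sub>m (1 + 1))"
    hence "i = 0 \<or> i = 1" "j = 0 \<or> j = 1" by auto
    thus "Q $$ (i,j) = (Q $$ (0,0) \<cdot>\<^sub>m 1\<^sub>m (1 + 1)) $$ (i,j)" using 1 3 by auto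
  qed (use Q in auto)
next
  case (right a b)
  \<comment> \<open>\<open>K\<close> is the upper right block \<open>(1 0)\<close> of the new matrix: multiplication by it selects
    the first \<open>a\<close> rows, or pads with zero columns.\<close>
  define K where "K = four_block_mat (1\<^sub>m a) (0\<^sub>m a b) (0\<^sub>m 0 a) (0\<^sub>m 0 b :: complex mat)"
  define J' where "J' = J_mat a b"
  have J': "J' \<in> carrier_mat (a + b) (a + b)" using right J_mat_carrier by (simp add: J'_def)
  have K: "K \<in> carrier_mat a (a + b)" by (auto simp: K_def four_block_carrier_mat)
  have K_index: "K $$ (i,j) = (if i = j then 1 else 0)" if "i < a" "j < a + b" for i j
    using that by (auto simp: K_def)
  define A where "A = mat a a (\<lambda>(i,j). Q $$ (i,j))"
  define B where "B = mat (a + b) a (\<lambda>(i,j). Q $$ (i + a,j))"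
  define C where "C = mat (a + b) (a + b) (\<lambda>(i,j). Q $$ (i + a,j + a))"
  have ABC: "A \<in> carrier_mat a a" "B \<in> carrier_mat (a + b) a" "C \<in> carrier_mat (a + b) (a + b)"
    by (auto simp: A_def B_def C_def)
  have Q: "Q = four_block_mat A (0\<^sub>m a (a + b)) B C"
    unfolding A_def B_def C_def by (rule split_block_lower) (use right.prems in auto)
  have J: "J_mat a (a + b) = four_block_mat (0\<^sub>m a a) K (0\<^sub>m (a + b) a) J'"
    unfolding K_def J'_def using right by (simp add: J_mat_step_right)
  have QJ: "Q * J_mat a (a + b) = four_block_mat (0\<^sub>m a a) (A * K) (0\<^sub>m (a + b) a) (B * K + C * J')"
    unfolding Q J using ABC K J'
    by (subst mult_four_block_mat[of _ a a _ "a + b" _ "a + b" _ _ a _ "a + b"]) auto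
  have JQ: "J_mat a (a + b) * Q = four_block_mat (K * B) (K * C) (J' * B) (J' * C)"
    unfolding Q J using ABC K J'
    by (subst mult_four_block_mat[of _ a a _ "a + b" _ "a + b" _ _ a _ "a + b"]) auto
  have br: "bracket Q (J_mat a (a + b)) $$ (i,j) = (Q * J_mat a (a + b)) $$ (i,j) - (J_mat a (a + b) * Q) $$ (i,j)"
    if "i < a + (a + b)" "j < a + (a + b)" for i j
    unfolding bracket_def using that ABC K J' by (subst index_minus_mat) (auto simp: JQ)
  have KB: "(K * B) $$ (i,j) = B $$ (i,j)" if "i < a" "j < a" for i j
    using that by (simp add: index_mult_sum[OF K ABC(2)] K_index if_distrib[of "\<lambda>x. x * _"] cong: if_cong)
  have KC: "(K * C) $$ (i,j) = C $$ (i,j)" if "i < a" "j < a + b" for i j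
    using that by (simp add: index_mult_sum[OF K ABC(3)] K_index if_distrib[of "\<lambda>x. x * _"] cong: if_cong)
  have AK: "(A * K) $$ (i,j) = (if j < a then A $$ (i,j) else 0)" if "i < a" "j < a + b" for i j
    using that by (simp add: index_mult_sum[OF ABC(1) K] K_index if_distrib[of "\<lambda>x. _ * x"] cong: if_cong)
  have BK: "(B * K) $$ (i,j) = (if j < a then B $$ (i,j) else 0)" if "i < a + b" "j < a + b" for i j
    using that by (simp add: index_mult_sum[OF ABC(2) K] K_index if_distrib[of "\<lambda>x. _ * x"] cong: if_cong)
  have B0: "B $$ (i,j) = 0" if "i < a" "j < a" for i j
    using right.prems(3)[of i j] that br[of i j] ABC K J' by (simp add: QJ JQ KB del: index_mult_mat(1))
  have CA: "C $$ (i,j) = (if j < a then A $$ (i,j) else 0)" if "i < a" "j < a + b" for i j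
    using right.prems(3)[of i "j + a"] that br[of i "j + a"] ABC K J'
    by (simp add: QJ JQ KC AK del: index_mult_mat(1) split: if_splits)
  have brC: "bracket C J' $$ (i,j) = - (if j < a then B $$ (i,j) else 0)" if "i < a + b" "j < a + b" for i j
  proof -
    have "(B * K) $$ (i,j) + (C * J') $$ (i,j) - (J' * C) $$ (i,j) = 0"
      using right.prems(3)[of "i + a" "j + a"] that br[of "i + a" "j + a"] ABC K J'
      by (simp add: QJ JQ del: index_mult_mat(1))
    moreover have "bracket C J' $$ (i,j) = (C * J') $$ (i,j) - (J' * C) $$ (i,j)"
      unfolding bracket_def using that ABC J' by (subst index_minus_mat) auto
    moreover have "w = - u" if "u + v - z = 0" "w = v - z" for u v w z :: complex
      using that by (metis add_diff_eq add.commute eq_neg_iff_add_eq_0)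
    ultimately have "bracket C J' $$ (i,j) = - (B * K) $$ (i,j)" by blast
    thus ?thesis using BK[OF that] by simp
  qed
  have C0: "C $$ (i,j) = 0" if "i < a" "a \<le> j" "j < a + b" for i j
    using CA[of i j] that by simp
  have brC0': "bracket C J' $$ (i,j) = 0" if "i < a + b" "j < a + b" "i < a \<or> a \<le> j" for i j
    using brC[of i j] that B0[of i j] by auto
  obtain c where c: "C = c \<cdot>\<^sub>m 1\<^sub>m (a + b)"
    using right.IH[OF ABC(3) C0 brC0'[unfolded J'_def]] by blast
  have brC0: "bracket C J' = 0\<^sub>m (a + b) (a + b)"
    unfolding c bracket_def using J' mult_smult_distrib[OF J' one_carrier_mat[of "a + b"], of c]
      mult_smult_assoc_mat[OF one_carrier_mat[of "a + b"] J', of c] by auto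
  have B: "B = 0\<^sub>m (a + b) a"
  proof (rule eq_matI)
    fix i j assume "i < dim_row (0\<^sub>m (a + b) a :: complex mat)" "j < dim_col (0\<^sub>m (a + b) a :: complex mat)"
    thus "B $$ (i,j) = 0\<^sub>m (a + b) a $$ (i,j)" using brC[of i j] brC0 by simp
  qed (use ABC in auto)
  have A: "A = c \<cdot>\<^sub>m 1\<^sub>m a"
  proof (rule eq_matI)
    fix i j assume "i < dim_row (c \<cdot>\<^sub>m 1\<^sub>m a)" "j < dim_col (c \<cdot>\<^sub>m 1\<^sub>m a)"
    thus "A $$ (i,j) = (c \<cdot>\<^sub>m 1\<^sub>m a) $$ (i,j)" using CA[of i j] c by simp
  qed (use ABC in auto)
  have "Q = c \<cdot>\<^sub>m 1\<^sub>m (a + (a + b))"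
    unfolding Q A B c by (rule eq_matI) auto
  thus ?case by blast
next
  case (left a b)
  \<comment> \<open>Here the new upper right block has the identity at the bottom, so that \<open>K\<close> selects the last
    \<open>b\<close> columns, or pads with zero rows.\<close>
  define K where "K = four_block_mat (0\<^sub>m a b) (0\<^sub>m a 0) (1\<^sub>m b) (0\<^sub>m b 0 :: complex mat)"
  define J' where "J' = J_mat a b"
  have J': "J' \<in> carrier_mat (a + b) (a + b)" using left J_mat_carrier by (simp add: J'_def)
  have K: "K \<in> carrier_mat (a + b) b" by (auto simp: K_def four_block_carrier_mat)
  have K_index: "K $$ (i,j) = (if i = a + j then 1 else 0)" if "i < a + b" "j < b" for i j
    using that by (auto simp: K_def)
  define A where "A = mat (a + b) (a + b) (\<lambda>(i,j). Q $$ (i,j))"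
  define B where "B = mat b (a + b) (\<lambda>(i,j). Q $$ (i + (a + b),j))"
  define C where "C = mat b b (\<lambda>(i,j). Q $$ (i + (a + b),j + (a + b)))"
  have ABC: "A \<in> carrier_mat (a + b) (a + b)" "B \<in> carrier_mat b (a + b)" "C \<in> carrier_mat b b"
    by (auto simp: A_def B_def C_def)
  have Q: "Q = four_block_mat A (0\<^sub>m (a + b) b) B C"
    unfolding A_def B_def C_def by (rule split_block_lower) (use left.prems in auto)
  have J: "J_mat (a + b) b = four_block_mat J' K (0\<^sub>m b (a + b)) (0\<^sub>m b b)"
    unfolding K_def J'_def using left by (simp add: J_mat_step_left)
  have QJ: "Q * J_mat (a + b) b = four_block_mat (A * J') (A * K) (B * J') (B * K)"
    unfolding Q J using ABC K J'
    by (subst mult_four_block_mat[of _ "a + b" "a + b" _ b _ b _ _ "a + b" _ b]) auto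
  have JQ: "J_mat (a + b) b * Q = four_block_mat (J' * A + K * B) (K * C) (0\<^sub>m b (a + b)) (0\<^sub>m b b)"
    unfolding Q J using ABC K J'
    by (subst mult_four_block_mat[of _ "a + b" "a + b" _ b _ b _ _ "a + b" _ b]) auto
  have br: "bracket Q (J_mat (a + b) b) $$ (i,j) = (Q * J_mat (a + b) b) $$ (i,j) - (J_mat (a + b) b * Q) $$ (i,j)"
    if "i < a + b + b" "j < a + b + b" for i j
    unfolding bracket_def using that ABC K J' by (subst index_minus_mat) (auto simp: JQ)
  have KB: "(K * B) $$ (i,j) = (if a \<le> i then B $$ (i - a,j) else 0)" if "i < a + b" "j < a + b" for i j
  proof -
    have "(K * B) $$ (i,j) = (\<Sum>k<b. if a \<le> i \<and> k = i - a then B $$ (k,j) else 0)"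
      unfolding index_mult_sum[OF K ABC(2) that] by (intro sum.cong refl) (use that in \<open>auto simp: K_index\<close>)
    thus ?thesis using that by auto
  qed
  have KC: "(K * C) $$ (i,j) = (if a \<le> i then C $$ (i - a,j) else 0)" if "i < a + b" "j < b" for i j
  proof -
    have "(K * C) $$ (i,j) = (\<Sum>k<b. if a \<le> i \<and> k = i - a then C $$ (k,j) else 0)"
      unfolding index_mult_sum[OF K ABC(3) that] by (intro sum.cong refl) (use that in \<open>auto simp: K_index\<close>)
    thus ?thesis using that by auto
  qed
  have AK: "(A * K) $$ (i,j) = A $$ (i,a + j)" if "i < a + b" "j < b" for i j
    using that by (simp add: index_mult_sum[OF ABC(1) K] K_index if_distrib[of "\<lambda>x. _ * x"] cong: if_cong)
  have BK: "(B * K) $$ (i,j) = B $$ (i,a + j)" if "i < b" "j < b" for i j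
    using that by (simp add: index_mult_sum[OF ABC(2) K] K_index if_distrib[of "\<lambda>x. _ * x"] cong: if_cong)
  have B0: "B $$ (i,j) = 0" if "i < b" "a \<le> j" "j < a + b" for i j
    using left.prems(3)[of "i + (a + b)" "(j - a) + (a + b)"] that br[of "i + (a + b)" "(j - a) + (a + b)"] ABC K J' BK[of i "j - a"]
    by (simp add: QJ JQ del: index_mult_mat(1))
  have AC: "A $$ (i,a + j) = (if a \<le> i then C $$ (i - a,j) else 0)" if "i < a + b" "j < b" for i j
    using left.prems(3)[of i "j + (a + b)"] that br[of i "j + (a + b)"] ABC K J'
    by (simp add: QJ JQ KC AK del: index_mult_mat(1) split: if_splits)
  have brA: "bracket A J' $$ (i,j) = (if a \<le> i then B $$ (i - a,j) else 0)" if "i < a + b" "j < a + b" for i j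
  proof -
    have "(A * J') $$ (i,j) - ((J' * A) $$ (i,j) + (K * B) $$ (i,j)) = 0"
      using left.prems(3)[of i j] that br[of i j] ABC K J'
      by (simp add: QJ JQ del: index_mult_mat(1))
    moreover have "bracket A J' $$ (i,j) = (A * J') $$ (i,j) - (J' * A) $$ (i,j)"
      unfolding bracket_def using that ABC J' by (subst index_minus_mat) auto
    moreover have "w = v" if "u - (z + v) = 0" "w = u - z" for u v w z :: complex
      using that by (metis diff_diff_add eq_iff_diff_eq_0)
    ultimately have "bracket A J' $$ (i,j) = (K * B) $$ (i,j)" by blast
    thus ?thesis using KB[OF that] by simp
  qed
  have A0: "A $$ (i,j) = 0" if "i < a" "a \<le> j" "j < a + b" for i j
    using AC[of i "j - a"] that by simp
  have brA0': "bracket A J' $$ (i,j) = 0" if "i < a + b" "j < a + b" "i < a \<or> a \<le> j" for i j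
    using brA[of i j] that B0[of "i - a" j] by auto
  obtain c where c: "A = c \<cdot>\<^sub>m 1\<^sub>m (a + b)"
    using left.IH[OF ABC(1) A0 brA0'[unfolded J'_def]] by blast
  have brA0: "bracket A J' = 0\<^sub>m (a + b) (a + b)"
    unfolding c bracket_def using J' mult_smult_distrib[OF J' one_carrier_mat[of "a + b"], of c]
      mult_smult_assoc_mat[OF one_carrier_mat[of "a + b"] J', of c] by auto
  have B: "B = 0\<^sub>m b (a + b)"
  proof (rule eq_matI)
    fix i j assume "i < dim_row (0\<^sub>m b (a + b) :: complex mat)" "j < dim_col (0\<^sub>m b (a + b) :: complex mat)"
    thus "B $$ (i,j) = 0\<^sub>m b (a + b) $$ (i,j)" using brA[of "i + a" j] brA0 by simp
  qed (use ABC in auto)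
  have C: "C = c \<cdot>\<^sub>m 1\<^sub>m b"
  proof (rule eq_matI)
    fix i j assume "i < dim_row (c \<cdot>\<^sub>m 1\<^sub>m b)" "j < dim_col (c \<cdot>\<^sub>m 1\<^sub>m b)"
    thus "C $$ (i,j) = (c \<cdot>\<^sub>m 1\<^sub>m b) $$ (i,j)" using AC[of "i + a" j] c by simp
  qed (use ABC in auto)
  have "Q = c \<cdot>\<^sub>m 1\<^sub>m (a + b + b)"
    unfolding Q C B c by (rule eq_matI) auto
  thus ?case by blast
qed

section \<open>The correction maps\<close>

abbreviation upr :: "nat \<Rightarrow> nat \<Rightarrow> complex mat \<Rightarrow> complex mat" where
  "upr e \<equiv> mask (\<lambda>i j. i < e \<and> e \<le> j)"
abbreviation diag :: "nat \<Rightarrow> nat \<Rightarrow> complex mat \<Rightarrow> complex mat" where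
  "diag e \<equiv> mask (\<lambda>i j. i < e \<longleftrightarrow> j < e)"
abbreviation lwr :: "nat \<Rightarrow> nat \<Rightarrow> complex mat \<Rightarrow> complex mat" where
  "lwr e \<equiv> mask (\<lambda>i j. e \<le> i \<and> j < e)"

text \<open>The lower left block of \<open>B\<close> absorbs the only block of the bracket that
  \<open>J_mat_nondegenerate\<close> leaves unrestricted, and a traceless scalar matrix is zero.\<close>
lemma parabolic_equation_injective:
  fixes Q B :: "complex mat"
  assumes ed: "e > 0" "d > 0" "coprime e d" and n: "n = e + d"
    and Q: "Q \<in> sl n" "upr e n Q = 0\<^sub>m n n" 
    and B: "B \<in> carrier_mat n n" "lwr e n B = B"
    and eq: "bracket Q (J_mat e d) + B = 0\<^sub>m n n"
  shows "Q = 0\<^sub>m n n" "B = 0\<^sub>m n n"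
proof -
  note J = J_mat_carrier[OF ed, folded n]
  have br: "bracket Q (J_mat e d) \<in> carrier_mat n n" using slD(1)[OF Q(1)] J by simp
  have brB: "bracket Q (J_mat e d) $$ (i,j) = - B $$ (i,j)" if "i < n" "j < n" for i j
  proof -
    have "(bracket Q (J_mat e d) + B) $$ (i,j) = 0" using eq that by simp
    thus ?thesis using that br B by (simp add: eq_neg_iff_add_eq_0)
  qed
  have Q0: "Q $$ (i,j) = 0" if "i < e" "e \<le> j" "j < e + d" for i j
  proof -
    have "upr e n Q $$ (i,j) = 0" using Q(2) that n by simp
    thus ?thesis using that n by simp
  qed
  have B0: "B $$ (i,j) = 0" if "i < n" "j < n" "i < e \<or> e \<le> j" for i j
  proof -
    have "B $$ (i,j) = lwr e n B $$ (i,j)" using B(2) by simp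
    thus ?thesis using that by auto
  qed
  have "\<exists>c. Q = c \<cdot>\<^sub>m 1\<^sub>m (e + d)"
    by (rule J_mat_nondegenerate[OF ed]) (use Q0 B0 brB slD[OF Q(1)] n in auto)
  then obtain c where c: "Q = c \<cdot>\<^sub>m 1\<^sub>m n" using n by blast
  have "of_nat n * c = 0" using slD(4)[OF Q(1)] by (simp add: c)
  moreover have "of_nat n \<noteq> (0 :: complex)" using ed n unfolding of_nat_eq_0_iff by simp
  ultimately have "c = 0" by simp
  thus Q: "Q = 0\<^sub>m n n" by (auto simp: c)
  have "bracket Q (J_mat e d) = 0\<^sub>m n n" unfolding Q bracket_def using J by simp
  thus "B = 0\<^sub>m n n" using eq B(1) by simp
qed

lemma tr_add: "A \<in> carrier_mat n n \<Longrightarrow> B \<in> carrier_mat n n \<Longrightarrow> tr (A + B) = tr A + tr B"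
  by (simp add: tr_def sum.distrib)

lemma tr_smult: "A \<in> carrier_mat n n \<Longrightarrow> tr (s \<cdot>\<^sub>m A) = s * tr (A :: complex mat)"
  by (simp add: tr_def sum_distrib_left)

text \<open>The unknowns \<open>q R\<close> (traceless, block lower triangular) and \<open>b R\<close> (lower left block only) together
  have as many degrees of freedom as a traceless \<open>R\<close>, so \<open>parabolic_equation_injective\<close> makes the
  equation solvable. Both the surjectivity of the evaluation map on \<open>Sol\<close> and the existence of dual
  elements in \<open>w_space\<close> come from here.\<close>
lemma parabolic_equation_solver:
  assumes ed: "e > 0" "d > 0" "coprime e d" and n: "n = e + d"
  obtains q b where "lin_map n q" "lin_map n b"
    and "\<And>R. R \<in> sl n \<Longrightarrow> q R \<in> sl n"
    and "\<And>R. upr e n (q R) = 0\<^sub>m n n" "\<And>R. lwr e n (b R) = b R"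
    and "\<And>R. R \<in> sl n \<Longrightarrow> bracket (q R) (J_mat e d) + b R = R"
proof -
  note J = J_mat_carrier[OF ed, folded n]
  let ?low = "mask (\<lambda>i j. \<not> (i < e \<and> e \<le> j)) n"
  \<comment> \<open>The two unknowns are packed into one matrix \<open>M\<close>: \<open>q\<close> is its lower part, \<open>b\<close> the transpose of
    its upper right block. The multiple of the identity makes \<open>T\<close> injective on all matrices; comparing
    traces shows that it vanishes as soon as the value of \<open>T\<close> is traceless.\<close>
  define T where "T = (\<lambda>M. (bracket (?low M) (J_mat e d) + lwr e n (transpose_mat M)) + tr M \<cdot>\<^sub>m 1\<^sub>m n)"
  have tr: "lin_map n (\<lambda>M. tr M \<cdot>\<^sub>m 1\<^sub>m n)"
    by (rule lin_mapI) (auto simp: tr_add[of _ n] tr_smult[of _ n])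
  have T: "lin_map n T"
    unfolding T_def
    by (intro lin_map_add tr lin_map_comp[OF lin_map_pick lin_map_transpose]
        lin_map_comp[OF lin_map_bracket[OF J] lin_map_pick])
  have tr_low: "tr (?low M) = tr M" if "M \<in> carrier_mat n n" for M
    using that by (auto simp: tr_def)
  have trT: "tr (T M) = of_nat n * tr M" if "M \<in> carrier_mat n n" for M
  proof -
    have "tr (lwr e n (transpose_mat M)) = 0" unfolding tr_def by (intro sum.neutral) auto
    moreover have "tr (bracket (?low M) (J_mat e d)) = 0"
      using bracket_in_sl[of "?low M" n "J_mat e d"] J by (simp add: sl_def)
    moreover have "tr (tr M \<cdot>\<^sub>m 1\<^sub>m n) = of_nat n * tr M" by (simp add: tr_def)
    ultimately show ?thesis using J unfolding T_def by (simp add: tr_add[of _ n])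
  qed
  have tr0: "tr M = 0" if "M \<in> carrier_mat n n" "tr (T M) = 0" for M
  proof -
    have "of_nat n \<noteq> (0 :: complex)" using ed n unfolding of_nat_eq_0_iff by simp
    thus ?thesis using trT[OF that(1)] that(2) by simp
  qed
  have T0: "T M = bracket (?low M) (J_mat e d) + lwr e n (transpose_mat M)"
    if "M \<in> carrier_mat n n" "tr (T M) = 0" for M
    unfolding T_def tr0[OF that] using J by (intro eq_matI) auto
  have low_sl: "?low M \<in> sl n" if "M \<in> carrier_mat n n" "tr (T M) = 0" for M
    using tr_low[OF that(1)] tr0[OF that] by (simp add: sl_def)
  have up_low: "upr e n (?low M) = 0\<^sub>m n n" for M by (rule eq_matI) auto
  have lwr_lwr: "lwr e n (lwr e n M) = lwr e n M" for M by (rule eq_matI) auto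
  have "\<exists>S. lin_map n S \<and> (\<forall>R\<in>carrier_mat n n. T (S R) = R)"
  proof (rule injective_lin_map_has_right_inverse[OF T])
    fix M assume M: "M \<in> carrier_mat n n" and TM: "T M = 0\<^sub>m n n"
    hence tTM: "tr (T M) = 0" by (simp add: tr_def)
    note inj = parabolic_equation_injective[OF ed n low_sl[OF M tTM] up_low _ lwr_lwr T0[OF M tTM, symmetric, unfolded TM]]
    have 1: "?low M = 0\<^sub>m n n" and 2: "lwr e n (transpose_mat M) = 0\<^sub>m n n"
      by (rule inj; simp)+
    show "M = 0\<^sub>m n n"
    proof (rule eq_matI)
      fix i j assume "i < dim_row (0\<^sub>m n n :: complex mat)" "j < dim_col (0\<^sub>m n n :: complex mat)"
      hence ij: "i < n" "j < n" by auto
      show "M $$ (i,j) = 0\<^sub>m n n $$ (i,j)"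
      proof (cases "i < e \<and> e \<le> j")
        case True
        have "lwr e n (transpose_mat M) $$ (j,i) = 0" using 2 ij by simp
        thus ?thesis using True ij M by simp
      next
        case False
        have "?low M $$ (i,j) = 0" using 1 ij by simp
        thus ?thesis using False ij by auto
      qed
    qed (use M in auto)
  qed
  then obtain S where S: "lin_map n S" "\<And>R. R \<in> carrier_mat n n \<Longrightarrow> T (S R) = R" by blast
  have SC: "S R \<in> carrier_mat n n" "tr (T (S R)) = 0" if "R \<in> sl n" for R
    using that lin_map_carrier[OF S(1)] S(2) by (auto simp: sl_def)
  show ?thesis
  proof
    show "lin_map n (\<lambda>R. ?low (S R))" by (rule lin_map_comp[OF lin_map_pick S(1)])
    show "lin_map n (\<lambda>R. lwr e n (transpose_mat (S R)))"
      by (rule lin_map_comp[OF lin_map_pick lin_map_comp[OF lin_map_transpose S(1)]])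
  next
    fix R :: "complex mat" assume R: "R \<in> sl n"
    show "?low (S R) \<in> sl n" by (rule low_sl[OF SC[OF R]])
    show "bracket (?low (S R)) (J_mat e d) + lwr e n (transpose_mat (S R)) = R"
      using T0[OF SC[OF R]] S(2)[OF slD(1)[OF R]] by simp
  next
    fix R show "upr e n (?low (S R)) = 0\<^sub>m n n" by (rule up_low)
    show "lwr e n (lwr e n (transpose_mat (S R))) = lwr e n (transpose_mat (S R))" by (rule lwr_lwr)
  qed
qed

text \<open>\<open>g\<close> is the value at the pole. For the element of \<open>Sol\<close> with value \<open>g\<close> at \<open>x\<close>, divided by \<open>z - x\<close>,
  the polynomial part is affine in \<open>x\<close>; the maps \<open>q m\<close> and \<open>b m\<close> describe its coefficient of
  \<open>x\<^sup>m\<close>, the lower part through \<open>q\<close> and a further lower left block through \<open>b\<close>. The two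
  equations are those of \<open>Sol\<close>, separated by powers of \<open>x\<close>, and they are also
  the conditions for the corresponding Laurent polynomial to lie in \<open>w_space\<close>. The maps are fixed
  for all \<open>m\<close>, zero from 2 on, so that all dual elements can be written uniformly.\<close>
definition correction_maps ::
  "nat \<Rightarrow> nat \<Rightarrow> (nat \<Rightarrow> complex mat \<Rightarrow> complex mat) \<Rightarrow> (nat \<Rightarrow> complex mat \<Rightarrow> complex mat) \<Rightarrow> bool" where
  "correction_maps e d q b \<longleftrightarrow>
    (\<forall>m. lin_map (e + d) (q m) \<and> lin_map (e + d) (b m)) \<and>
    (\<forall>g\<in>sl (e + d).
       (\<forall>m. q m g \<in> sl (e + d) \<and> upr e (e + d) (q m g) = 0\<^sub>m (e + d) (e + d) \<and>
            lwr e (e + d) (b m g) = b m g) \<and>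
       bracket (q 0 g + upr e (e + d) g) (J_mat e d) + b 0 g + diag e (e + d) g = 0\<^sub>m (e + d) (e + d) \<and>
       bracket (q 1 g) (J_mat e d) + b 1 g + upr e (e + d) g = 0\<^sub>m (e + d) (e + d) \<and>
       (\<forall>m\<ge>2. q m g = 0\<^sub>m (e + d) (e + d) \<and> b m g = 0\<^sub>m (e + d) (e + d)))"

lemma correction_maps_exist:
  assumes ed: "e > 0" "d > 0" "coprime e d"
  obtains q b where "correction_maps e d q b"
proof -
  define n where n: "n = e + d"
  note J = J_mat_carrier[OF ed, folded n]
  obtain q b where qb: "lin_map n q" "lin_map n b"
    "\<And>R. R \<in> sl n \<Longrightarrow> q R \<in> sl n"
    "\<And>R. upr e n (q R) = 0\<^sub>m n n" "\<And>R. lwr e n (b R) = b R"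
    "\<And>R. R \<in> sl n \<Longrightarrow> bracket (q R) (J_mat e d) + b R = R"
    by (rule parabolic_equation_solver[OF ed n]) (rule that)
  define R where "R = (\<lambda>(m :: nat) g. if m = 0 then - diag e n g - bracket (upr e n g) (J_mat e d)
      else if m = 1 then - upr e n g else (0 :: complex) \<cdot>\<^sub>m g)"
  have R: "lin_map n (R m)" for m
  proof -
    consider "m = 0" | "m = 1" | "m \<ge> 2" by linarith
    thus ?thesis
    proof cases
      case 1
      have "R m = (\<lambda>g. - diag e n g - bracket (upr e n g) (J_mat e d))" using 1 by (simp add: R_def)
      thus ?thesis
        by (simp only:) (intro lin_map_diff lin_map_uminus lin_map_pick lin_map_comp[OF lin_map_bracket[OF J]])
    next
      case 2
      have "R m = (\<lambda>g. - upr e n g)" using 2 by (simp add: R_def)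
      thus ?thesis by (simp only:) (intro lin_map_uminus lin_map_pick)
    next
      case 3
      have "R m = (\<lambda>g. 0 \<cdot>\<^sub>m g)" using 3 by (simp add: R_def)
      thus ?thesis by (simp only:) (intro lin_map_smult lin_map_id)
    qed
  qed
  have Rsl: "R m g \<in> sl n" if g: "g \<in> sl n" for m g
  proof -
    have br: "bracket (upr e n g) (J_mat e d) \<in> sl n" using J by (intro bracket_in_sl) auto
    show ?thesis using slD[OF g] slD[OF br] lin_map_carrier[OF R, of g m]
      by (intro slI) (auto simp: R_def sum_subtractf sum_negf intro!: sum.neutral)
  qed
  have "correction_maps e d (\<lambda>m g. q (R m g)) (\<lambda>m g. b (R m g))"
    unfolding correction_maps_def n[symmetric]
  proof (intro conjI ballI allI impI)
    fix m show "lin_map n (\<lambda>g. q (R m g))" "lin_map n (\<lambda>g. b (R m g))"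
      by (intro lin_map_comp[OF _ R] qb)+
  next
    fix g :: "complex mat" and m assume g: "g \<in> sl n"
    show "q (R m g) \<in> sl n" "upr e n (q (R m g)) = 0\<^sub>m n n" "lwr e n (b (R m g)) = b (R m g)"
      using qb Rsl[OF g] by auto
  next
    fix g :: "complex mat" assume g: "g \<in> sl n"
    note gC = slD(1)[OF g]
    note c = lin_map_carrier[OF qb(1) lin_map_carrier[OF R gC]] lin_map_carrier[OF qb(2) lin_map_carrier[OF R gC]]
    have br: "bracket (A + upr e n g) (J_mat e d) = bracket A (J_mat e d) + bracket (upr e n g) (J_mat e d)"
      if "A \<in> carrier_mat n n" for A
      using lin_map_bracket[OF J] that by (simp add: lin_map_def)
    have entry: "bracket (q (R m g)) (J_mat e d) $$ (i,j) + b (R m g) $$ (i,j) = R m g $$ (i,j)"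
      if "i < n" "j < n" for m i j
    proof -
      have "(bracket (q (R m g)) (J_mat e d) + b (R m g)) $$ (i,j) = R m g $$ (i,j)"
        using qb(6)[OF Rsl[OF g, of m]] by simp
      thus ?thesis using c[of m] that by simp
    qed
    have aux: "(k + u) + l + w = 0" if "k + l = r" "r = - w - u" for k l r u w :: complex
    proof -
      have "(k + u) + l + w = (k + l) + u + w" by (simp add: algebra_simps)
      thus ?thesis using that by simp
    qed
    show "bracket (q (R 0 g) + upr e n g) (J_mat e d) + b (R 0 g) + diag e n g = 0\<^sub>m n n"
    proof (rule eq_matI)
      fix i j assume "i < dim_row (0\<^sub>m n n :: complex mat)" "j < dim_col (0\<^sub>m n n :: complex mat)"
      hence ij: "i < n" "j < n" by auto
      have "R 0 g $$ (i,j) = - diag e n g $$ (i,j) - bracket (upr e n g) (J_mat e d) $$ (i,j)"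
        using ij J by (simp add: R_def carrier_matD[OF bracket_carrier[OF _ J]] del: mask_index)
      thus "(bracket (q (R 0 g) + upr e n g) (J_mat e d) + b (R 0 g) + diag e n g) $$ (i,j) = 0\<^sub>m n n $$ (i,j)"
        unfolding br[OF c(1)] using aux[OF entry[OF ij, of 0]] ij c[of 0] J
        by (simp add: carrier_matD[OF bracket_carrier[OF _ J]] del: mask_index)
    qed (use c J in auto)
    show "bracket (q (R 1 g)) (J_mat e d) + b (R 1 g) + upr e n g = 0\<^sub>m n n"
    proof (rule eq_matI)
      fix i j assume "i < dim_row (0\<^sub>m n n :: complex mat)" "j < dim_col (0\<^sub>m n n :: complex mat)"
      hence ij: "i < n" "j < n" by auto
      have "R 1 g $$ (i,j) = - upr e n g $$ (i,j)"
        using ij by (simp add: R_def del: mask_index)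
      thus "(bracket (q (R 1 g)) (J_mat e d) + b (R 1 g) + upr e n g) $$ (i,j) = 0\<^sub>m n n $$ (i,j)"
        using entry[OF ij, of 1] ij c[of 1] J
        by (simp add: carrier_matD[OF bracket_carrier[OF _ J]] del: mask_index)
    qed (use c J in auto)
    fix m :: nat assume "m \<ge> 2"
    hence "R m g = 0\<^sub>m n n" using gC by (auto simp: R_def intro!: eq_matI)
    thus "q (R m g) = 0\<^sub>m n n" "b (R m g) = 0\<^sub>m n n" using lin_map_zero qb by auto
  qed
  thus ?thesis by (rule that)
qed

section \<open>The solution attached to the cuspidal curve\<close>

text \<open>The exponent by which conjugation with \<open>diag(1,z)\<close> shifts the entry at \<open>(i,j)\<close>. Both \<open>V_space\<close>
  and \<open>w_space\<close> become degree conditions relative to it, the same for all blocks; \<open>F_zero\<close> and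
  \<open>F_eps\<close> are the two leading coefficients in this grading.\<close>
definition level :: "nat \<Rightarrow> nat \<Rightarrow> nat \<Rightarrow> int" where
  "level e i j = (if i < e then 0 else 1) - (if j < e then 0 else 1)"

lemma level_cases:
  obtains "i < e" "e \<le> j" "level e i j = -1" | "i < e \<longleftrightarrow> j < e" "level e i j = 0" | "e \<le> i" "j < e" "level e i j = 1"
  by (cases "i < e"; cases "j < e") (auto simp: level_def)

lemma V_space_iff:
  "F \<in> V_space e d \<longleftrightarrow> F \<in> sl (e + d) \<and>
     (\<forall>i<e+d. \<forall>j<e+d. \<forall>k. int k > 1 + level e i j \<longrightarrow> coeff (F $$ (i,j)) k = 0)"
  (is "_ \<longleftrightarrow> ?R")
proof
  assume "F \<in> V_space e d"
  then obtain W X Y Z W' Y' Z' Y'' where sl: "F \<in> sl (e + d)" and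
    F: "F = poly_mat (four_block_mat W X Y Z)
        + monom 1 1 \<cdot>\<^sub>m poly_mat (four_block_mat W' (0\<^sub>m e d) Y' Z')
        + monom 1 2 \<cdot>\<^sub>m poly_mat (four_block_mat (0\<^sub>m e e) (0\<^sub>m e d) Y'' (0\<^sub>m d d))"
    and C: "W \<in> carrier_mat e e" "X \<in> carrier_mat e d" "Y \<in> carrier_mat d e" "Z \<in> carrier_mat d d"
      "W' \<in> carrier_mat e e" "Y' \<in> carrier_mat d e" "Z' \<in> carrier_mat d d" "Y'' \<in> carrier_mat d e"
    unfolding V_space_def by blast
  have "coeff (F $$ (i,j)) k = 0" if "i < e + d" "j < e + d" "int k > 1 + level e i j" for i j k
  proof -
    have "F $$ (i,j) = [:four_block_mat W X Y Z $$ (i,j):]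
        + monom 1 1 * [:four_block_mat W' (0\<^sub>m e d) Y' Z' $$ (i,j):]
        + monom 1 2 * [:four_block_mat (0\<^sub>m e e) (0\<^sub>m e d) Y'' (0\<^sub>m d d) $$ (i,j):]"
      unfolding F using that C by (simp add: poly_mat_def)
    thus ?thesis using that C
      by (cases rule: level_cases[of i e j]) (auto simp: coeff_monom_mult coeff_pCons split: nat.splits)
  qed
  thus ?R using sl by blast
next
  assume ?R
  hence sl: "F \<in> sl (e + d)"
    and c: "\<And>i j k. i < e + d \<Longrightarrow> j < e + d \<Longrightarrow> int k > 1 + level e i j \<Longrightarrow> coeff (F $$ (i,j)) k = 0" by auto
  have F: "F \<in> carrier_mat (e + d) (e + d)" using slD[OF sl] by simp
  define blk where "blk = (\<lambda>r s u v k. mat r s (\<lambda>(i,j). coeff (F $$ (i + u, j + v)) k))"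
  have "F = poly_mat (four_block_mat (blk e e 0 0 0) (blk e d 0 e 0) (blk d e e 0 0) (blk d d e e 0))
        + monom 1 1 \<cdot>\<^sub>m poly_mat (four_block_mat (blk e e 0 0 1) (0\<^sub>m e d) (blk d e e 0 1) (blk d d e e 1))
        + monom 1 2 \<cdot>\<^sub>m poly_mat (four_block_mat (0\<^sub>m e e) (0\<^sub>m e d) (blk d e e 0 2) (0\<^sub>m d d))"
    (is "F = poly_mat ?A + monom 1 1 \<cdot>\<^sub>m poly_mat ?B + monom 1 2 \<cdot>\<^sub>m poly_mat ?C")
  proof (rule eq_matI)
    fix i j assume "i < dim_row (poly_mat ?A + monom 1 1 \<cdot>\<^sub>m poly_mat ?B + monom 1 2 \<cdot>\<^sub>m poly_mat ?C)"
      "j < dim_col (poly_mat ?A + monom 1 1 \<cdot>\<^sub>m poly_mat ?B + monom 1 2 \<cdot>\<^sub>m poly_mat ?C)"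
    hence ij: "i < e + d" "j < e + d" by (auto simp: poly_mat_def)
    have *: "(poly_mat ?A + monom 1 1 \<cdot>\<^sub>m poly_mat ?B + monom 1 2 \<cdot>\<^sub>m poly_mat ?C) $$ (i,j)
        = [:?A $$ (i,j):] + monom 1 1 * [:?B $$ (i,j):] + monom 1 2 * [:?C $$ (i,j):]"
      using ij by (simp add: poly_mat_def blk_def)
    show "F $$ (i,j) = (poly_mat ?A + monom 1 1 \<cdot>\<^sub>m poly_mat ?B + monom 1 2 \<cdot>\<^sub>m poly_mat ?C) $$ (i,j)"
    proof (rule poly_eqI)
      fix k :: nat
      have k: "k = 0 \<or> k = 1 \<or> k = 2 \<or> k > 2" by linarith
      show "coeff (F $$ (i,j)) k = coeff ((poly_mat ?A + monom 1 1 \<cdot>\<^sub>m poly_mat ?B + monom 1 2 \<cdot>\<^sub>m poly_mat ?C) $$ (i,j)) k"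
        unfolding * using ij c[OF ij, of k] k
        by (cases rule: level_cases[of i e j])
          (auto simp: coeff_monom_mult coeff_pCons blk_def numeral_2_eq_2 split: nat.splits)
    qed
  qed (use F in \<open>auto simp: poly_mat_def blk_def\<close>)
  moreover have "blk r s u v k \<in> carrier_mat r s" for r s u v k by (simp add: blk_def)
  ultimately show "F \<in> V_space e d"
    unfolding V_space_def using sl by blast
qed

lemma F_zero_index:
  assumes "F \<in> carrier_mat (e + d) (e + d)"
  shows "F_zero e d F \<in> carrier_mat (e + d) (e + d)"
    and "i < e + d \<Longrightarrow> j < e + d \<Longrightarrow> F_zero e d F $$ (i,j) = coeff (F $$ (i,j)) (nat (1 + level e i j))"
proof -
  show "F_zero e d F \<in> carrier_mat (e + d) (e + d)"
    using assms by (auto simp: F_zero_def split_block_def coeff_mat_def Let_def)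
  assume "i < e + d" "j < e + d"
  thus "F_zero e d F $$ (i,j) = coeff (F $$ (i,j)) (nat (1 + level e i j))"
    using assms by (cases rule: level_cases[of i e j])
      (auto simp: F_zero_def split_block_def coeff_mat_def Let_def numeral_2_eq_2)
qed

lemma F_eps_index:
  assumes "F \<in> carrier_mat (e + d) (e + d)"
  shows "F_eps e d F \<in> carrier_mat (e + d) (e + d)"
    and "i < e + d \<Longrightarrow> j < e + d \<Longrightarrow> F_eps e d F $$ (i,j) =
       (if i < e \<and> e \<le> j then 0 else coeff (F $$ (i,j)) (nat (level e i j)))"
proof -
  show "F_eps e d F \<in> carrier_mat (e + d) (e + d)"
    using assms by (auto simp: F_eps_def split_block_def coeff_mat_def Let_def)
  assume "i < e + d" "j < e + d"
  thus "F_eps e d F $$ (i,j) =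
       (if i < e \<and> e \<le> j then 0 else coeff (F $$ (i,j)) (nat (level e i j)))"
    using assms by (cases rule: level_cases[of i e j])
      (auto simp: F_eps_def split_block_def coeff_mat_def Let_def)
qed

lemma poly_degree_le_2:
  fixes p :: "complex poly"
  assumes "\<And>k. k > 2 \<Longrightarrow> coeff p k = 0"
  shows "poly p x = coeff p 0 + coeff p 1 * x + coeff p 2 * x ^ 2"
proof -
  have "degree p \<le> 2" using assms by (intro degree_le) auto
  hence "poly p x = (\<Sum>i\<le>2. coeff p i * x ^ i)"
    unfolding poly_altdef by (intro sum.mono_neutral_left) (auto simp: coeff_eq_0)
  thus ?thesis by (simp add: numeral_2_eq_2)
qed


text \<open>If \<open>F\<close> and \<open>G\<close> agree at \<open>x\<close>, then \<open>F - G = (z - x) P\<close>. The degree conditions make the leading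
  part \<open>Q\<close> of \<open>P\<close> block lower triangular, and the equation of \<open>Sol\<close> becomes
  \<open>[Q,J] + B = 0\<close> with \<open>B\<close> the remaining lower left coefficient of \<open>P\<close>. So \<open>P = 0\<close>.\<close>
lemma Sol_eval_inj:
  assumes ed: "e > 0" "d > 0" "coprime e d"
  shows "inj_on (eval_mat x) (Sol e d x)"
proof (rule inj_onI)
  fix F G assume F: "F \<in> Sol e d x" and G: "G \<in> Sol e d x" and FG: "eval_mat x F = eval_mat x G"
  define n where n: "n = e + d"
  note J = J_mat_carrier[OF ed, folded n]
  have V: "F \<in> V_space e d" "G \<in> V_space e d"
    and eq: "bracket (F_zero e d F) (J_mat e d) + x \<cdot>\<^sub>m F_zero e d F + F_eps e d F = 0\<^sub>m n n"
      "bracket (F_zero e d G) (J_mat e d) + x \<cdot>\<^sub>m F_zero e d G + F_eps e d G = 0\<^sub>m n n"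
    using F G by (auto simp: Sol_def n)
  have sl: "F \<in> sl n" "G \<in> sl n" using V by (auto simp: V_space_iff n)
  note C = slD(1)[OF sl(1)] slD(1)[OF sl(2)]
  note FZ = F_zero_index[OF C(1)[unfolded n], folded n] F_zero_index[OF C(2)[unfolded n], folded n]
  note FE = F_eps_index[OF C(1)[unfolded n], folded n] F_eps_index[OF C(2)[unfolded n], folded n]
  define c where "c = (\<lambda>i j k. coeff (F $$ (i,j)) k - coeff (G $$ (i,j)) k)"
  have c0: "c i j k = 0" if "i < n" "j < n" "int k > 1 + level e i j" for i j k
    using V that by (auto simp: V_space_iff n c_def)
  have root: "c i j 0 + c i j 1 * x + c i j 2 * x ^ 2 = 0" if ij: "i < n" "j < n" for i j
  proof -
    have "eval_mat x F $$ (i,j) = eval_mat x G $$ (i,j)" using FG by simp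
    hence "poly (F $$ (i,j) - G $$ (i,j)) x = 0" using ij C by (simp add: eval_mat_def)
    moreover have "coeff (F $$ (i,j) - G $$ (i,j)) k = 0" if "k > 2" for k
    proof -
      have "level e i j \<le> 1" by (simp add: level_def)
      thus ?thesis using c0[OF ij, of k] that by (simp add: c_def)
    qed
    ultimately show ?thesis
      using poly_degree_le_2[of "F $$ (i,j) - G $$ (i,j)" x] by (simp add: c_def)
  qed
  \<comment> \<open>With \<open>F - G = (z - x) P\<close>, these are the coefficients of \<open>P\<close> mentioned above, recovered from \<open>F - G\<close>.\<close>
  define Q where "Q = mat n n (\<lambda>(i,j). c i j (nat (1 + level e i j)))"
  define B where "B = mat n n (\<lambda>(i,j). if e \<le> i \<and> j < e then x * c i j 2 + c i j 1 else 0)"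
  have Q: "Q \<in> carrier_mat n n" and B: "B \<in> carrier_mat n n" by (auto simp: Q_def B_def)
  have QFG: "Q $$ (i,j) = F_zero e d F $$ (i,j) - F_zero e d G $$ (i,j)" if "i < n" "j < n" for i j
    using that FZ(2)[OF that] FZ(4)[OF that] by (simp add: Q_def c_def)
  have upr: "c i j 0 = 0" if "i < n" "j < n" "i < e" "e \<le> j" for i j
    using root[OF that(1,2)] c0[OF that(1,2), of 1] c0[OF that(1,2), of 2] that by (simp add: level_def)
  have QB: "Q = 0\<^sub>m n n" "B = 0\<^sub>m n n"
  proof -
    have tr0: "(\<Sum>i<n. coeff (H $$ (i,i)) 1) = 0" if "H \<in> sl n" for H :: "complex poly mat"
      using arg_cong[OF slD(4)[OF that], of "\<lambda>p. coeff p 1"] by (simp add: coeff_sum)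
    have "(\<Sum>i<n. Q $$ (i,i)) = 0"
      using tr0[OF sl(1)] tr0[OF sl(2)] by (simp add: Q_def c_def level_def sum_subtractf)
    hence Qsl: "Q \<in> sl n" using Q by (intro slI)
    have up: "upr e n Q = 0\<^sub>m n n"
      by (rule eq_matI) (auto simp: Q_def level_def upr)
    have lw: "lwr e n B = B"
      by (rule eq_matI) (auto simp: B_def)
    have "bracket Q (J_mat e d) + B = 0\<^sub>m n n"
    proof (rule eq_matI)
      fix i j assume "i < dim_row (0\<^sub>m n n :: complex mat)" "j < dim_col (0\<^sub>m n n :: complex mat)"
      hence ij: "i < n" "j < n" by auto
      have brQ: "bracket Q (J_mat e d) $$ (i,j) =
          bracket (F_zero e d F) (J_mat e d) $$ (i,j) - bracket (F_zero e d G) (J_mat e d) $$ (i,j)"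
        unfolding bracket_index[OF Q J ij] bracket_index[OF FZ(1) J ij] bracket_index[OF FZ(3) J ij]
        using ij by (simp add: QFG algebra_simps sum_subtractf)
      have e1: "bracket (F_zero e d F) (J_mat e d) $$ (i,j) + x * F_zero e d F $$ (i,j) + F_eps e d F $$ (i,j) = 0"
        using arg_cong[OF eq(1), of "\<lambda>A. A $$ (i,j)"] ij FZ(1) FE(1) J
        by (simp add: carrier_matD[OF bracket_carrier[OF _ J]])
      have e2: "bracket (F_zero e d G) (J_mat e d) $$ (i,j) + x * F_zero e d G $$ (i,j) + F_eps e d G $$ (i,j) = 0"
        using arg_cong[OF eq(2), of "\<lambda>A. A $$ (i,j)"] ij FZ(3) FE(3) J
        by (simp add: carrier_matD[OF bracket_carrier[OF _ J]])
      have "B $$ (i,j) = x * (F_zero e d F $$ (i,j) - F_zero e d G $$ (i,j)) + (F_eps e d F $$ (i,j) - F_eps e d G $$ (i,j))"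
      proof (cases rule: level_cases[of i e j])
        case 1
        thus ?thesis using ij upr[OF ij 1(1,2)] by (simp add: B_def FZ FE c_def)
      next
        case 2
        have "c i j 0 + x * c i j 1 = 0"
          using root[OF ij] c0[OF ij, of 2] 2 by (simp add: mult.commute)
        thus ?thesis using ij 2 by (auto simp: B_def FZ FE c_def algebra_simps)
      next
        case 3
        thus ?thesis using ij by (simp add: B_def FZ FE c_def algebra_simps numeral_2_eq_2)
      qed
      moreover have "k - l + (x * (u - v) + (w - z)) = 0"
        if "k + x * u + w = 0" "l + x * v + z = 0" for k l u v w z
      proof -
        have "k - l + (x * (u - v) + (w - z)) = (k + x * u + w) - (l + x * v + z)"
          by (simp add: algebra_simps)
        thus ?thesis using that by simp
      qed
      ultimately have "bracket Q (J_mat e d) $$ (i,j) + B $$ (i,j) = 0"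
        using e1 e2 unfolding brQ by metis
      thus "(bracket Q (J_mat e d) + B) $$ (i,j) = 0\<^sub>m n n $$ (i,j)" using ij B by simp
    qed (use B in auto)
    thus "Q = 0\<^sub>m n n" "B = 0\<^sub>m n n" using parabolic_equation_injective[OF ed n Qsl up B lw] by auto
  qed
  have Q0: "c i j (nat (1 + level e i j)) = 0" and B0: "e \<le> i \<Longrightarrow> j < e \<Longrightarrow> x * c i j 2 + c i j 1 = 0"
    if "i < n" "j < n" for i j
  proof -
    have "Q $$ (i,j) = 0" "B $$ (i,j) = 0" using that unfolding QB by simp_all
    thus "c i j (nat (1 + level e i j)) = 0" "e \<le> i \<Longrightarrow> j < e \<Longrightarrow> x * c i j 2 + c i j 1 = 0"
      using that by (simp_all add: Q_def B_def)
  qed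
  have "c i j k = 0" if ij: "i < n" "j < n" for i j k
  proof (cases "int k > 1 + level e i j")
    case False
    show ?thesis
    proof (cases rule: level_cases[of i e j])
      case 1
      thus ?thesis using False upr[OF ij 1(1,2)] by simp
    next
      case 2
      have "c i j 1 = 0" using Q0[OF ij] 2 by simp
      moreover from this have "c i j 0 = 0" using root[OF ij] c0[OF ij, of 2] 2 by simp
      moreover have "k = 0 \<or> k = 1" using False 2 by linarith
      ultimately show ?thesis by auto
    next
      case 3
      have "c i j 2 = 0" using Q0[OF ij] 3 by (simp add: numeral_2_eq_2)
      moreover from this have "c i j 1 = 0" using B0[OF ij 3(1,2)] by simp
      moreover from calculation have "c i j 0 = 0" using root[OF ij] by simp
      moreover have "k = 0 \<or> k = 1 \<or> k = 2" using False 3 by linarith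
      ultimately show ?thesis by auto
    qed
  qed (use c0 ij in auto)
  hence "F $$ (i,j) = G $$ (i,j)" if "i < n" "j < n" for i j
    using that by (intro poly_eqI) (simp add: c_def)
  thus "F = G" using C by (intro eq_matI) auto
qed

text \<open>Value at \<open>y\<close> of the coefficient of \<open>x\<^sup>m\<close> in the polynomial part: the lower left block of \<open>q\<close>
  belongs to \<open>z\<close>, everything else to the constant term.\<close>
definition correction_at ::
  "nat \<Rightarrow> nat \<Rightarrow> (nat \<Rightarrow> complex mat \<Rightarrow> complex mat) \<Rightarrow> (nat \<Rightarrow> complex mat \<Rightarrow> complex mat) \<Rightarrow>
   nat \<Rightarrow> complex \<Rightarrow> complex mat \<Rightarrow> complex mat" where
  "correction_at e n q b m y g = (diag e n (q m g) + b m g) + y \<cdot>\<^sub>m lwr e n (q m g)"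

lemma correction_at_lin_map:
  assumes "correction_maps e d q b"
  shows "lin_map (e + d) (correction_at e (e + d) q b m y)"
proof -
  have "lin_map (e + d) (q m)" "lin_map (e + d) (b m)"
    using assms by (auto simp: correction_maps_def)
  thus ?thesis
    unfolding correction_at_def[abs_def]
    by (intro lin_map_add lin_map_smult lin_map_comp[OF lin_map_pick])
qed

lemma correction_at_sl:
  assumes cm: "correction_maps e d q b" and g: "g \<in> sl (e + d)"
  shows "correction_at e (e + d) q b m y g \<in> sl (e + d)"
proof (rule slI)
  show "correction_at e (e + d) q b m y g \<in> carrier_mat (e + d) (e + d)"
    using lin_map_carrier[OF correction_at_lin_map[OF cm] slD(1)[OF g]] .
  have q: "q m g \<in> sl (e + d)" and b: "lwr e (e + d) (b m g) = b m g"
    using cm g by (auto simp: correction_maps_def)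
  have "correction_at e (e + d) q b m y g $$ (i,i) = q m g $$ (i,i)" if "i < e + d" for i
  proof -
    have "b m g $$ (i,i) = lwr e (e + d) (b m g) $$ (i,i)" using b by simp
    also have "\<dots> = 0" using that by auto
    finally have "b m g $$ (i,i) = 0" .
    moreover have "dim_row (b m g) = e + d" "dim_col (b m g) = e + d"
      using arg_cong[OF b, of dim_row] arg_cong[OF b, of dim_col] by simp_all
    ultimately show ?thesis using that by (auto simp: correction_at_def)
  qed
  thus "(\<Sum>i<e + d. correction_at e (e + d) q b m y g $$ (i, i)) = 0"
    using slD(4)[OF q] by simp
qed

text \<open>The inverse of the evaluation map at \<open>x\<close> is explicit: it sends \<open>g\<close> to
  \<open>g + (z - x) (C\<^sub>0 + x C\<^sub>1)\<close>, where \<open>C\<^sub>m\<close> is the polynomial with values \<open>correction_at m\<close>.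
  In the equation of \<open>Sol\<close> for this polynomial the terms in \<open>x q\<close> cancel between \<open>x F\<^sub>0\<close> and
  \<open>F\<^sub>\<epsilon>\<close>, which leaves the two equations of \<open>correction_maps\<close>, the second multiplied by \<open>x\<close>.\<close>
lemma eval_res_inv:
  assumes ed: "e > 0" "d > 0" "coprime e d" and cm: "correction_maps e d q b"
    and g: "g \<in> sl (e + d)" and ij: "i < e + d" "j < e + d"
  shows "eval_mat y (res_inv e d x g) \<in> carrier_mat (e + d) (e + d)"
    and "eval_mat y (res_inv e d x g) $$ (i,j) = g $$ (i,j) + (y - x) *
      (correction_at e (e + d) q b 0 y g $$ (i,j) + x * correction_at e (e + d) q b 1 y g $$ (i,j))"
proof -
  define n where n: "n = e + d"
  note J = J_mat_carrier[OF ed, folded n]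
  have lin: "lin_map n (q m)" "lin_map n (b m)" for m
    using cm by (auto simp: correction_maps_def n)
  have cmg: "\<And>m. q m g \<in> sl n" "\<And>m. upr e n (q m g) = 0\<^sub>m n n" "\<And>m. lwr e n (b m g) = b m g"
    "bracket (q 0 g + upr e n g) (J_mat e d) + b 0 g + diag e n g = 0\<^sub>m n n"
    "bracket (q 1 g) (J_mat e d) + b 1 g + upr e n g = 0\<^sub>m n n"
    using cm g by (auto simp: correction_maps_def n)
  note gC = slD(1)[OF g, folded n]
  note qC = slD(1)[OF cmg(1)] and bC = lin_map_carrier[OF lin(2) gC]
  have q0: "q m g $$ (i,j) = 0" if "i < n" "j < n" "i < e" "e \<le> j" for m i j
    using arg_cong[OF cmg(2)[of m], of "\<lambda>A. A $$ (i,j)"] that by simp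
  have b0: "b m g $$ (i,j) = 0" if "i < n" "j < n" "\<not> (e \<le> i \<and> j < e)" for m i j
  proof -
    have "b m g $$ (i,j) = lwr e n (b m g) $$ (i,j)" using cmg(3) by simp
    also have "\<dots> = 0" using that by auto
    finally show ?thesis .
  qed
  define Q where "Q = q 0 g + x \<cdot>\<^sub>m q 1 g"
  define B where "B = b 0 g + x \<cdot>\<^sub>m b 1 g"
  have Q: "Q \<in> carrier_mat n n" and B: "B \<in> carrier_mat n n"
    using qC bC by (auto simp: Q_def B_def)
  have Q0: "Q $$ (i,j) = 0" if "i < n" "j < n" "i < e" "e \<le> j" for i j
    using that q0[OF that] carrier_matD[OF qC] by (simp add: Q_def)
  have B0: "B $$ (i,j) = 0" if "i < n" "j < n" "\<not> (e \<le> i \<and> j < e)" for i j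
    using that(1,2) b0[OF that] carrier_matD[OF bC] by (simp add: B_def)
  define F where "F = mat n n (\<lambda>(i,j). [: g $$ (i,j) :] + [: - x, 1 :] *
     [: diag e n Q $$ (i,j) + B $$ (i,j), lwr e n Q $$ (i,j) :])"
  have F: "F \<in> carrier_mat n n" by (simp add: F_def)
  have coeff: "coeff (F $$ (i,j)) k =
      (if k = 0 then g $$ (i,j) - x * (diag e n Q $$ (i,j) + B $$ (i,j))
       else if k = 1 then (diag e n Q $$ (i,j) + B $$ (i,j)) - x * lwr e n Q $$ (i,j)
       else if k = 2 then lwr e n Q $$ (i,j) else 0)" if "i < n" "j < n" for i j k
    using that by (auto simp: F_def coeff_pCons numeral_2_eq_2 split: nat.splits)
  have evalF: "eval_mat y F $$ (i,j) = g $$ (i,j) + (y - x) *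
      ((diag e n Q $$ (i,j) + B $$ (i,j)) + y * lwr e n Q $$ (i,j))" if "i < n" "j < n" for y i j
    using that by (simp add: eval_mat_def F_def algebra_simps)
  have "F \<in> Sol e d x"
  proof -
    have "F \<in> sl n"
    proof (rule slI[OF F])
      have "(\<Sum>i<n. Q $$ (i,i)) = (\<Sum>i<n. q 0 g $$ (i,i)) + x * (\<Sum>i<n. q 1 g $$ (i,i))"
        using carrier_matD[OF qC] by (simp add: Q_def sum.distrib sum_distrib_left)
      hence trQ: "(\<Sum>i<n. Q $$ (i,i)) = 0" using slD(4)[OF cmg(1)] by simp
      show "(\<Sum>i<n. F $$ (i,i)) = 0"
      proof (rule poly_eqI)
        fix k
        have "coeff (F $$ (i,i)) k = (if k = 0 then g $$ (i,i) - x * Q $$ (i,i)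
            else if k = 1 then Q $$ (i,i) else 0)" if "i < n" for i
          unfolding coeff[OF that that] using that B0[OF that that] by auto
        hence "coeff (\<Sum>i<n. F $$ (i,i)) k = (\<Sum>i<n. if k = 0 then g $$ (i,i) - x * Q $$ (i,i)
            else if k = 1 then Q $$ (i,i) else 0)"
          by (simp add: coeff_sum)
        also have "\<dots> = 0" using trQ slD(4)[OF g, folded n]
          by (cases "k = 0"; cases "k = 1") (simp_all add: sum_subtractf flip: sum_distrib_left)
        finally show "coeff (\<Sum>i<n. F $$ (i,i)) k = coeff 0 k" by simp
      qed
    qed
    moreover have "coeff (F $$ (i,j)) k = 0" if "i < n" "j < n" "int k > 1 + level e i j" for i j k
      unfolding coeff[OF that(1,2)] using that B0[OF that(1,2)]
      by (cases rule: level_cases[of i e j]) auto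
    ultimately have V: "F \<in> V_space e d" by (simp add: V_space_iff n)
    note FZ = F_zero_index[OF F[unfolded n], folded n]
    note FE = F_eps_index[OF F[unfolded n], folded n]
    have fz: "F_zero e d F $$ (i,j) = Q $$ (i,j) + upr e n g $$ (i,j)" if "i < n" "j < n" for i j
      unfolding FZ(2)[OF that] coeff[OF that] using that B0[OF that] Q0[OF that]
      by (cases rule: level_cases[of i e j]) auto
    have fe: "x * F_zero e d F $$ (i,j) + F_eps e d F $$ (i,j) =
       x * upr e n g $$ (i,j) + diag e n g $$ (i,j) + B $$ (i,j)" if "i < n" "j < n" for i j
      unfolding FZ(2)[OF that] FE(2)[OF that] coeff[OF that] using that B0[OF that] Q0[OF that]
      by (cases rule: level_cases[of i e j]) (auto simp: algebra_simps)
    have "bracket (F_zero e d F) (J_mat e d) + x \<cdot>\<^sub>m F_zero e d F + F_eps e d F = 0\<^sub>m n n"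
    proof (rule eq_matI)
      fix i j assume "i < dim_row (0\<^sub>m n n :: complex mat)" "j < dim_col (0\<^sub>m n n :: complex mat)"
      hence ij: "i < n" "j < n" by auto
      have br: "bracket (F_zero e d F) (J_mat e d) $$ (i,j) =
         bracket (q 0 g + upr e n g) (J_mat e d) $$ (i,j) + x * bracket (q 1 g) (J_mat e d) $$ (i,j)"
      proof -
        have "F_zero e d F = (q 0 g + upr e n g) + x \<cdot>\<^sub>m q 1 g"
          by (rule eq_matI) (use FZ(1) carrier_matD[OF qC] in \<open>auto simp: fz Q_def\<close>)
        moreover have "bracket ((q 0 g + upr e n g) + x \<cdot>\<^sub>m q 1 g) (J_mat e d) $$ (i,j) =
            bracket (q 0 g + upr e n g) (J_mat e d) $$ (i,j) + bracket (x \<cdot>\<^sub>m q 1 g) (J_mat e d) $$ (i,j)"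
          using ij qC by (intro lin_map_entry(4)[OF lin_map_bracket[OF J]]) auto
        moreover have "bracket (x \<cdot>\<^sub>m q 1 g) (J_mat e d) $$ (i,j) = x * bracket (q 1 g) (J_mat e d) $$ (i,j)"
          using ij qC by (intro lin_map_entry(5)[OF lin_map_bracket[OF J]]) auto
        ultimately show ?thesis by simp
      qed
      have e0: "bracket (q 0 g + upr e n g) (J_mat e d) $$ (i,j) + b 0 g $$ (i,j) + diag e n g $$ (i,j) = 0"
        using arg_cong[OF cmg(4), of "\<lambda>A. A $$ (i,j)"] ij qC[of 0] bC[of 0] J
        by (simp add: carrier_matD[OF bracket_carrier[OF _ J]] del: mask_index)
      have e1: "bracket (q 1 g) (J_mat e d) $$ (i,j) + b 1 g $$ (i,j) + upr e n g $$ (i,j) = 0"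
        using arg_cong[OF cmg(5), of "\<lambda>A. A $$ (i,j)"] ij qC[of 1] bC[of 1] J
        by (simp add: carrier_matD[OF bracket_carrier[OF _ J]] del: mask_index)
      have "(bracket (F_zero e d F) (J_mat e d) + x \<cdot>\<^sub>m F_zero e d F + F_eps e d F) $$ (i,j) =
         bracket (F_zero e d F) (J_mat e d) $$ (i,j) + (x * F_zero e d F $$ (i,j) + F_eps e d F $$ (i,j))"
        using ij FZ(1) FE(1) J by (simp add: carrier_matD[OF bracket_carrier[OF _ J]])
      also have "B $$ (i,j) = b 0 g $$ (i,j) + x * b 1 g $$ (i,j)"
        using ij carrier_matD[OF bC] by (simp add: B_def)
      hence "bracket (F_zero e d F) (J_mat e d) $$ (i,j) + (x * F_zero e d F $$ (i,j) + F_eps e d F $$ (i,j)) =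
         (bracket (q 0 g + upr e n g) (J_mat e d) $$ (i,j) + b 0 g $$ (i,j) + diag e n g $$ (i,j)) +
         x * (bracket (q 1 g) (J_mat e d) $$ (i,j) + b 1 g $$ (i,j) + upr e n g $$ (i,j))"
        unfolding br fe[OF ij] by (simp add: algebra_simps del: mask_index)
      also have "\<dots> = 0" unfolding e0 e1 by simp
      finally show "(bracket (F_zero e d F) (J_mat e d) + x \<cdot>\<^sub>m F_zero e d F + F_eps e d F) $$ (i,j) = 0\<^sub>m n n $$ (i,j)"
        using ij by simp
    qed (use FZ(1) FE(1) J in auto)
    thus ?thesis using V by (simp add: Sol_def n)
  qed
  moreover have "eval_mat x F = g"
    by (rule eq_matI) (use gC in \<open>auto simp: evalF simp del: mask_index\<close>, simp_all add: eval_mat_def F_def)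
  ultimately have r: "res_inv e d x g = F"
    unfolding res_inv_def by (intro the_inv_into_f_eq Sol_eval_inj[OF ed])
  show "eval_mat y (res_inv e d x g) \<in> carrier_mat (e + d) (e + d)"
    unfolding r using F n by (simp add: eval_mat_def)
  show "eval_mat y (res_inv e d x g) $$ (i,j) = g $$ (i,j) + (y - x) *
      (correction_at e (e + d) q b 0 y g $$ (i,j) + x * correction_at e (e + d) q b 1 y g $$ (i,j))"
  proof -
    note ij' = ij[folded n] and dims = carrier_matD[OF qC] carrier_matD[OF bC]
    have cv: "correction_at e n q b m y g $$ (i,j) =
        diag e n (q m g) $$ (i,j) + b m g $$ (i,j) + y * lwr e n (q m g) $$ (i,j)" for m
      using ij' dims by (simp add: correction_at_def del: mask_index)
    have "diag e n Q $$ (i,j) = diag e n (q 0 g) $$ (i,j) + x * diag e n (q 1 g) $$ (i,j)"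
      "lwr e n Q $$ (i,j) = lwr e n (q 0 g) $$ (i,j) + x * lwr e n (q 1 g) $$ (i,j)"
      "B $$ (i,j) = b 0 g $$ (i,j) + x * b 1 g $$ (i,j)"
      using ij' dims by (auto simp: Q_def B_def)
    thus ?thesis unfolding r n[symmetric] cv evalF[OF ij'] by (simp add: algebra_simps del: mask_index)
  qed
qed

text \<open>The endomorphism attached to \<open>r_cusp\<close> is \<open>g \<mapsto> g / (y - x) + C\<^sub>0(y) + x C\<^sub>1(y)\<close>, so its tensor is read
  off at the projected matrix units; \<open>phi\<close> then transposes the indices.\<close>
lemma r_cusp_index:
  assumes ed: "e > 0" "d > 0" "coprime e d" and cm: "correction_maps e d q b" and xy: "x \<noteq> y"
  shows "tensor_map (e + d) phi phi (r_cusp e d x y) = (\<lambda>(i,j,k,l).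
     if i < e + d \<and> j < e + d \<and> k < e + d \<and> l < e + d then
       unit_sl (e + d) i j $$ (l,k) / (y - x)
        + (correction_at e (e + d) q b 0 y (unit_sl (e + d) i j) $$ (l,k)
        + x * correction_at e (e + d) q b 1 y (unit_sl (e + d) i j) $$ (l,k))
     else 0)"
proof -
  define n where n: "n = e + d"
  define D where "D = (\<lambda>g. (1 / (y - x)) \<cdot>\<^sub>m g +
     (correction_at e n q b 0 y g + x \<cdot>\<^sub>m correction_at e n q b 1 y g))"
  note cv = correction_at_lin_map[OF cm, folded n]
  have D: "lin_map n D"
    unfolding D_def by (intro lin_map_add lin_map_smult cv lin_map_id)
  have cvC: "correction_at e n q b m y g \<in> carrier_mat n n" if "g \<in> carrier_mat n n" for m g
    using lin_map_carrier[OF cv that] .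
  have D_index: "D g $$ (i,j) = g $$ (i,j) / (y - x) + (correction_at e n q b 0 y g $$ (i,j)
       + x * correction_at e n q b 1 y g $$ (i,j))" if "g \<in> carrier_mat n n" "i < n" "j < n" for g i j
    using that carrier_matD[OF cvC[OF that(1)]] by (simp add: D_def)
  have Dsl: "D g \<in> sl n" if g: "g \<in> sl n" for g
  proof (rule slI)
    show "D g \<in> carrier_mat n n" using lin_map_carrier[OF D slD(1)[OF g]] .
    note s = slD(4)[OF correction_at_sl[OF cm g[unfolded n]], folded n]
    have "(\<Sum>i<n. D g $$ (i,i)) = (\<Sum>i<n. g $$ (i,i)) / (y - x) + ((\<Sum>i<n. correction_at e n q b 0 y g $$ (i,i))
       + x * (\<Sum>i<n. correction_at e n q b 1 y g $$ (i,i)))"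
      by (simp add: D_index[OF slD(1)[OF g]] sum.distrib sum_divide_distrib sum_distrib_left)
    thus "(\<Sum>i<n. D g $$ (i,i)) = 0" using s slD(4)[OF g] by simp
  qed
  have h: "(ev_bar x y \<circ> res_inv e d x) g = D g" if g: "g \<in> sl n" for g
  proof (rule eq_matI)
    note r = eval_res_inv[OF ed cm g[unfolded n], folded n]
    have c: "eval_mat y (res_inv e d x g) \<in> carrier_mat n n" using r(1)[of 0 0] ed n by simp
    have DC: "D g \<in> carrier_mat n n" using slD(1)[OF Dsl[OF g]] .
    fix i j assume "i < dim_row (D g)" "j < dim_col (D g)"
    hence ij: "i < n" "j < n" using DC by auto
    have "(ev_bar x y \<circ> res_inv e d x) g $$ (i,j) = (1 / (y - x)) * eval_mat y (res_inv e d x g) $$ (i,j)"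
      using c ij by (simp add: ev_bar_def)
    also have "\<dots> = D g $$ (i,j)"
      unfolding r(2)[OF ij] D_index[OF slD(1)[OF g] ij] using xy by (simp add: field_simps)
    finally show "(ev_bar x y \<circ> res_inv e d x) g $$ (i,j) = D g $$ (i,j)" .
  next
    have c: "eval_mat y (res_inv e d x g) \<in> carrier_mat n n"
      using eval_res_inv(1)[OF ed cm g[unfolded n], of 0 0] ed n by simp
    show "dim_row ((ev_bar x y \<circ> res_inv e d x) g) = dim_row (D g)"
      "dim_col ((ev_bar x y \<circ> res_inv e d x) g) = dim_col (D g)"
      using c slD[OF Dsl[OF g]] by (auto simp: ev_bar_def)
  qed
  obtain ps where ps: "set ps \<subseteq> sl n \<times> sl n" "tensor_of_end n (ev_bar x y \<circ> res_inv e d x) = tensor_sum n ps"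
    "\<And>i j k l. i < n \<Longrightarrow> j < n \<Longrightarrow> k < n \<Longrightarrow> l < n \<Longrightarrow>
      tensor_sum n ps (i,j,k,l) = D (unit_sl n j i) $$ (k,l)"
    by (rule tensor_of_end_linear[OF D Dsl h]) (assumption | rule that)+
  show ?thesis
    unfolding r_cusp_def n[symmetric] ps(2) tensor_map_phi_phi[OF ps(1)]
  proof (rule ext, clarify)
    fix i j k l
    show "tensor_sum n ps (j,i,l,k) = (if i < n \<and> j < n \<and> k < n \<and> l < n then
       unit_sl n i j $$ (l,k) / (y - x) + (correction_at e n q b 0 y (unit_sl n i j) $$ (l,k)
        + x * correction_at e n q b 1 y (unit_sl n i j) $$ (l,k)) else 0)"
    proof (cases "i < n \<and> j < n \<and> k < n \<and> l < n")
      case True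
      thus ?thesis using ps(3)[of j i l k] D_index[OF unit_sl_dim(1), of l k i j] by simp
    next
      case False
      hence "\<not> (j < n \<and> i < n \<and> l < n \<and> k < n)" by blast
      thus ?thesis unfolding if_not_P[OF False] by (rule tensor_sum_out_of_range)
    qed
  qed
qed

section \<open>The complementary subspace and its dual elements\<close>

lemma eta_index:
  assumes "i < e + d" "j < e + d"
  shows "eta e d $$ (i,j) = (if i = j then if i < e then 1 else fls_X_inv else 0)"
    and "eta_inv e d $$ (i,j) = (if i = j then if i < e then 1 else fls_X else 0)"
  using assms by (auto simp: eta_def eta_inv_def)

lemma eta_carrier:
  "eta e d \<in> carrier_mat (e + d) (e + d)" "eta_inv e d \<in> carrier_mat (e + d) (e + d)"
  by (auto simp: eta_def eta_inv_def)

lemma eta_conj_index: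
  assumes A: "A \<in> carrier_mat (e + d) (e + d)" and ij: "i < e + d" "j < e + d"
  shows "(eta_inv e d * A * eta e d) $$ (i,j) = fls_shift (level e j i) (A $$ (i,j))"
proof -
  let ?n = "e + d"
  let ?u = "if i < e then 1 else fls_X :: complex fls" and ?v = "if j < e then 1 else fls_X_inv :: complex fls"
  have 1: "(eta_inv e d * A) $$ (i,k) = ?u * A $$ (i,k)" if "k < ?n" for k
  proof -
    have "(eta_inv e d * A) $$ (i,k) = (\<Sum>l<?n. if l = i then ?u * A $$ (l,k) else 0)"
      unfolding index_mult_sum[OF eta_carrier(2) A ij(1) that]
      by (intro sum.cong refl) (use ij in \<open>auto simp: eta_index\<close>)
    thus ?thesis using ij by simp
  qed
  have "(eta_inv e d * A * eta e d) $$ (i,j) = (\<Sum>l<?n. if l = j then ?u * A $$ (i,l) * ?v else 0)"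
    unfolding index_mult_sum[OF mult_carrier_mat[OF eta_carrier(2) A] eta_carrier(1) ij]
    by (intro sum.cong refl) (use ij 1 in \<open>auto simp: eta_index simp del: index_mult_mat(1)\<close>)
  also have "\<dots> = ?u * A $$ (i,j) * ?v" using ij by simp
  also have "\<dots> = fls_shift (level e j i) (A $$ (i,j))"
    by (auto simp: level_def fls_X_times_conv_shift fls_X_inv_times_conv_shift)
  finally show ?thesis .
qed

text \<open>The coefficient of \<open>z\<^sup>-\<^sup>k\<close> of \<open>\<eta> M \<eta>\<^sup>-\<^sup>1\<close>, where \<open>\<eta> = diag(1,z)\<close>.\<close>
definition graded_coeff :: "nat \<Rightarrow> nat \<Rightarrow> int \<Rightarrow> complex fls mat \<Rightarrow> complex mat" where
  "graded_coeff e n k M = mat n n (\<lambda>(i,j). fls_nth (M $$ (i,j)) (k + level e i j))"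

lemma graded_coeff_carrier [simp]:
  "graded_coeff e n k M \<in> carrier_mat n n" "dim_row (graded_coeff e n k M) = n" "dim_col (graded_coeff e n k M) = n"
  by (simp_all add: graded_coeff_def)

lemma graded_coeff_index [simp]:
  "i < n \<Longrightarrow> j < n \<Longrightarrow> graded_coeff e n k M $$ (i,j) = fls_nth (M $$ (i,j)) (k + level e i j)"
  by (simp add: graded_coeff_def)

lemma graded_coeff_sl:
  assumes "M \<in> sl n"
  shows "graded_coeff e n k M \<in> sl n"
proof (rule slI)
  have "(\<Sum>i<n. fls_nth (M $$ (i,i)) k) = 0"
    using arg_cong[OF slD(4)[OF assms], of "\<lambda>f. fls_nth f k"] by (simp add: fls_nth_sum)
  thus "(\<Sum>i<n. graded_coeff e n k M $$ (i,i)) = 0" by (simp add: level_def)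
qed simp

text \<open>Invariance of the trace form turns \<open>\<omega>\<^sub>K(b,c)\<close> into \<open>tr([K\<^sup>t,b] c)\<close>.\<close>
lemma omega_eq_trace_iff:
  assumes K: "K \<in> carrier_mat n n" and a: "a \<in> sl n" and b: "b \<in> sl n"
  shows "(\<forall>c\<in>sl n. tr (a * c) = omega K b c) \<longleftrightarrow> a = bracket (transpose_mat K) b"
proof -
  let ?k = "transpose_mat K"
  have k: "?k \<in> carrier_mat n n" using K by simp
  note bC = slD(1)[OF b] and aC = slD(1)[OF a]
  have om: "omega K b c = tr (bracket ?k b * c)" if c: "c \<in> carrier_mat n n" for c
  proof -
    have "omega K b c = tr (?k * (b * c)) - tr (?k * (c * b))"
      unfolding omega_def bracket_def using k bC c
      by (subst mult_minus_distrib_mat[of _ n n _ n]) (auto simp: tr_def sum_subtractf)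
    also have "?k * (b * c) = ?k * b * c" by (rule assoc_mult_mat[OF k bC c, symmetric])
    also have "tr (?k * (c * b)) = tr (b * ?k * c)"
    proof -
      have "tr (?k * (c * b)) = tr ((?k * c) * b)" by (subst assoc_mult_mat[OF k c bC]) simp
      also have "\<dots> = tr (b * (?k * c))" by (rule tr_mult_commute[of _ n]) (use k bC c in auto)
      also have "b * (?k * c) = b * ?k * c" by (rule assoc_mult_mat[OF bC k c, symmetric])
      finally show ?thesis .
    qed
    also have "tr (?k * b * c) - tr (b * ?k * c) = tr (bracket ?k b * c)"
      unfolding bracket_def using k bC c
      by (subst minus_mult_distrib_mat[of _ n n _ _ n]) (auto simp: tr_def sum_subtractf)
    finally show ?thesis .
  qed
  show ?thesis
  proof
    assume L: "\<forall>c\<in>sl n. tr (a * c) = omega K b c"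
    have br: "bracket ?k b \<in> sl n" using k bC by (rule bracket_in_sl)
    have "a - bracket ?k b = 0\<^sub>m n n"
    proof (rule trace_form_nondegenerate)
      show "a - bracket ?k b \<in> sl n"
        using slD[OF a] slD[OF br] by (intro slI) (auto simp: sum_subtractf)
      fix c :: "complex mat" assume c: "c \<in> sl n"
      have "tr ((a - bracket ?k b) * c) = tr (a * c) - tr (bracket ?k b * c)"
        using aC slD(1)[OF br] slD(1)[OF c]
        by (subst minus_mult_distrib_mat[of _ n n _ _ n]) (auto simp: tr_def sum_subtractf)
      thus "tr ((a - bracket ?k b) * c) = 0" using L c om[OF slD(1)[OF c]] by simp
    qed
    show "a = bracket ?k b"
    proof (rule eq_matI)
      fix i j assume "i < dim_row (bracket ?k b)" "j < dim_col (bracket ?k b)"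
      hence ij: "i < n" "j < n" using slD[OF br] by auto
      have "(a - bracket ?k b) $$ (i,j) = 0" using \<open>a - bracket ?k b = 0\<^sub>m n n\<close> ij by simp
      thus "a $$ (i,j) = bracket ?k b $$ (i,j)" using ij slD[OF br] slD[OF a] by simp
    qed (use slD[OF br] slD[OF a] in auto)
  next
    assume "a = bracket ?k b"
    thus "\<forall>c\<in>sl n. tr (a * c) = omega K b c" using om by (auto simp: sl_def)
  qed
qed

text \<open>Together with its converse \<open>w_space_if_graded_coeff\<close> this describes \<open>w_space\<close> by linear conditions
  on coefficients. Elements in the subspace start, after conjugation, with \<open>b + z\<^sup>-\<^sup>1 a\<close>, and
  \<open>a = [K\<^sup>t,b]\<close> is the only relation between \<open>a\<close> and \<open>b\<close>.\<close>
lemma w_space_graded_coeff: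
  assumes M: "M \<in> w_space e d K" and K: "K \<in> carrier_mat (e + d) (e + d)"
  shows "M \<in> sl (e + d)"
    and "\<And>i j k. i < e + d \<Longrightarrow> j < e + d \<Longrightarrow> k < 0 \<Longrightarrow> fls_nth (M $$ (i,j)) (k + level e i j) = 0"
    and "graded_coeff e (e + d) 1 M = bracket (transpose_mat K) (graded_coeff e (e + d) 0 M)"
proof -
  define n where n: "n = e + d"
  obtain A where MA: "M = eta_inv e d * A * eta e d" and A: "A \<in> w'_space n K"
    using M by (auto simp: w_space_def n)
  obtain G a b where AG: "A = fls_X ^ 2 \<cdot>\<^sub>m map_mat fps_to_fls G + (fls_X \<cdot>\<^sub>m const_mat a + const_mat b)"
    and G: "G \<in> sl n" and a: "a \<in> sl n" and b: "b \<in> sl n"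
    and ab: "\<forall>c\<in>sl n. tr (a * c) = omega K b c"
    using A unfolding w'_space_def v_space_def by blast
  have AC: "A \<in> carrier_mat n n"
    unfolding AG using slD[OF G] slD[OF a] slD[OF b] by (auto simp: const_mat_def)
  have A_index: "A $$ (i,j) = fls_shift (-2) (fps_to_fls (G $$ (i,j))) + fls_shift (-1) (fls_const (a $$ (i,j)))
     + fls_const (b $$ (i,j))" if "i < n" "j < n" for i j
    unfolding AG using that slD[OF G] slD[OF a] slD[OF b]
    by (simp add: const_mat_def fls_X_power_times_conv_shift fls_X_times_conv_shift add.assoc)
  have M_nth: "fls_nth (M $$ (i,j)) (k + level e i j) = fls_nth (A $$ (i,j)) k" if "i < n" "j < n" for i j k
    unfolding MA using that AC by (simp add: eta_conj_index n level_def del: index_mult_mat(1))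
  show neg: "fls_nth (M $$ (i,j)) (k + level e i j) = 0" if "i < e + d" "j < e + d" "k < 0" for i j k
    using M_nth[of i j k] A_index[of i j] that n by simp
  have b': "graded_coeff e n 0 M = b"
    by (rule eq_matI) (use slD[OF b] in \<open>auto simp: M_nth[of _ _ 0, simplified] A_index\<close>)
  have a': "graded_coeff e n 1 M = a"
    by (rule eq_matI) (use slD[OF a] in \<open>auto simp: M_nth A_index\<close>)
  show "graded_coeff e (e + d) 1 M = bracket (transpose_mat K) (graded_coeff e (e + d) 0 M)"
    using omega_eq_trace_iff[OF K[folded n] a b] ab a' b' n by simp
  have MC: "M \<in> carrier_mat n n" unfolding MA n
    by (intro mult_carrier_mat[of _ _ "e + d"] eta_carrier AC[unfolded n])
  show "M \<in> sl (e + d)"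
    unfolding n[symmetric]
  proof (rule slI[OF MC], rule fls_eqI)
    fix k
    have "(\<Sum>i<n. fls_nth (M $$ (i,i)) k) = (\<Sum>i<n. fls_nth (A $$ (i,i)) k)"
    proof (intro sum.cong refl)
      fix i assume "i \<in> {..<n}"
      thus "fls_nth (M $$ (i,i)) k = fls_nth (A $$ (i,i)) k"
        using M_nth[of i i k] by (simp add: level_def)
    qed
    also have "\<dots> = (\<Sum>i<n. fls_nth (fps_to_fls (G $$ (i,i))) (k - 2)) +
      (if k = 1 then (\<Sum>i<n. a $$ (i,i)) else 0) + (if k = 0 then (\<Sum>i<n. b $$ (i,i)) else 0)"
      by (auto simp: A_index sum.distrib)
    also have "\<dots> = (\<Sum>i<n. fls_nth (fps_to_fls (G $$ (i,i))) (k - 2))"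
      using slD(4)[OF a] slD(4)[OF b] by simp
    also have "\<dots> = 0"
    proof (cases "k < 2")
      case False
      have "(\<Sum>i<n. fps_nth (G $$ (i,i)) (nat (k - 2))) = 0"
        using arg_cong[OF slD(4)[OF G], of "\<lambda>f. fps_nth f (nat (k - 2))"] by (simp add: fps_sum_nth)
      thus ?thesis using False by simp
    qed simp
    finally show "fls_nth (\<Sum>i<n. M $$ (i,i)) k = fls_nth 0 k" by (simp add: fls_nth_sum)
  qed
qed

lemma w_space_if_graded_coeff:
  assumes K: "K \<in> carrier_mat (e + d) (e + d)" and M: "M \<in> sl (e + d)"
    and neg: "\<And>i j k. i < e + d \<Longrightarrow> j < e + d \<Longrightarrow> k < 0 \<Longrightarrow> fls_nth (M $$ (i,j)) (k + level e i j) = 0"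
    and v: "graded_coeff e (e + d) 1 M = bracket (transpose_mat K) (graded_coeff e (e + d) 0 M)"
  shows "M \<in> w_space e d K"
proof -
  define n where n: "n = e + d"
  note Msl = M[folded n]
  let ?a = "graded_coeff e n 1 M" and ?b = "graded_coeff e n 0 M"
  \<comment> \<open>Everything beyond the first two graded coefficients.\<close>
  define G where "G = mat n n (\<lambda>(i,j). Abs_fps (\<lambda>k. fls_nth (M $$ (i,j)) (int k + 2 + level e i j)))"
  have G: "G \<in> sl n"
  proof (rule slI)
    show "(\<Sum>i<n. G $$ (i,i)) = 0"
    proof (rule fps_ext)
      fix k
      have "(\<Sum>i<n. fls_nth (M $$ (i,i)) (int k + 2)) = 0"
        using arg_cong[OF slD(4)[OF Msl], of "\<lambda>f. fls_nth f (int k + 2)"] by (simp add: fls_nth_sum)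
      thus "fps_nth (\<Sum>i<n. G $$ (i,i)) k = fps_nth 0 k"
        by (simp add: G_def fps_sum_nth level_def)
    qed
  qed (simp add: G_def)
  have ab: "\<forall>c\<in>sl n. tr (?a * c) = omega K ?b c"
    using omega_eq_trace_iff[OF K[folded n] graded_coeff_sl[OF Msl] graded_coeff_sl[OF Msl], of e 1 e 0] v n by simp
  define A where "A = fls_X ^ 2 \<cdot>\<^sub>m map_mat fps_to_fls G + (fls_X \<cdot>\<^sub>m const_mat ?a + const_mat ?b)"
  have "A \<in> w'_space n K"
    unfolding w'_space_def v_space_def A_def using G ab graded_coeff_sl[OF Msl] by blast
  moreover have AC: "A \<in> carrier_mat n n" by (simp add: A_def const_mat_def)
  moreover have "M = eta_inv e d * A * eta e d"
  proof (rule eq_matI)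
    fix i j assume "i < dim_row (eta_inv e d * A * eta e d)" "j < dim_col (eta_inv e d * A * eta e d)"
    hence ij: "i < n" "j < n" using eta_carrier[of e d] n by auto
    have A_index: "A $$ (i,j) = fls_shift (-2) (fps_to_fls (G $$ (i,j))) + fls_shift (-1) (fls_const (?a $$ (i,j)))
        + fls_const (?b $$ (i,j))"
      unfolding A_def using ij slD[OF G]
      by (simp add: const_mat_def fls_X_power_times_conv_shift fls_X_times_conv_shift add.assoc del: graded_coeff_index)
    have "A $$ (i,j) = fls_shift (level e i j) (M $$ (i,j))"
    proof (rule fls_eqI)
      fix k :: int
      consider "k < 0" | "k = 0" | "k = 1" | "k \<ge> 2" by linarith
      thus "fls_nth (A $$ (i,j)) k = fls_nth (fls_shift (level e i j) (M $$ (i,j))) k"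
        unfolding A_index using ij neg[of i j k] by cases (auto simp: G_def n)
    qed
    hence "M $$ (i,j) = fls_shift (level e j i) (A $$ (i,j))"
      by (simp add: level_def)
    thus "M $$ (i,j) = (eta_inv e d * A * eta e d) $$ (i,j)"
      using ij AC by (simp add: eta_conj_index n del: index_mult_mat(1))
  qed (use slD[OF Msl] eta_carrier[of e d] n in auto)
  ultimately show ?thesis unfolding w_space_def n by blast
qed

lemma res_form_index:
  assumes \<beta>: "\<beta> \<in> carrier_mat n n" and a: "a \<in> carrier_mat n n"
  shows "res_form \<beta> (fls_X_inv ^ m \<cdot>\<^sub>m const_mat a) =
    (\<Sum>i<n. \<Sum>j<n. fls_nth (\<beta> $$ (i,j)) (int m + 1) * a $$ (j,i))"
proof -
  have c: "fls_X_inv ^ m \<cdot>\<^sub>m const_mat a \<in> carrier_mat n n" using a by (simp add: const_mat_def)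
  show ?thesis
    unfolding res_form_def tr_mult[OF \<beta> c] fls_nth_sum
  proof (intro sum.cong refl)
    fix i j assume "i \<in> {..<n}" "j \<in> {..<n}"
    hence "\<beta> $$ (i,j) * (fls_X_inv ^ m \<cdot>\<^sub>m const_mat a) $$ (j,i) =
        fls_X_inv ^ m * (\<beta> $$ (i,j) * fls_const (a $$ (j,i)))"
      using a by (simp add: const_mat_def mult.left_commute)
    also have "\<dots> = fls_shift (int m) (\<beta> $$ (i,j) * fls_const (a $$ (j,i)))"
      by (rule fls_X_inv_power_times_conv_shift)
    finally show "fls_nth (\<beta> $$ (i,j) * (fls_X_inv ^ m \<cdot>\<^sub>m const_mat a) $$ (j,i)) 1 =
        fls_nth (\<beta> $$ (i,j)) (int m + 1) * a $$ (j,i)"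
      by (simp add: add.commute)
  qed
qed


text \<open>Equal pairings with \<open>sl[z]\<close> leave a difference \<open>D\<close> without negative powers of \<open>z\<close>. Then its first
  two graded coefficients are supported in the blocks of the transposed unknowns \<open>Q\<close> and \<open>V\<close> of
  \<open>parabolic_equation_injective\<close>, and all others vanish. So this is \<open>w \<inter> sl[z] = 0\<close>.\<close>
lemma w_space_determined_by_pairing:
  assumes ed: "e > 0" "d > 0" "coprime e d" and B: "basis_sl (e + d) B"
    and M: "M \<in> w_space e d (- J_mat e d)" "N \<in> w_space e d (- J_mat e d)"
    and eq: "\<And>\<alpha> m. \<alpha> \<in> B \<Longrightarrow> res_form M (fls_X_inv ^ m \<cdot>\<^sub>m const_mat \<alpha>) =
       res_form N (fls_X_inv ^ m \<cdot>\<^sub>m const_mat \<alpha>)"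
  shows "M = N"
proof -
  define n where n: "n = e + d"
  note J = J_mat_carrier[OF ed, folded n]
  have K: "- J_mat e d \<in> carrier_mat n n" using J by simp
  note wM = w_space_graded_coeff[OF M(1) K[unfolded n], folded n] and wN = w_space_graded_coeff[OF M(2) K[unfolded n], folded n]
  note C = slD(1)[OF wM(1)] slD(1)[OF wN(1)]
  define c where "c = (\<lambda>i j k. fls_nth (M $$ (i,j)) k - fls_nth (N $$ (i,j)) k)"
  have neg: "c i j (k + level e i j) = 0" if "i < n" "j < n" "k < 0" for i j k
    using wM(2) wN(2) that by (simp add: c_def)
  have tr0: "(\<Sum>i<n. c i i k) = 0" for k
    using arg_cong[OF slD(4)[OF wM(1)], of "\<lambda>f. fls_nth f k"] arg_cong[OF slD(4)[OF wN(1)], of "\<lambda>f. fls_nth f k"]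
    by (simp add: c_def fls_nth_sum sum_subtractf)
  have pos: "c i j (int m + 1) = 0" if ij: "i < n" "j < n" for i j m
  proof -
    let ?C = "mat n n (\<lambda>(i,j). c i j (int m + 1))"
    have pair: "(\<Sum>i<n. \<Sum>j<n. c i j (int m + 1) * \<alpha> $$ (j,i)) = 0" if \<alpha>: "\<alpha> \<in> B" for \<alpha>
    proof -
      have \<alpha>C: "\<alpha> \<in> carrier_mat n n" using basis_sl_properties(2)[OF B] \<alpha> by (auto simp: sl_def n)
      show ?thesis
        using eq[OF \<alpha>, of m] unfolding res_form_index[OF C(1) \<alpha>C] res_form_index[OF C(2) \<alpha>C]
        by (simp add: c_def left_diff_distrib sum_subtractf)
    qed
    have "?C = 0\<^sub>m n n"
    proof (rule trace_form_nondegenerate)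
      show "?C \<in> sl n" using tr0 by (intro slI) auto
      fix a :: "complex mat" assume a: "a \<in> sl n"
      obtain u where u: "\<And>i j. i < n \<Longrightarrow> j < n \<Longrightarrow> a $$ (i,j) = (\<Sum>\<alpha>\<in>B. u \<alpha> * \<alpha> $$ (i,j))"
        using basis_sl_properties(3)[OF B a[unfolded n]] unfolding n by blast
      have "tr (?C * a) = (\<Sum>i<n. \<Sum>j<n. ?C $$ (i,j) * a $$ (j,i))"
        by (rule tr_mult) (use slD(1)[OF a] in auto)
      also have "\<dots> = (\<Sum>i<n. \<Sum>j<n. \<Sum>\<alpha>\<in>B. u \<alpha> * (c i j (int m + 1) * \<alpha> $$ (j,i)))"
        by (intro sum.cong refl) (auto simp: u sum_distrib_left algebra_simps)
      also have "\<dots> = (\<Sum>i<n. \<Sum>\<alpha>\<in>B. \<Sum>j<n. u \<alpha> * (c i j (int m + 1) * \<alpha> $$ (j,i)))"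
        by (intro sum.cong refl sum.swap)
      also have "\<dots> = (\<Sum>\<alpha>\<in>B. \<Sum>i<n. \<Sum>j<n. u \<alpha> * (c i j (int m + 1) * \<alpha> $$ (j,i)))"
        by (rule sum.swap)
      also have "\<dots> = (\<Sum>\<alpha>\<in>B. u \<alpha> * (\<Sum>i<n. \<Sum>j<n. c i j (int m + 1) * \<alpha> $$ (j,i)))"
        by (simp add: sum_distrib_left)
      also have "\<dots> = 0" using pair by simp
      finally show "tr (?C * a) = 0" .
    qed
    hence "?C $$ (i,j) = 0" using ij by simp
    thus ?thesis using ij by simp
  qed
  have pos': "c i j k = 0" if "i < n" "j < n" "k > 0" for i j k
    using pos[OF that(1,2), of "nat (k - 1)"] that(3) by simp
  define Q where "Q = mat n n (\<lambda>(i,j). c j i (level e j i))"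
  define V where "V = mat n n (\<lambda>(i,j). c j i (1 + level e j i))"
  have Q: "Q \<in> carrier_mat n n" and V: "V \<in> carrier_mat n n" by (auto simp: Q_def V_def)
  have "Q = 0\<^sub>m n n" "V = 0\<^sub>m n n"
  proof -
    have Qsl: "Q \<in> sl n" using tr0[of 0] by (intro slI Q) (simp add: Q_def level_def)
    have up: "upr e n Q = 0\<^sub>m n n" by (rule eq_matI) (auto simp: Q_def level_def pos')
    have lw: "lwr e n V = V" by (rule eq_matI) (auto simp: V_def level_def pos')
    have "bracket Q (J_mat e d) + V = 0\<^sub>m n n"
    proof (rule eq_matI)
      fix i j assume "i < dim_row (0\<^sub>m n n :: complex mat)" "j < dim_col (0\<^sub>m n n :: complex mat)"
      hence ij: "i < n" "j < n" by auto
      have e: "fls_nth (L $$ (j,i)) (1 + level e j i) =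
        (\<Sum>k<n. J_mat e d $$ (i,k) * fls_nth (L $$ (j,k)) (level e j k)) -
        (\<Sum>k<n. fls_nth (L $$ (k,i)) (level e k i) * J_mat e d $$ (k,j))"
        if "graded_coeff e n 1 L = bracket (transpose_mat (- J_mat e d)) (graded_coeff e n 0 L)" for L
      proof -
        have "fls_nth (L $$ (j,i)) (1 + level e j i) = bracket (transpose_mat (- J_mat e d)) (graded_coeff e n 0 L) $$ (j,i)"
          using arg_cong[OF that, of "\<lambda>A. A $$ (j,i)"] ij by simp
        also have "\<dots> = (\<Sum>k<n. (- J_mat e d $$ (k,j)) * fls_nth (L $$ (k,i)) (level e k i)) -
           (\<Sum>k<n. fls_nth (L $$ (j,k)) (level e j k) * (- J_mat e d $$ (i,k)))"
          using ij J by (subst bracket_index[of _ n]) auto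
        finally show ?thesis by (simp add: sum_negf mult.commute)
      qed
      have "bracket Q (J_mat e d) $$ (i,j) = (\<Sum>k<n. c k i (level e k i) * J_mat e d $$ (k,j)) -
          (\<Sum>k<n. J_mat e d $$ (i,k) * c j k (level e j k))"
        using ij by (subst bracket_index[OF Q J]) (auto simp: Q_def)
      also have "\<dots> = - c j i (1 + level e j i)"
      proof -
        have "(\<Sum>k<n. c k i (level e k i) * J_mat e d $$ (k,j)) =
            (\<Sum>k<n. fls_nth (M $$ (k,i)) (level e k i) * J_mat e d $$ (k,j)) -
            (\<Sum>k<n. fls_nth (N $$ (k,i)) (level e k i) * J_mat e d $$ (k,j))"
          "(\<Sum>k<n. J_mat e d $$ (i,k) * c j k (level e j k)) =
            (\<Sum>k<n. J_mat e d $$ (i,k) * fls_nth (M $$ (j,k)) (level e j k)) -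
            (\<Sum>k<n. J_mat e d $$ (i,k) * fls_nth (N $$ (j,k)) (level e j k))"
          by (simp_all add: c_def left_diff_distrib right_diff_distrib sum_subtractf)
        thus ?thesis unfolding c_def e[OF wM(3)] e[OF wN(3)] by simp
      qed
      finally show "(bracket Q (J_mat e d) + V) $$ (i,j) = 0\<^sub>m n n $$ (i,j)"
        using ij V by (simp add: V_def)
    qed (use V in auto)
    thus "Q = 0\<^sub>m n n" "V = 0\<^sub>m n n" using parabolic_equation_injective[OF ed n Qsl up V lw] by auto
  qed note QV = this
  have "c i j k = 0" if ij: "i < n" "j < n" for i j k
  proof -
    have "Q $$ (j,i) = 0" "V $$ (j,i) = 0" using ij unfolding QV by auto
    hence 0: "c i j (level e i j) = 0" "c i j (1 + level e i j) = 0" using ij by (auto simp: Q_def V_def)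
    have "level e i j \<ge> -1" by (simp add: level_def)
    hence "k < level e i j \<or> k = level e i j \<or> k = 1 + level e i j \<or> k > 0" by linarith
    thus ?thesis using 0 pos'[OF ij] neg[OF ij, of "k - level e i j"] by auto
  qed
  hence "M $$ (i,j) = N $$ (i,j)" if "i < n" "j < n" for i j
    using that by (intro fls_eqI) (simp add: c_def)
  thus "M = N" using C by (intro eq_matI) auto
qed

text \<open>The dual element for the traceless matrix \<open>g\<^sup>t\<close> at \<open>z\<^sup>m\<close>: it is \<open>g\<^sup>t z\<^sup>-\<^sup>m\<^sup>-\<^sup>1\<close>, which has the right
  pairings with \<open>sl[z]\<close>, plus the transposed correction, a polynomial in \<open>z\<close> that pairs to zero and
  moves the sum into \<open>w_space\<close>.\<close>
definition dual_series ::
  "nat \<Rightarrow> nat \<Rightarrow> (nat \<Rightarrow> complex mat \<Rightarrow> complex mat) \<Rightarrow> (nat \<Rightarrow> complex mat \<Rightarrow> complex mat) \<Rightarrow>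
   nat \<Rightarrow> complex mat \<Rightarrow> complex fls mat" where
  "dual_series e n q b m g = mat n n (\<lambda>(i,j). fls_shift (- int (Suc m)) (fls_const (g $$ (j,i)))
     + fls_const ((diag e n (q m g) + b m g) $$ (j,i)) + fls_shift 1 (fls_const (lwr e n (q m g) $$ (j,i))))"

lemma dual_series_nth:
  "i < n \<Longrightarrow> j < n \<Longrightarrow> fls_nth (dual_series e n q b m g $$ (i,j)) k =
    (if k = int (Suc m) then g $$ (j,i) else 0) + (if k = 0 then (diag e n (q m g) + b m g) $$ (j,i) else 0)
    + (if k = -1 then lwr e n (q m g) $$ (j,i) else 0)"
  by (auto simp: dual_series_def simp del: mask_index index_add_mat(1))

text \<open>The graded coefficients 0 and 1 are the transposes of \<open>P\<close> and \<open>R\<close> below. As \<open>K = - J\<close>, the relation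
  \<open>a = [K\<^sup>t,b]\<close> is the transpose of \<open>[P,J] + R = 0\<close>, which is the equation of \<open>correction_maps\<close>
  for \<open>m\<close>.\<close>
lemma dual_series_in_w_space:
  assumes ed: "e > 0" "d > 0" "coprime e d" and cm: "correction_maps e d q b"
    and g: "g \<in> sl (e + d)"
  shows "dual_series e (e + d) q b m g \<in> w_space e d (- J_mat e d)"
proof -
  define n where n: "n = e + d"
  note J = J_mat_carrier[OF ed, folded n]
  let ?M = "dual_series e n q b m g"
  have cmg: "q m g \<in> sl n" "upr e n (q m g) = 0\<^sub>m n n" "lwr e n (b m g) = b m g"
    using cm g by (auto simp: correction_maps_def n)
  note gsl = g[folded n]
  note gC = slD(1)[OF gsl] and qC = slD(1)[OF cmg(1)]
  have bC: "b m g \<in> carrier_mat n n" using mask_carrier(1)[of _ n "b m g"] cmg(3) by metis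
  have q0: "q m g $$ (i,j) = 0" if "i < n" "j < n" "i < e" "e \<le> j" for i j
    using arg_cong[OF cmg(2), of "\<lambda>A. A $$ (i,j)"] that by simp
  have b0: "b m g $$ (i,j) = 0" if "i < n" "j < n" "\<not> (e \<le> i \<and> j < e)" for i j
  proof -
    have "b m g $$ (i,j) = lwr e n (b m g) $$ (i,j)" using cmg(3) by simp
    also have "\<dots> = 0" using that by auto
    finally show ?thesis .
  qed
  define P where "P = q m g + (if m = 0 then upr e n g else 0\<^sub>m n n)"
  define R where "R = b m g + (if m = 0 then diag e n g else if m = 1 then upr e n g else 0\<^sub>m n n)"
  have P: "P \<in> carrier_mat n n" and R: "R \<in> carrier_mat n n" using qC bC by (auto simp: P_def R_def)
  have PR: "bracket P (J_mat e d) + R = 0\<^sub>m n n"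
  proof -
    consider "m = 0" | "m = 1" | "m \<ge> 2" by linarith
    thus ?thesis
    proof cases
      case 1
      have "bracket (q 0 g + upr e n g) (J_mat e d) + b 0 g + diag e n g = 0\<^sub>m n n"
        using cm g by (auto simp: correction_maps_def n)
      thus ?thesis using bC J qC by (simp add: P_def R_def 1 assoc_add_mat[of _ n n])
    next
      case 2
      have "bracket (q 1 g) (J_mat e d) + b 1 g + upr e n g = 0\<^sub>m n n"
        using cm g by (auto simp: correction_maps_def n)
      thus ?thesis using bC J qC by (simp add: P_def R_def 2 assoc_add_mat[of _ n n])
    next
      case 3
      hence "q m g = 0\<^sub>m n n" "b m g = 0\<^sub>m n n" using cm g by (auto simp: correction_maps_def n)
      thus ?thesis using J 3 by (simp add: P_def R_def bracket_def) (rule eq_matI; simp)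
    qed
  qed
  have "?M \<in> w_space e d (- J_mat e d)"
  proof (rule w_space_if_graded_coeff, unfold n[symmetric])
    show K: "- J_mat e d \<in> carrier_mat n n" using J by simp
    show "?M \<in> sl n"
    proof (rule slI, simp add: dual_series_def, rule fls_eqI)
      fix k
      have "fls_nth (\<Sum>i<n. ?M $$ (i,i)) k = (\<Sum>i<n. (if k = int (Suc m) then g $$ (i,i) else 0)
          + (if k = 0 then q m g $$ (i,i) else 0))"
        unfolding fls_nth_sum
        by (intro sum.cong refl) (use bC b0 in \<open>auto simp: dual_series_nth\<close>)
      also have "\<dots> = (if k = int (Suc m) then (\<Sum>i<n. g $$ (i,i)) else 0) + (if k = 0 then (\<Sum>i<n. q m g $$ (i,i)) else 0)"
        by (simp add: sum.distrib)
      also have "\<dots> = 0" using slD(4)[OF gsl] slD(4)[OF cmg(1)] by simp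
      finally show "fls_nth (\<Sum>i<n. ?M $$ (i,i)) k = fls_nth 0 k" by simp
    qed
    show "fls_nth (?M $$ (i,j)) (k + level e i j) = 0" if "i < n" "j < n" "k < 0" for i j k
      unfolding dual_series_nth[OF that(1,2)] using that bC b0
      by (cases rule: level_cases[of i e j]) auto
    have w0: "graded_coeff e n 0 ?M $$ (i,j) = P $$ (j,i)" if "i < n" "j < n" for i j
      using that bC qC b0 q0
      by (cases rule: level_cases[of i e j]) (auto simp: dual_series_nth P_def)
    have w1: "graded_coeff e n 1 ?M $$ (i,j) = R $$ (j,i)" if "i < n" "j < n" for i j
      using that bC qC b0 q0
      by (cases rule: level_cases[of i e j]) (auto simp: dual_series_nth R_def)
    have KC: "transpose_mat (- J_mat e d) \<in> carrier_mat n n" using K by simp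
    show "graded_coeff e n 1 ?M = bracket (transpose_mat (- J_mat e d)) (graded_coeff e n 0 ?M)"
    proof (rule eq_matI)
      fix i j assume "i < dim_row (bracket (transpose_mat (- J_mat e d)) (graded_coeff e n 0 ?M))"
        "j < dim_col (bracket (transpose_mat (- J_mat e d)) (graded_coeff e n 0 ?M))"
      hence ij: "i < n" "j < n" using carrier_matD[OF bracket_carrier[OF KC graded_coeff_carrier(1)]] by auto
      have "bracket (transpose_mat (- J_mat e d)) (graded_coeff e n 0 ?M) $$ (i,j) =
        (\<Sum>k<n. - (P $$ (j,k) * J_mat e d $$ (k,i))) - (\<Sum>k<n. - (J_mat e d $$ (j,k) * P $$ (k,i)))"
        unfolding bracket_index[OF KC graded_coeff_carrier(1) ij]
        using ij J by (intro arg_cong2[where f="(-)"] sum.cong refl) (auto simp: w0 simp del: graded_coeff_index)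
      also have "\<dots> = - bracket P (J_mat e d) $$ (j,i)"
        unfolding bracket_index[OF P J ij(2,1)] by (simp add: sum_negf)
      also have "\<dots> = R $$ (j,i)"
      proof -
        have "bracket P (J_mat e d) $$ (j,i) + R $$ (j,i) = 0"
          using arg_cong[OF PR, of "\<lambda>A. A $$ (j,i)"] ij R by simp
        thus ?thesis by (metis add.commute eq_neg_iff_add_eq_0)
      qed
      finally show "graded_coeff e n 1 ?M $$ (i,j) = bracket (transpose_mat (- J_mat e d)) (graded_coeff e n 0 ?M) $$ (i,j)"
        using w1[OF ij] by simp
    qed (use carrier_matD[OF bracket_carrier[OF KC graded_coeff_carrier(1)]] in auto)
  qed
  thus ?thesis by (simp add: n)
qed

lemma dual_elt_eq:
  assumes ed: "e > 0" "d > 0" "coprime e d" and cm: "correction_maps e d q b"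
    and B: "basis_sl (e + d) B" and \<beta>: "\<beta> \<in> sl (e + d)"
    and dual: "\<And>\<alpha>'. \<alpha>' \<in> B \<Longrightarrow> tr (\<beta> * \<alpha>') = (if \<alpha>' = \<alpha> then 1 else 0)"
  shows "dual_elt e d (- J_mat e d) B \<alpha> m = dual_series e (e + d) q b m (transpose_mat \<beta>)"
proof -
  define n where n: "n = e + d"
  let ?M = "dual_series e n q b m (transpose_mat \<beta>)"
  note \<beta>C = slD(1)[OF \<beta>[folded n]]
  have g: "transpose_mat \<beta> \<in> sl n" using slD[OF \<beta>[folded n]] by (intro slI) auto
  have w: "?M \<in> w_space e d (- J_mat e d)"
    using dual_series_in_w_space[OF ed cm g[unfolded n]] by (simp add: n)
  have pair: "res_form ?M (fls_X_inv ^ m' \<cdot>\<^sub>m const_mat \<alpha>') = (if \<alpha>' = \<alpha> \<and> m' = m then 1 else 0)"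
    if \<alpha>': "\<alpha>' \<in> B" for \<alpha>' m'
  proof -
    have \<alpha>C: "\<alpha>' \<in> carrier_mat n n" using basis_sl_properties(2)[OF B] \<alpha>' by (auto simp: sl_def n)
    have "res_form ?M (fls_X_inv ^ m' \<cdot>\<^sub>m const_mat \<alpha>') =
       (\<Sum>i<n. \<Sum>j<n. fls_nth (?M $$ (i,j)) (int m' + 1) * \<alpha>' $$ (j,i))"
      by (rule res_form_index[OF _ \<alpha>C]) (simp add: dual_series_def)
    also have "\<dots> = (\<Sum>i<n. \<Sum>j<n. (if m' = m then \<beta> $$ (i,j) else 0) * \<alpha>' $$ (j,i))"
      by (intro sum.cong refl arg_cong2[where f="(*)"]) (use \<beta>C in \<open>auto simp: dual_series_nth simp del: mask_index index_add_mat(1)\<close>)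
    also have "\<dots> = (if m' = m then tr (\<beta> * \<alpha>') else 0)"
      by (simp add: tr_mult[OF \<beta>C \<alpha>C])
    finally show ?thesis using dual[OF \<alpha>'] by auto
  qed
  show ?thesis
    unfolding dual_elt_def n[symmetric]
  proof (rule the_equality)
    show "?M \<in> w_space e d (- J_mat e d) \<and> (\<forall>\<alpha>'\<in>B. \<forall>m'. res_form ?M (fls_X_inv ^ m' \<cdot>\<^sub>m const_mat \<alpha>') =
        (if \<alpha>' = \<alpha> \<and> m' = m then 1 else 0))"
      using w pair by blast
  next
    fix N assume "N \<in> w_space e d (- J_mat e d) \<and> (\<forall>\<alpha>'\<in>B. \<forall>m'. res_form N (fls_X_inv ^ m' \<cdot>\<^sub>m const_mat \<alpha>') =
        (if \<alpha>' = \<alpha> \<and> m' = m then 1 else 0))"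
    thus "N = ?M" using w pair by (intro w_space_determined_by_pairing[OF ed B]) auto
  qed
qed

lemma dual_series_eval:
  assumes "b m g \<in> carrier_mat n n" "i < n" "j < n" "t \<noteq> 0"
  shows "fls_eval_mat t (dual_series e n q b m g) $$ (i,j) =
    g $$ (j,i) / t ^ Suc m + correction_at e n q b m t g $$ (j,i)"
proof -
  have r: "fls_conv_radius (fls_shift k (fls_const c)) = \<infinity>" "fls_conv_radius (fls_const c) = \<infinity>"
    for c :: complex and k by simp_all
  have r2: "fls_conv_radius (F + G) = \<infinity>" if "fls_conv_radius F = \<infinity>" "fls_conv_radius G = \<infinity>" for F G :: "complex fls"
    using fls_conv_radius_add[of F G] that by simp
  have "fls_eval_mat t (dual_series e n q b m g) $$ (i,j) =
     eval_fls (fls_shift (- int (Suc m)) (fls_const (g $$ (j,i)))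
     + fls_const ((diag e n (q m g) + b m g) $$ (j,i)) + fls_shift 1 (fls_const (lwr e n (q m g) $$ (j,i)))) (inverse t)"
    using assms by (simp add: fls_eval_mat_def dual_series_def del: mask_index index_add_mat(1))
  also have "\<dots> = g $$ (j,i) * inverse t powi int (Suc m) + (diag e n (q m g) + b m g) $$ (j,i)
      + lwr e n (q m g) $$ (j,i) * inverse t powi (-1)"
    using assms(4) by (simp add: eval_fls_add eval_fls_shift r r2 del: mask_index index_add_mat(1) of_nat_Suc)
  also have "inverse t powi int (Suc m) = 1 / t ^ Suc m"
    unfolding power_int_of_nat by (simp add: power_inverse field_simps)
  also have "inverse t powi (-1) = t" using assms(4) by (simp add: power_int_minus)
  finally show ?thesis
    using assms(1-3) by (simp add: correction_at_def mult.commute del: mask_index)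
qed

section \<open>Summation of the series\<close>

lemma poly2_simps:
  "poly2 (P + Q) x y = poly2 P x y + poly2 Q x y" "poly2 (P - Q) x y = poly2 P x y - poly2 Q x y"
  "poly2 (P * Q) x y = poly2 P x y * poly2 Q x y"
  "poly2 [:[:c:]:] x y = c" "poly2 [:[:0, 1:]:] x y = x" "poly2 [:0, 1:] x y = y"
  by (simp_all add: poly2_def)

lemma poly2_eq_poly_map_poly: "poly2 R x y = poly (map_poly (\<lambda>p. poly p x) R) y"
  by (induction R) (simp_all add: poly2_def map_poly_pCons)

text \<open>For fixed \<open>t \<noteq> 0\<close> the polynomial in \<open>s\<close> has a disc of zeros, so it vanishes; then for fixed \<open>s\<close>
  the polynomial in \<open>t\<close> vanishes on all of \<open>t \<noteq> 0\<close>.\<close>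
lemma poly2_zero_on_region:
  assumes "\<And>s t. norm s < norm t \<Longrightarrow> poly2 R s t = 0"
  shows "poly2 R x y = 0"
proof -
  have *: "poly2 R s t = 0" if "t \<noteq> 0" for s t
  proof -
    have "infinite (ball 0 (norm t) :: complex set)"
      using that uncountable_ball[of "norm t" "0 :: complex"] countable_finite by auto
    moreover have "ball 0 (norm t) \<subseteq> {s. poly (poly R [:t:]) s = 0}"
      using assms by (auto simp: poly2_def)
    ultimately have "poly R [:t:] = 0" using poly_roots_finite finite_subset by blast
    thus ?thesis by (simp add: poly2_def)
  qed
  have "UNIV - {0} \<subseteq> {t. poly (map_poly (\<lambda>p. poly p x) R) t = 0}"
    using * by (auto simp: poly2_eq_poly_map_poly)
  moreover have "infinite (UNIV - {0 :: complex})" by (simp add: infinite_UNIV_char_0)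
  ultimately have "map_poly (\<lambda>p. poly p x) R = 0" using poly_roots_finite finite_subset by blast
  thus ?thesis by (simp add: poly2_eq_poly_map_poly)
qed

text \<open>Two rational functions that represent the sum of the series on the region agree wherever both are
  defined, as one sees by clearing denominators.\<close>
lemma rational_suminf_eq:
  assumes PQ: "\<And>s t. norm s < norm t \<Longrightarrow> poly2 Q s t \<noteq> 0"
    "\<And>s t. norm s < norm t \<Longrightarrow> (\<lambda>m. f m s t) sums (poly2 P s t / poly2 Q s t)"
    and Qxy: "poly2 Q x y \<noteq> 0"
  shows "rational_suminf f x y = poly2 P x y / poly2 Q x y"
  unfolding rational_suminf_def
proof (rule the_equality)
  show "\<exists>P' Q'. (\<forall>s t. norm s < norm t \<longrightarrow> poly2 Q' s t \<noteq> 0 \<and> (\<lambda>m. f m s t) sums (poly2 P' s t / poly2 Q' s t)) \<and>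
      poly2 Q' x y \<noteq> 0 \<and> poly2 P x y / poly2 Q x y = poly2 P' x y / poly2 Q' x y"
    using assms by blast
next
  fix v assume "\<exists>P' Q'. (\<forall>s t. norm s < norm t \<longrightarrow> poly2 Q' s t \<noteq> 0 \<and> (\<lambda>m. f m s t) sums (poly2 P' s t / poly2 Q' s t)) \<and>
      poly2 Q' x y \<noteq> 0 \<and> v = poly2 P' x y / poly2 Q' x y"
  then obtain P' Q' where 1: "\<And>s t. norm s < norm t \<Longrightarrow> poly2 Q' s t \<noteq> 0"
      "\<And>s t. norm s < norm t \<Longrightarrow> (\<lambda>m. f m s t) sums (poly2 P' s t / poly2 Q' s t)"
    and 2: "poly2 Q' x y \<noteq> 0" "v = poly2 P' x y / poly2 Q' x y" by blast
  have "poly2 (P' * Q - P * Q') s t = 0" if "norm s < norm t" for s t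
  proof -
    have "poly2 P' s t / poly2 Q' s t = poly2 P s t / poly2 Q s t"
      using 1(2)[OF that] PQ(2)[OF that] by (rule sums_unique2)
    thus ?thesis using 1(1)[OF that] PQ(1)[OF that] by (simp add: poly2_simps frac_eq_eq)
  qed
  hence "poly2 (P' * Q - P * Q') x y = 0" by (rule poly2_zero_on_region)
  thus "v = poly2 P x y / poly2 Q x y" using 2 Qxy by (simp add: poly2_simps frac_eq_eq)
qed

lemma unit_sl_transpose: "transpose_mat (unit_sl n j i) = unit_sl n i j"
  by (rule eq_matI) (auto simp: unit_sl_index)

text \<open>Dual elements depend linearly on the dual basis, so summation over \<open>B\<close> evaluates them at the
  coordinates of the Casimir tensor, which are projected matrix units.\<close>
lemma r_stolin_term_index:
  assumes ed: "e > 0" "d > 0" "coprime e d" and cm: "correction_maps e d q b"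
    and B: "basis_sl (e + d) B" and t: "t \<noteq> 0"
    and ijkl: "i < e + d" "j < e + d" "k < e + d" "l < e + d"
  shows "r_stolin_term e d (- J_mat e d) B m s t (i,j,k,l) =
    s ^ m * (unit_sl (e + d) i j $$ (l,k) / t ^ Suc m + correction_at e (e + d) q b m t (unit_sl (e + d) i j) $$ (l,k))"
proof -
  define n where n: "n = e + d"
  note ijkl' = ijkl[folded n] and Bn = B[folded n]
  obtain \<beta> where \<beta>: "\<And>\<alpha>. \<alpha> \<in> B \<Longrightarrow> \<beta> \<alpha> \<in> sl n"
    "\<And>\<alpha> \<alpha>'. \<alpha> \<in> B \<Longrightarrow> \<alpha>' \<in> B \<Longrightarrow> tr (\<beta> \<alpha> * \<alpha>') = (if \<alpha>' = \<alpha> then 1 else 0)"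
    "\<And>i j p q. i < n \<Longrightarrow> j < n \<Longrightarrow> p < n \<Longrightarrow> q < n \<Longrightarrow>
      (\<Sum>\<alpha>\<in>B. \<alpha> $$ (i,j) * \<beta> \<alpha> $$ (p,q)) = unit_sl n j i $$ (p,q)"
    by (rule trace_dual_basis[OF Bn]) (assumption | rule that)+
  let ?c = "correction_at e n q b m t"
  have lin: "lin_map n (\<lambda>g. ?c (transpose_mat g))"
    using lin_map_comp[OF correction_at_lin_map[OF cm, folded n] lin_map_transpose] .
  have blin: "lin_map n (b m)" using cm by (auto simp: correction_maps_def n)
  have ev: "fls_eval_mat t (dual_elt e d (- J_mat e d) B \<alpha> m) $$ (k,l) =
     \<beta> \<alpha> $$ (k,l) / t ^ Suc m + ?c (transpose_mat (\<beta> \<alpha>)) $$ (l,k)" if \<alpha>: "\<alpha> \<in> B" for \<alpha>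
  proof -
    note C = slD(1)[OF \<beta>(1)[OF \<alpha>]]
    have "dual_elt e d (- J_mat e d) B \<alpha> m = dual_series e n q b m (transpose_mat (\<beta> \<alpha>))"
      unfolding n by (rule dual_elt_eq[OF ed cm B \<beta>(1)[OF \<alpha>, unfolded n] \<beta>(2)[OF \<alpha>]])
    thus ?thesis
      using dual_series_eval[of b m "transpose_mat (\<beta> \<alpha>)" n k l t e q] lin_map_carrier[OF blin, of "transpose_mat (\<beta> \<alpha>)"]
        C ijkl' t by simp
  qed
  have fin: "finite B" by (rule basis_sl_properties(1)[OF B])
  have "(\<Sum>\<alpha>\<in>B. tens n \<alpha> (fls_eval_mat t (dual_elt e d (- J_mat e d) B \<alpha> m)) (i,j,k,l)) =
     (\<Sum>\<alpha>\<in>B. \<alpha> $$ (i,j) * \<beta> \<alpha> $$ (k,l) / t ^ Suc m + \<alpha> $$ (i,j) * ?c (transpose_mat (\<beta> \<alpha>)) $$ (l,k))"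
    by (intro sum.cong refl) (use ijkl' ev in \<open>simp add: tens_index algebra_simps\<close>)
  also have "\<dots> = (\<Sum>\<alpha>\<in>B. \<alpha> $$ (i,j) * \<beta> \<alpha> $$ (k,l)) / t ^ Suc m
      + (\<Sum>\<alpha>\<in>B. \<alpha> $$ (i,j) * ?c (transpose_mat (\<beta> \<alpha>)) $$ (l,k))"
    by (simp add: sum.distrib sum_divide_distrib)
  also have "(\<Sum>\<alpha>\<in>B. \<alpha> $$ (i,j) * \<beta> \<alpha> $$ (k,l)) = unit_sl n i j $$ (l,k)"
    unfolding \<beta>(3)[OF ijkl'] using ijkl' by (auto simp: unit_sl_index)
  also have "(\<Sum>\<alpha>\<in>B. \<alpha> $$ (i,j) * ?c (transpose_mat (\<beta> \<alpha>)) $$ (l,k)) = ?c (transpose_mat (unit_sl n j i)) $$ (l,k)"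
    by (rule lin_map_combination[OF lin fin, symmetric]) (use ijkl' \<beta>(3) slD(1)[OF \<beta>(1)] in auto)
  finally show ?thesis by (simp add: r_stolin_term_def n unit_sl_transpose)
qed

lemma geometric_sums_kernel:
  fixes s t :: complex
  assumes "norm s < norm t"
  shows "(\<lambda>m. s ^ m * (u / t ^ Suc m)) sums (u / (t - s))"
proof -
  have t: "t \<noteq> 0" using assms by auto
  have "norm (s / t) < 1" using assms t by (simp add: norm_divide)
  hence "(\<lambda>m. (u / t) * (s / t) ^ m) sums ((u / t) * (1 / (1 - s / t)))"
    by (intro sums_mult geometric_sums)
  moreover have "(u / t) * (s / t) ^ m = s ^ m * (u / t ^ Suc m)" for m
    by (simp add: power_divide)
  moreover have "(u / t) * (1 / (1 - s / t)) = u / (t - s)"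
    using t by (simp add: field_simps)
  ultimately show ?thesis by (simp only:)
qed

text \<open>The leading terms of the dual elements sum to the geometric series of \<open>1 / (t - s)\<close>, and only
  finitely many corrections are non-zero. The denominator \<open>t - s\<close> is common to all entries.\<close>
lemma r_stolin_index:
  assumes ed: "e > 0" "d > 0" "coprime e d" and cm: "correction_maps e d q b"
    and B: "basis_sl (e + d) B" and xy: "x \<noteq> y"
  shows "r_stolin e d (- J_mat e d) B x y = (\<lambda>(i,j,k,l).
     if i < e + d \<and> j < e + d \<and> k < e + d \<and> l < e + d then
       unit_sl (e + d) i j $$ (l,k) / (y - x)
        + (correction_at e (e + d) q b 0 y (unit_sl (e + d) i j) $$ (l,k)
        + x * correction_at e (e + d) q b 1 y (unit_sl (e + d) i j) $$ (l,k))
     else 0)"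
proof (rule ext, clarify)
  fix i j k l
  define n where n: "n = e + d"
  let ?f = "\<lambda>m s t. r_stolin_term e d (- J_mat e d) B m s t (i,j,k,l)"
  show "r_stolin e d (- J_mat e d) B x y (i,j,k,l) = (if i < e + d \<and> j < e + d \<and> k < e + d \<and> l < e + d then
       unit_sl (e + d) i j $$ (l,k) / (y - x)
        + (correction_at e (e + d) q b 0 y (unit_sl (e + d) i j) $$ (l,k)
        + x * correction_at e (e + d) q b 1 y (unit_sl (e + d) i j) $$ (l,k))
     else 0)"
  proof (cases "i < e + d \<and> j < e + d \<and> k < e + d \<and> l < e + d")
    case False
    hence "?f = (\<lambda>m s t. 0)" by (auto simp: r_stolin_term_def tens_def fun_eq_iff)
    hence "r_stolin e d (- J_mat e d) B x y (i,j,k,l) = poly2 [:[:0:]:] x y / poly2 [:[:1:]:] x y"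
      unfolding r_stolin_def by (simp only:) (rule rational_suminf_eq, simp_all only: poly2_simps, auto)
    thus ?thesis unfolding if_not_P[OF False] by (simp only: poly2_simps div_by_1)
  next
    case True
    hence *: "i < n" "j < n" "k < n" "l < n" by (auto simp: n)
    let ?g = "unit_sl n i j"
    have g: "?g \<in> sl n" using * by (intro unit_sl_in_sl)
    define u where "u = ?g $$ (l,k)"
    define p where "p = (\<lambda>m. (diag e n (q m ?g) + b m ?g) $$ (l,k))"
    define r where "r = (\<lambda>m. lwr e n (q m ?g) $$ (l,k))"
    have bC: "b m ?g \<in> carrier_mat n n" for m
      using cm lin_map_carrier[of n "b m" ?g] by (auto simp: correction_maps_def n)
    have cv: "correction_at e n q b m t ?g $$ (l,k) = p m + t * r m" for m t
      using * bC[of m] by (simp add: correction_at_def p_def r_def del: mask_index)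
    have pr0: "p m = 0" "r m = 0" if "m \<ge> 2" for m
    proof -
      have "q m ?g = 0\<^sub>m n n" "b m ?g = 0\<^sub>m n n"
        using cm g that by (auto simp: correction_maps_def n)
      thus "p m = 0" "r m = 0" using * by (simp_all add: p_def r_def)
    qed
    let ?S = "[:[:0,1:]:] :: complex poly poly" and ?T = "[:0,1:] :: complex poly poly"
    \<comment> \<open>In \<open>poly2\<close> the inner variable stands for \<open>s\<close> and the outer one for \<open>t\<close>.\<close>
    define Q where "Q = ?T - ?S"
    define P where "P = [:[:u:]:] + Q * (([:[:p 0:]:] + ?T * [:[:r 0:]:]) + ?S * ([:[:p 1:]:] + ?T * [:[:r 1:]:]))"
    have P: "poly2 P s t = u + (t - s) * ((p 0 + t * r 0) + s * (p 1 + t * r 1))"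
      and Q: "poly2 Q s t = t - s" for s t
      unfolding P_def Q_def by (simp_all only: poly2_simps)
    have PQ: "poly2 P s t / poly2 Q s t = u / (t - s) + ((p 0 + t * r 0) + s * (p 1 + t * r 1))"
      if "s \<noteq> t" for s t
      unfolding P Q using that by (simp add: add_divide_distrib)
    have "rational_suminf ?f x y = poly2 P x y / poly2 Q x y"
    proof (rule rational_suminf_eq)
      fix s t :: complex assume st: "norm s < norm t"
      hence t: "t \<noteq> 0" and ne: "s \<noteq> t" by auto
      show "poly2 Q s t \<noteq> 0" using ne by (simp add: Q)
      have "(\<lambda>m. s ^ m * (p m + t * r m)) sums (\<Sum>m<2. s ^ m * (p m + t * r m))"
        by (intro sums_finite) (auto simp: pr0)
      hence "(\<lambda>m. s ^ m * (u / t ^ Suc m) + s ^ m * (p m + t * r m)) sums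
         (u / (t - s) + (\<Sum>m<2. s ^ m * (p m + t * r m)))"
        by (intro sums_add geometric_sums_kernel st)
      moreover have "?f m s t = s ^ m * (u / t ^ Suc m) + s ^ m * (p m + t * r m)" for m
        unfolding r_stolin_term_index[OF ed cm B t *[unfolded n]] n[symmetric] cv u_def
        by (rule distrib_left)
      ultimately show "(\<lambda>m. ?f m s t) sums (poly2 P s t / poly2 Q s t)"
        unfolding PQ[OF ne] by (simp add: numeral_2_eq_2)
    next
      show "poly2 Q x y \<noteq> 0" using xy by (simp add: Q)
    qed
    thus ?thesis
      using True unfolding r_stolin_def PQ[OF xy] n[symmetric] cv u_def by simp
  qed
qed

theorem theorem9p8:
  fixes e d :: nat and B :: "complex mat set" and x y :: complex
  assumes "e > 0" and "d > 0" and "coprime e d"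
    and "basis_sl (e + d) B"
    and "x \<noteq> y"
  shows "tensor_map (e + d) phi phi (r_cusp e d x y) = r_stolin e d (- J_mat e d) B x y"
proof -
  obtain q b where "correction_maps e d q b"
    using correction_maps_exist[OF assms(1-3)] by blast
  thus ?thesis using r_cusp_index r_stolin_index assms by simp
qed

end
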